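(* For every $\epsilon>0$, letting $P_{n,d}(\epsilon):=\{p\in P_{n,d}:\mathsf d_{\mathrm{FS}}(p,\Delta_{n,d})\ge\epsilon\}$, the identity map $\mathrm{id}:(P_{n,d}(\epsilon),\mathsf d_{\mathrm{FS}})\to(P_{n,d}(\epsilon),W_2^{\mathrm{in}})$ is Lipschitz. In particular $P_{n,d}(\epsilon)$ is compact in the $W_2^{\mathrm{in}}$-topology.
   Context: $P_{n,d}$ is the projectivization of the space of complex homogeneous polynomials of degree $d$ in $n+1$ variables, $\Delta_{n,d}$ its discriminant (classes of polynomials with a singular projective zero). $\mathsf d_{\mathrm{FS}}$ is the Fubini–Study distance on $P_{n,d}\cong\mathbb{C}\mathrm{P}^N$ induced by the Bombieri–Weyl Hermitian product (monomials $\sqrt{d!/(\alpha_0!\cdots\alpha_n!)}z^\alpha$ orthonormal). $W_2^{\mathrm{in}}$ is the inner Wasserstein distance on $P_{n,d}$: with $\mu(p)\in\mathscr{P}(\mathbb{C}\mathrm{P}^n)$ defined by $\int f\,\mathrm{d}\mu(p)=\frac1d\int_{\mathbb{G}(1,n)}\sum_{z\in Z(p)\cap\ell}m_z(p|_\ell)f(z)\,\mathrm{vol}_{\mathbb{G}(1,n)}(\mathrm{d}\ell)$, a curve $\gamma$ is admissible if $\mu\circ\gamma$ is 2-absolutely continuous in $(\mathscr{P}(\mathbb{C}\mathrm{P}^n),W_2)$ (Fubini–Study cost), $\mathcal{E}(\gamma)=\int_0^1|\dot\mu_t|^2\mathrm{d}t$ with $|\dot\mu_t|$ the $W_2$ metric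 speed, and $W_2^{\mathrm{in}}(p_0,p_1)=\inf\mathcal{E}(\gamma)^{1/2}$ over admissible curves from $p_0$ to $p_1$. *)

theory Defs
  imports "HOL-Analysis.Analysis" "HOL-Computational_Algebra.Polynomial"
begin

text \<open>Conventions. The n+1 homogeneous variables are indexed by a finite type 'n
(so CARD('n) = n+1). A homogeneous polynomial of degree d is represented by its
coefficient function on multi-indices alpha :: 'n => nat of total degree d.
A point of P_{n,d} is represented by any nonzero such coefficient function; all
notions below are invariant under rescaling. Points of CP^n are represented by
nonzero vectors of complex^'n, and measures on CP^n by measures on complex^'n
(lifts); the Fubini-Study cost is scale invariant.\<close>

definition mons :: "nat \<Rightarrow> ('n::finite \<Rightarrow> nat) set" where
  "mons d = {\<alpha>. (\<Sum>i\<in>UNIV. \<alpha> i) = d}"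

definition polys :: "nat \<Rightarrow> (('n::finite \<Rightarrow> nat) \<Rightarrow> complex) set" where
  "polys d = {c. c \<noteq> (\<lambda>_. 0) \<and> (\<forall>\<alpha>. \<alpha> \<notin> mons d \<longrightarrow> c \<alpha> = 0)}"

definition peval :: "nat \<Rightarrow> (('n::finite \<Rightarrow> nat) \<Rightarrow> complex) \<Rightarrow> complex^'n \<Rightarrow> complex" where
  "peval d c z = (\<Sum>\<alpha>\<in>mons d. c \<alpha> * (\<Prod>i\<in>UNIV. (z$i) ^ (\<alpha> i)))"

definition dpeval :: "nat \<Rightarrow> 'n::finite \<Rightarrow> (('n \<Rightarrow> nat) \<Rightarrow> complex) \<Rightarrow> complex^'n \<Rightarrow> complex" where
  "dpeval d i c z = (\<Sum>\<alpha>\<in>mons d. c \<alpha> * of_nat (\<alpha> i) *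
      (\<Prod>j\<in>UNIV. (z$j) ^ (\<alpha> j - (if j = i then 1 else 0))))"

definition singular :: "nat \<Rightarrow> (('n::finite \<Rightarrow> nat) \<Rightarrow> complex) \<Rightarrow> bool" where
  "singular d c = (\<exists>z::complex^'n. z \<noteq> 0 \<and> peval d c z = 0 \<and> (\<forall>i. dpeval d i c z = 0))"

definition discr :: "nat \<Rightarrow> (('n::finite \<Rightarrow> nat) \<Rightarrow> complex) set" where
  "discr d = {c \<in> polys d. singular d c}"

text \<open>Bombieri-Weyl Hermitian product: monomials sqrt(d!/alpha!) z^alpha orthonormal.\<close>
definition bw_inner :: "nat \<Rightarrow> (('n::finite \<Rightarrow> nat) \<Rightarrow> complex) \<Rightarrow> (('n \<Rightarrow> nat) \<Rightarrow> complex) \<Rightarrow> complex" where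
  "bw_inner d c c' = (\<Sum>\<alpha>\<in>mons d. c \<alpha> * cnj (c' \<alpha>) *
      complex_of_real ((\<Prod>i\<in>UNIV. fact (\<alpha> i)) / fact d))"

definition bw_norm :: "nat \<Rightarrow> (('n::finite \<Rightarrow> nat) \<Rightarrow> complex) \<Rightarrow> real" where
  "bw_norm d c = sqrt (Re (bw_inner d c c))"

definition dFS :: "nat \<Rightarrow> (('n::finite \<Rightarrow> nat) \<Rightarrow> complex) \<Rightarrow> (('n \<Rightarrow> nat) \<Rightarrow> complex) \<Rightarrow> real" where
  "dFS d c c' = arccos (min 1 (cmod (bw_inner d c c') / (bw_norm d c * bw_norm d c')))"

text \<open>Distance to the discriminant (extended real; +infinity if Delta is empty).\<close>
definition dist_discr :: "nat \<Rightarrow> (('n::finite \<Rightarrow> nat) \<Rightarrow> complex) \<Rightarrow> ereal" where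
  "dist_discr d c = (INF q\<in>discr d. ereal (dFS d c q))"

definition Peps :: "nat \<Rightarrow> real \<Rightarrow> (('n::finite \<Rightarrow> nat) \<Rightarrow> complex) set" where
  "Peps d \<epsilon> = {c \<in> polys d. ereal \<epsilon> \<le> dist_discr d c}"

definition dpt :: "complex^'n::finite \<Rightarrow> complex^'n \<Rightarrow> real" where
  "dpt z w = arccos (min 1 (cmod (\<Sum>i\<in>UNIV. z$i * cnj (w$i)) / (norm z * norm w)))"

text \<open>Unitarily invariant probability measure on G(1,n): a line is the span of a
pair (u,v) of independent standard complex Gaussian vectors.\<close>
definition gauss_dens :: "(complex^'n::finite) \<times> (complex^'n) \<Rightarrow> real" where
  "gauss_dens w = exp (- ((norm (fst w))\<^sup>2 + (norm (snd w))\<^sup>2))"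

definition gauss :: "((complex^'n::finite) \<times> (complex^'n)) measure" where
  "gauss = density lborel (\<lambda>w. ennreal (gauss_dens w) / (\<integral>\<^sup>+ x. ennreal (gauss_dens (x :: (complex^'n) \<times> (complex^'n))) \<partial>lborel))"

text \<open>Restriction of p to the line through u and v, dehomogenised: x \<mapsto> p(x u + v).\<close>
definition restr_poly :: "nat \<Rightarrow> (('n::finite \<Rightarrow> nat) \<Rightarrow> complex) \<Rightarrow> complex^'n \<Rightarrow> complex^'n \<Rightarrow> complex poly" where
  "restr_poly d c u v = (\<Sum>\<alpha>\<in>mons d. [:c \<alpha>:] * (\<Prod>i\<in>UNIV. [: v$i, u$i :] ^ (\<alpha> i)))"

text \<open>sum over z in Z(p) cap l of m_z(p|_l) * 1_A(z); the root at infinity [1:0]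
(the point u) has multiplicity d - deg. Lines contained in Z(p) (a null set) count 0.\<close>
definition line_count :: "nat \<Rightarrow> (('n::finite \<Rightarrow> nat) \<Rightarrow> complex) \<Rightarrow> (complex^'n) set
     \<Rightarrow> (complex^'n) \<times> (complex^'n) \<Rightarrow> ennreal" where
  "line_count d c A w = (let u = fst w; v = snd w; g = restr_poly d c u v in
     if g = 0 then 0 else
       (\<Sum>x\<in>{x. poly g x = 0}. of_nat (order x g) * indicator A (x *s u + v))
       + of_nat (d - degree g) * indicator A u)"

definition mu :: "nat \<Rightarrow> (('n::finite \<Rightarrow> nat) \<Rightarrow> complex) \<Rightarrow> (complex^'n) measure" where
  "mu d c = measure_of UNIV (sets borel)
      (\<lambda>A. (\<integral>\<^sup>+ w. line_count d c A w \<partial>gauss) / of_nat d)"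

definition couplings :: "(complex^'n::finite) measure \<Rightarrow> (complex^'n) measure
     \<Rightarrow> ((complex^'n) \<times> (complex^'n)) measure set" where
  "couplings \<mu> \<nu> = {\<pi>. sets \<pi> = sets borel \<and> distr \<pi> borel fst = \<mu> \<and> distr \<pi> borel snd = \<nu>}"

definition W2 :: "(complex^'n::finite) measure \<Rightarrow> (complex^'n) measure \<Rightarrow> real" where
  "W2 \<mu> \<nu> = sqrt (Inf ((\<lambda>\<pi>. \<integral> w. (dpt (fst w) (snd w))\<^sup>2 \<partial>\<pi>) ` couplings \<mu> \<nu>))"

definition AC2 :: "(real \<Rightarrow> (complex^'n::finite) measure) \<Rightarrow> bool" where
  "AC2 \<mu>t = (\<exists>m::real \<Rightarrow> real. (\<forall>t. 0 \<le> m t) \<and> m integrable_on {0..1} \<and>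
      (\<lambda>t. (m t)\<^sup>2) integrable_on {0..1} \<and>
      (\<forall>s t. 0 \<le> s \<longrightarrow> s \<le> t \<longrightarrow> t \<le> 1 \<longrightarrow> W2 (\<mu>t s) (\<mu>t t) \<le> integral {s..t} m))"

text \<open>Metric speed (limsup of difference quotients; equals the limit a.e.).\<close>
definition speed :: "(real \<Rightarrow> (complex^'n::finite) measure) \<Rightarrow> real \<Rightarrow> ereal" where
  "speed \<mu>t t = Limsup (at t within {0..1}) (\<lambda>s. ereal (W2 (\<mu>t s) (\<mu>t t) / \<bar>s - t\<bar>))"

definition admissible :: "nat \<Rightarrow> (('n::finite \<Rightarrow> nat) \<Rightarrow> complex) \<Rightarrow> (('n \<Rightarrow> nat) \<Rightarrow> complex)
     \<Rightarrow> (real \<Rightarrow> (('n \<Rightarrow> nat) \<Rightarrow> complex)) \<Rightarrow> bool" where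
  "admissible d p q \<gamma> = (\<gamma> 0 = p \<and> \<gamma> 1 = q \<and> (\<forall>t\<in>{0..1}. \<gamma> t \<in> polys d) \<and>
      AC2 (\<lambda>t. mu d (\<gamma> t)))"

definition energy :: "nat \<Rightarrow> (real \<Rightarrow> (('n::finite \<Rightarrow> nat) \<Rightarrow> complex)) \<Rightarrow> ennreal" where
  "energy d \<gamma> = (\<integral>\<^sup>+ t. indicator {0..1} t * (e2ennreal (speed (\<lambda>s. mu d (\<gamma> s)) t))\<^sup>2 \<partial>lebesgue)"

definition W2in :: "nat \<Rightarrow> (('n::finite \<Rightarrow> nat) \<Rightarrow> complex) \<Rightarrow> (('n \<Rightarrow> nat) \<Rightarrow> complex) \<Rightarrow> ennreal" where
  "W2in d p q = (let E = (INF \<gamma>\<in>{\<gamma>. admissible d p q \<gamma>}. energy d \<gamma>) in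
      if E = \<infinity> then \<infinity> else ennreal (sqrt (enn2real E)))"

end

theory Submission
  imports Defs "HOL-Computational_Algebra.Fundamental_Theorem_Algebra"
begin

text \<open>
  The heart of the matter is a static estimate: on a set of polynomials that are uniformly
  nondegenerate, \<open>W2 (mu p) (mu q) \<le> K * \<delta>\<close> with \<open>\<delta> = |p - q|\<close>. On a random line,
  match the roots of \<open>p\<close> and \<open>q\<close>. Where the derivative along the line has size
  \<open>a \<ge> sqrt (A * \<delta>)\<close>, a root of \<open>p\<close> moves by \<open>O(\<delta> / a)\<close>, and \<open>(\<delta> / a)\<^sup>2\<close> is the area of a disc on
  which \<open>|p| = O(\<delta>)\<close>; the remaining roots sit in discs of area \<open>\<delta>\<close> on which moreover the line is
  nearly tangent to the hypersurface. Averaged over lines, both contributions are bounded by the volume of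
  the tube \<open>|p(z)| \<le> C * \<delta> * |z| ^ d\<close>, which is \<open>O(\<delta>\<^sup>2)\<close> because a one-variable polynomial can only be small with
  large derivative near one of its roots. Since the estimate holds for any two
  polynomials of the set, every Lipschitz path in it is \<open>W2\<close>-Lipschitz; no triangle inequality for \<open>W2\<close> is needed.

  Nearby polynomials are joined by segments. Any two nonsingular ones are joined
  through a generic member of a finite-dimensional family, because the discriminant has real codimension two,
  so that the members seen from a given polynomial along a segment through the discriminant form a null set.
  Compactness of the normalised \<open>P(\<epsilon>)\<close> makes all constants uniform.
\<close>

section \<open>Homogeneous polynomials and their restrictions to lines\<close>

text \<open>The obstacle is that a root on a line moves by about \<open>\<delta> / a\<close>, where
  \<open>a\<close> is the derivative along the line, and \<open>a\<close> has no positive lower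
  bound over all lines. The threshold for \<open>a\<close> is the point where this displacement
  becomes small against the distance \<open>a / M\<close> to the other roots, with \<open>M\<close>
  bounding the Taylor remainders; this is why \<open>a\<^sup>2\<close> is compared with
  \<open>\<delta>\<close>. Below the threshold a root is matched arbitrarily, at a cost of order
  one, which has to be paid for by rarity: the tube has volume O(\<open>\<delta>\<^sup>2\<close>),
  near tangency is one complex condition of width \<open>sqrt \<delta>\<close> and thus has measure
  O(\<open>\<delta>\<close>), and dividing by the disc area \<open>\<delta>\<close> leaves
  \<open>\<delta>\<^sup>2\<close>. Counting areas of discs in this way takes the place of a Kac-Rice
  formula for the roots. An affine parameter on the line is useless near its point at infinity;
  exchanging the two spanning vectors inverts the parameter, so every root lies in the unit disc of
  one of two charts.\<close>

lemma finite_mons [simp]: "finite (mons d :: ('n::finite \<Rightarrow> nat) set)"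
proof (rule finite_subset)
  show "(mons d :: ('n \<Rightarrow> nat) set) \<subseteq> PiE UNIV (\<lambda>_. {..d})"
    by (auto simp: mons_def PiE_def intro: member_le_sum)
  show "finite (PiE (UNIV::'n set) (\<lambda>_. {..d}))"
    by (intro finite_PiE) auto
qed

definition coeff_norm :: "nat \<Rightarrow> (('n::finite \<Rightarrow> nat) \<Rightarrow> complex) \<Rightarrow> real" where
  "coeff_norm d c = (\<Sum>\<alpha>\<in>mons d. cmod (c \<alpha>))"

lemma coeff_norm_nonneg [simp]: "0 \<le> coeff_norm d c"
  by (simp add: coeff_norm_def sum_nonneg)

lemma coeff_norm_triangle: "coeff_norm d (\<lambda>a. x a + y a) \<le> coeff_norm d x + coeff_norm d y"
  unfolding coeff_norm_def sum.distrib[symmetric] by (intro sum_mono norm_triangle_ineq)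

lemma coeff_norm_diff_triangle:
  "coeff_norm d (\<lambda>a. x a - z a) \<le> coeff_norm d (\<lambda>a. x a - y a) + coeff_norm d (\<lambda>a. y a - z a)"
  using coeff_norm_triangle[of d "\<lambda>a. x a - y a" "\<lambda>a. y a - z a"] by simp

lemma coeff_norm_scale: "coeff_norm d (\<lambda>a. k * x a) = cmod k * coeff_norm d x"
  by (simp add: coeff_norm_def norm_mult sum_distrib_left)

lemma peval_scale: "peval d (\<lambda>a. k * c a) z = k * peval d c z"
  by (simp add: peval_def sum_distrib_left mult.assoc)

lemma peval_add: "peval d (\<lambda>a. c a + c' a) z = peval d c z + peval d c' z"
  by (simp add: peval_def sum.distrib algebra_simps)

lemma peval_diff: "peval d (\<lambda>a. c a - c' a) z = peval d c z - peval d c' z"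
  by (simp add: peval_def sum_subtractf algebra_simps)

lemma dpeval_scale: "dpeval d i (\<lambda>a. k * c a) z = k * dpeval d i c z"
  by (simp add: dpeval_def sum_distrib_left mult.assoc)

lemma dpeval_add: "dpeval d i (\<lambda>a. c a + c' a) z = dpeval d i c z + dpeval d i c' z"
  by (simp add: dpeval_def sum.distrib algebra_simps)

lemma dpeval_diff: "dpeval d i (\<lambda>a. c a - c' a) z = dpeval d i c z - dpeval d i c' z"
  by (simp add: dpeval_def sum_subtractf algebra_simps)

text \<open>Natural subtraction truncates, so the exponents sum to \<open>d - 1\<close> only if
  \<open>\<alpha> i\<close> is positive. The other terms of \<open>dpeval\<close> carry the factor
  \<open>\<alpha> i = 0\<close> and never need this count.\<close>

lemma mons_sum_minus:
  assumes "\<alpha> \<in> mons d" "\<alpha> i \<noteq> 0"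
  shows "(\<Sum>j\<in>UNIV. \<alpha> j - (if j = i then 1 else 0)) = d - 1"
proof -
  have "(\<Sum>j\<in>UNIV. \<alpha> j) = (\<Sum>j\<in>UNIV. (\<alpha> j - (if j = i then 1 else 0)) + (if j = i then 1 else 0))"
    by (rule sum.cong) (use assms in auto)
  also have "\<dots> = (\<Sum>j\<in>UNIV. \<alpha> j - (if j = i then 1 else 0)) + 1"
    unfolding sum.distrib by simp
  finally show ?thesis using assms(1) by (simp add: mons_def)
qed

lemma peval_homogeneous: "peval d c (k *s z) = k ^ d * peval d c z"
  unfolding peval_def sum_distrib_left
  by (rule sum.cong)
     (auto simp: power_mult_distrib prod.distrib mons_def simp flip: power_sum)

lemma dpeval_homogeneous: "dpeval d i c (k *s z) = k ^ (d - 1) * dpeval d i c z"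
  unfolding dpeval_def sum_distrib_left
proof (rule sum.cong)
  fix \<alpha> :: "'a \<Rightarrow> nat" assume a: "\<alpha> \<in> mons d"
  show "c \<alpha> * of_nat (\<alpha> i) * (\<Prod>j\<in>UNIV. ((k *s z)$j) ^ (\<alpha> j - (if j = i then 1 else 0))) =
        k ^ (d - 1) * (c \<alpha> * of_nat (\<alpha> i) * (\<Prod>j\<in>UNIV. (z$j) ^ (\<alpha> j - (if j = i then 1 else 0))))"
  proof (cases "\<alpha> i = 0")
    case False
    have "(\<Prod>j\<in>UNIV. ((k *s z)$j) ^ (\<alpha> j - (if j = i then 1 else 0))) =
       k ^ (d - 1) * (\<Prod>j\<in>UNIV. (z$j) ^ (\<alpha> j - (if j = i then 1 else 0)))"
      unfolding mons_sum_minus[OF a False, symmetric] power_sum prod.distrib[symmetric]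
      by (rule prod.cong) (auto simp: power_mult_distrib)
    then show ?thesis by simp
  qed simp
qed simp

lemma norm_vec_nth_le: "cmod (z $ i) \<le> norm (z :: complex^'n::finite)"
  by (rule Finite_Cartesian_Product.norm_nth_le)

lemma norm_vector_scalar_mult: "norm (k *s (z::complex^'n::finite)) = cmod k * norm z"
  by (simp add: norm_vec_def norm_mult L2_set_right_distrib[symmetric])

lemma norm_prod_power_le:
  "(\<Prod>i\<in>UNIV. cmod (z $ i) ^ \<beta> i) \<le> norm (z::complex^'n::finite) ^ (\<Sum>i\<in>UNIV. \<beta> i)"
  unfolding power_sum by (intro prod_mono conjI power_mono norm_vec_nth_le) auto

lemma cmod_peval_le: "cmod (peval d c z) \<le> coeff_norm d c * norm z ^ d"
proof -
  have "cmod (peval d c z) \<le> (\<Sum>\<alpha>\<in>mons d. cmod (c \<alpha>) * norm z ^ d)"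
    unfolding peval_def
  proof (rule sum_norm_le)
    fix \<alpha> :: "'a \<Rightarrow> nat" assume "\<alpha> \<in> mons d"
    then have "(\<Prod>i\<in>UNIV. cmod (z $ i) ^ \<alpha> i) \<le> norm z ^ d"
      using norm_prod_power_le[of z \<alpha>] by (simp add: mons_def)
    then show "cmod (c \<alpha> * (\<Prod>i\<in>UNIV. (z$i) ^ (\<alpha> i))) \<le> cmod (c \<alpha>) * norm z ^ d"
      by (simp add: norm_mult prod_norm[symmetric] norm_power mult_left_mono)
  qed
  then show ?thesis by (simp add: coeff_norm_def sum_distrib_right)
qed

lemma cmod_dpeval_le: "cmod (dpeval d i c z) \<le> d * coeff_norm d c * norm z ^ (d - 1)"
proof -
  have "cmod (dpeval d i c z) \<le> (\<Sum>\<alpha>\<in>mons d. cmod (c \<alpha>) * (d * norm z ^ (d - 1)))"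
    unfolding dpeval_def
  proof (rule sum_norm_le)
    fix \<alpha> :: "'a \<Rightarrow> nat" assume a: "\<alpha> \<in> mons d"
    show "cmod (c \<alpha> * of_nat (\<alpha> i) * (\<Prod>j\<in>UNIV. (z$j) ^ (\<alpha> j - (if j = i then 1 else 0))))
        \<le> cmod (c \<alpha>) * (d * norm z ^ (d - 1))"
    proof (cases "\<alpha> i = 0")
      case False
      have "\<alpha> i \<le> d"
        using a member_le_sum[of i UNIV \<alpha>] by (auto simp: mons_def)
      moreover have "(\<Prod>j\<in>UNIV. cmod (z $ j) ^ (\<alpha> j - (if j = i then 1 else 0))) \<le> norm z ^ (d - 1)"
        using norm_prod_power_le[of z "\<lambda>j. \<alpha> j - (if j = i then 1 else 0)"]
        unfolding mons_sum_minus[OF a False] .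
      ultimately have "real (\<alpha> i) * (\<Prod>j\<in>UNIV. cmod (z $ j) ^ (\<alpha> j - (if j = i then 1 else 0)))
          \<le> d * norm z ^ (d - 1)"
        by (intro mult_mono) (auto intro!: prod_nonneg)
      then show ?thesis
        by (simp add: norm_mult prod_norm[symmetric] norm_power mult_left_mono mult.assoc)
    qed simp
  qed
  also have "\<dots> = d * coeff_norm d c * norm z ^ (d - 1)"
    by (simp add: coeff_norm_def sum_distrib_right sum_distrib_left mult_ac)
  finally show ?thesis .
qed

section \<open>Restriction of a form to a line\<close>

definition dir_deriv :: "nat \<Rightarrow> (('n::finite \<Rightarrow> nat) \<Rightarrow> complex) \<Rightarrow> complex^'n \<Rightarrow> complex^'n \<Rightarrow> complex" where
  "dir_deriv d c z u = (\<Sum>i\<in>UNIV. dpeval d i c z * u $ i)"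

lemma DERIV_peval_line:
  "((\<lambda>x. peval d c (x *s u + v)) has_field_derivative dir_deriv d c (x *s u + v) u) (at x)"
proof -
  have "((\<lambda>x. peval d c (x *s u + v)) has_field_derivative
     (\<Sum>\<alpha>\<in>mons d. c \<alpha> * (\<Sum>i\<in>UNIV. (of_nat (\<alpha> i) * ((x *s u + v) $ i) ^ (\<alpha> i - 1) * u $ i) *
         (\<Prod>j\<in>UNIV - {i}. ((x *s u + v) $ j) ^ \<alpha> j)))) (at x)"
    unfolding peval_def
    by (rule DERIV_sum DERIV_cmult has_field_derivative_prod)+ (auto intro!: derivative_eq_intros)
  also have "(\<Sum>\<alpha>\<in>mons d. c \<alpha> * (\<Sum>i\<in>UNIV. (of_nat (\<alpha> i) * ((x *s u + v) $ i) ^ (\<alpha> i - 1) * u $ i) *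
         (\<Prod>j\<in>UNIV - {i}. ((x *s u + v) $ j) ^ \<alpha> j))) =
     (\<Sum>\<alpha>\<in>mons d. \<Sum>i\<in>UNIV. c \<alpha> * of_nat (\<alpha> i) *
      (\<Prod>j\<in>UNIV. ((x *s u + v)$j) ^ (\<alpha> j - (if j = i then 1 else 0))) * u $ i)"
    unfolding sum_distrib_left
  proof (intro sum.cong refl)
    fix \<alpha> :: "'a \<Rightarrow> nat" and i
    have "(\<Prod>j\<in>UNIV. ((x *s u + v)$j) ^ (\<alpha> j - (if j = i then 1 else 0))) =
      ((x *s u + v)$i) ^ (\<alpha> i - 1) * (\<Prod>j\<in>UNIV - {i}. ((x *s u + v)$j) ^ \<alpha> j)"
      by (subst prod.remove[of _ i]) auto
    then show "c \<alpha> * (of_nat (\<alpha> i) * ((x *s u + v) $ i) ^ (\<alpha> i - 1) * u $ i *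
         (\<Prod>j\<in>UNIV - {i}. ((x *s u + v) $ j) ^ \<alpha> j)) =
       c \<alpha> * of_nat (\<alpha> i) *
      (\<Prod>j\<in>UNIV. ((x *s u + v)$j) ^ (\<alpha> j - (if j = i then 1 else 0))) * u $ i"
      by simp
  qed
  also have "\<dots> = dir_deriv d c (x *s u + v) u"
    unfolding dir_deriv_def dpeval_def sum_distrib_right by (rule sum.swap)
  finally show ?thesis .
qed

lemma poly_restr_poly: "poly (restr_poly d c u v) x = peval d c (x *s u + v)"
  by (simp add: restr_poly_def peval_def poly_sum poly_prod algebra_simps)

lemma poly_pderiv_restr_poly: "poly (pderiv (restr_poly d c u v)) x = dir_deriv d c (x *s u + v) u"
proof (rule DERIV_unique)
  show "((\<lambda>x. peval d c (x *s u + v)) has_field_derivative dir_deriv d c (x *s u + v) u) (at x)"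
    by (rule DERIV_peval_line)
  show "((\<lambda>x. peval d c (x *s u + v)) has_field_derivative poly (pderiv (restr_poly d c u v)) x) (at x)"
    using poly_DERIV[of "restr_poly d c u v" x] by (simp add: poly_restr_poly)
qed

lemma degree_prod_linear_power:
  "degree (\<Prod>i\<in>A. [: v i, u i :] ^ \<alpha> i) \<le> (\<Sum>i\<in>A. \<alpha> i)"
  if "finite A" for u v :: "'n \<Rightarrow> complex"
proof -
  have "degree (\<Prod>i\<in>A. [: v i, u i :] ^ \<alpha> i) \<le> (\<Sum>i\<in>A. degree ([: v i, u i :] ^ \<alpha> i))"
    using degree_prod_sum_le[OF that, of "\<lambda>i. [: v i, u i :] ^ \<alpha> i"] by (simp add: o_def)
  also have "\<dots> \<le> (\<Sum>i\<in>A. \<alpha> i)"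
  proof (rule sum_mono)
    fix i
    have "degree ([: v i, u i :] ^ \<alpha> i) \<le> degree [: v i, u i :] * \<alpha> i"
      by (rule degree_power_le)
    also have "\<dots> \<le> \<alpha> i" by simp
    finally show "degree ([: v i, u i :] ^ \<alpha> i) \<le> \<alpha> i" .
  qed
  finally show ?thesis .
qed

lemma degree_restr_poly: "degree (restr_poly d c u v) \<le> d"
  unfolding restr_poly_def
proof (rule degree_sum_le)
  fix \<alpha> :: "'a \<Rightarrow> nat" assume "\<alpha> \<in> mons d"
  then show "degree ([:c \<alpha>:] * (\<Prod>i\<in>UNIV. [:v $ i, u $ i:] ^ \<alpha> i)) \<le> d"
    using degree_prod_linear_power[of UNIV "\<lambda>i. v $ i" "\<lambda>i. u $ i" \<alpha>]
    by (auto simp: mons_def intro: order_trans[OF degree_smult_le])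
qed simp

lemma coeff_linear_power: "coeff ([: a, b :] ^ m) m = (b :: complex) ^ m"
proof (induction m)
  case (Suc m)
  have "degree ([: a, b :] ^ m) \<le> m"
    using degree_power_le[of "[:a,b:]" m] by (simp split: if_splits)
  then have "coeff ([: a, b :] ^ m) (Suc m) = 0"
    by (intro coeff_eq_0) auto
  then show ?case using Suc by simp
qed simp

lemma coeff_prod_linear_power:
  "finite A \<Longrightarrow> coeff (\<Prod>i\<in>A. [: v i, u i :] ^ \<alpha> i) (\<Sum>i\<in>A. \<alpha> i) = (\<Prod>i\<in>A. (u i :: complex) ^ \<alpha> i)"
proof (induction A rule: finite_induct)
  case (insert x A)
  have "coeff ([: v x, u x :] ^ \<alpha> x * (\<Prod>i\<in>A. [: v i, u i :] ^ \<alpha> i)) (\<alpha> x + (\<Sum>i\<in>A. \<alpha> i)) =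
     coeff ([: v x, u x :] ^ \<alpha> x) (\<alpha> x) * coeff (\<Prod>i\<in>A. [: v i, u i :] ^ \<alpha> i) (\<Sum>i\<in>A. \<alpha> i)"
  proof -
    have 1: "degree ([: v x, u x :] ^ \<alpha> x) \<le> \<alpha> x"
      using degree_power_le[of "[: v x, u x:]" "\<alpha> x"] by (simp split: if_splits)
    note 2 = degree_prod_linear_power[OF insert.hyps(1), of v u \<alpha>]
    show ?thesis unfolding coeff_mult
    proof (subst sum.remove[of _ "\<alpha> x"])
      have "coeff ([: v x, u x :] ^ \<alpha> x) i * coeff (\<Prod>i\<in>A. [: v i, u i :] ^ \<alpha> i) (\<alpha> x + sum \<alpha> A - i) = 0"
        if "i \<in> {..\<alpha> x + sum \<alpha> A} - {\<alpha> x}" for i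
      proof (cases "i < \<alpha> x")
        case True
        then have "coeff (\<Prod>i\<in>A. [: v i, u i :] ^ \<alpha> i) (\<alpha> x + sum \<alpha> A - i) = 0"
          using 2 by (intro coeff_eq_0) auto
        then show ?thesis by simp
      next
        case False
        then have "coeff ([: v x, u x :] ^ \<alpha> x) i = 0"
          using 1 that by (intro coeff_eq_0) auto
        then show ?thesis by simp
      qed
      then show "coeff ([: v x, u x :] ^ \<alpha> x) (\<alpha> x) * coeff (\<Prod>i\<in>A. [: v i, u i :] ^ \<alpha> i) (\<alpha> x + sum \<alpha> A - \<alpha> x) +
        (\<Sum>i\<in>{..\<alpha> x + sum \<alpha> A} - {\<alpha> x}. coeff ([: v x, u x :] ^ \<alpha> x) i * coeff (\<Prod>i\<in>A. [: v i, u i :] ^ \<alpha> i) (\<alpha> x + sum \<alpha> A - i)) =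
        coeff ([: v x, u x :] ^ \<alpha> x) (\<alpha> x) * coeff (\<Prod>i\<in>A. [: v i, u i :] ^ \<alpha> i) (\<Sum>i\<in>A. \<alpha> i)"
        by (simp add: sum.neutral)
    qed auto
  qed
  then show ?case using insert by (simp add: coeff_linear_power)
qed simp

text \<open>In the chart \<open>x \<mapsto> x *s u + v\<close> the point \<open>u\<close> lies at
  infinity, and the top coefficient is the value of the form there. Hence
  \<open>peval d c u \<noteq> 0\<close> says at once that the restriction has full degree
  \<open>d\<close> and no root at infinity.\<close>

lemma coeff_restr_poly: "coeff (restr_poly d c u v) d = peval d c u"
  unfolding restr_poly_def peval_def coeff_sum
  by (rule sum.cong)
     (use coeff_prod_linear_power[of UNIV "\<lambda>i. v $ i" "\<lambda>i. u $ i"] in \<open>auto simp: mons_def\<close>)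

text \<open>Multiplying by a linear factor with coefficients in the unit disc adds two shifted
  copies of the coefficient sequence, hence at most doubles the bound.\<close>

lemma coeff_linear_power_mult_le:
  assumes "\<And>k. cmod (coeff P k) \<le> B" "cmod a \<le> 1" "cmod b \<le> 1"
  shows "cmod (coeff ([:a, b:] ^ m * P) k) \<le> 2 ^ m * B"
proof (induction m arbitrary: k)
  case (Suc m)
  define Q where "Q = [:a, b:] ^ m * P"
  have IH: "cmod (coeff Q k) \<le> 2 ^ m * B" for k using Suc Q_def by simp
  have *: "cmod (x * coeff Q k) \<le> 2 ^ m * B" if "cmod x \<le> 1" for x k
    using mult_mono[OF that IH[of k]] by (simp add: norm_mult)
  have "0 \<le> 2 ^ m * B" using IH[of 0] norm_ge_zero order_trans by blast
  moreover have "cmod (coeff ([:a, b:] * Q) k) \<le> 2 ^ m * B + (if k = 0 then 0 else 2 ^ m * B)"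
    using *[OF assms(2), of k] *[OF assms(3), of "k - 1"]
    by (cases k) (auto intro!: norm_triangle_le add_mono simp: mult.commute)
  ultimately have "cmod (coeff ([:a, b:] * Q) k) \<le> 2 * (2 ^ m * B)"
    by (auto simp: mult.commute split: if_splits)
  then show ?case by (simp only: Q_def mult.assoc power_Suc)
qed (use assms in simp)

lemma cmod_coeff_restr_poly_le:
  assumes "norm u \<le> 1" "norm v \<le> 1"
  shows "cmod (coeff (restr_poly d c u v) k) \<le> 2 ^ d * coeff_norm d c"
proof -
  have uv: "cmod (u $ i) \<le> 1" "cmod (v $ i) \<le> 1" for i
    using assms norm_vec_nth_le order_trans by blast+
  have *: "cmod (coeff (\<Prod>i\<in>A. [: v $ i, u $ i :] ^ \<alpha> i) k) \<le> 2 ^ (\<Sum>i\<in>A. \<alpha> i)" if "finite A"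
    for A k and \<alpha> :: "'a \<Rightarrow> nat"
    using that
  proof (induction A arbitrary: k rule: finite_induct)
    case empty
    then show ?case by (cases k) auto
  next
    case (insert x A)
    then show ?case
      using coeff_linear_power_mult_le[OF insert.IH, of "v $ x" "u $ x" "\<alpha> x" k] uv
      by (simp add: power_add)
  qed
  have "cmod (coeff (restr_poly d c u v) k) \<le> (\<Sum>\<alpha>\<in>mons d. cmod (c \<alpha>) * 2 ^ d)"
    unfolding restr_poly_def coeff_sum
  proof (rule sum_norm_le)
    fix \<alpha> :: "'a \<Rightarrow> nat" assume "\<alpha> \<in> mons d"
    then have "cmod (coeff (\<Prod>i\<in>UNIV. [: v $ i, u $ i :] ^ \<alpha> i) k) \<le> 2 ^ d"
      using *[of UNIV \<alpha> k] by (simp add: mons_def)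
    then show "cmod (coeff ([:c \<alpha>:] * (\<Prod>i\<in>UNIV. [: v $ i, u $ i :] ^ \<alpha> i)) k) \<le> cmod (c \<alpha>) * 2 ^ d"
      by (simp add: norm_mult mult_left_mono)
  qed
  then show ?thesis by (simp add: coeff_norm_def sum_distrib_left mult.commute)
qed

section \<open>One-variable polynomials: Taylor bounds and roots near a given point\<close>

lemma poly_eq_sum_le_degree:
  assumes "degree P \<le> d"
  shows "poly P (x::complex) = (\<Sum>k\<le>d. coeff P k * x ^ k)"
  unfolding poly_altdef using assms
  by (intro sum.mono_neutral_left) (auto simp: coeff_eq_0)

text \<open>For \<open>cmod y \<le> 1\<close> the higher powers are dominated by the lowest one that
  occurs, so a bound on the coefficients replaces bounds on derivatives. The factor
  \<open>(real d + 1)\<^sup>2\<close> is wasteful in the first estimate but lets one constant serve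
  both.\<close>

lemma poly_taylor_bounds:
  fixes P :: "complex poly"
  assumes deg: "degree P \<le> d" and B: "\<And>k. cmod (coeff P k) \<le> B" and y: "cmod y \<le> 1"
  shows "cmod (poly P y - poly P 0 - poly (pderiv P) 0 * y) \<le> (real d + 1)\<^sup>2 * B * (cmod y)\<^sup>2"
    and "cmod (poly (pderiv P) y - poly (pderiv P) 0) \<le> (real d + 1)\<^sup>2 * B * cmod y"
proof -
  have B0: "0 \<le> B" using B[of 0] norm_ge_zero order_trans by blast
  have P: "poly P y = (\<Sum>k\<le>d. coeff P k * y ^ k)"
    using deg by (rule poly_eq_sum_le_degree)
  have "poly P y - poly P 0 - poly (pderiv P) 0 * y = (\<Sum>k\<in>{..d}. if k < 2 then 0 else coeff P k * y ^ k)"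
  proof -
    have p0: "poly P 0 = coeff P 0" "poly (pderiv P) 0 = coeff P 1"
      by (simp_all add: poly_0_coeff_0 coeff_pderiv)
    have "(\<Sum>k\<le>d. coeff P k * y ^ k) = (\<Sum>k\<le>d. (if k < 2 then 0 else coeff P k * y ^ k)
        + (if k = 0 then coeff P k * y ^ k else 0) + (if k = 1 then coeff P k * y ^ k else 0))"
      by (intro sum.cong) (auto simp: less_2_cases_iff)
    also have "\<dots> = (\<Sum>k\<le>d. (if k < 2 then 0 else coeff P k * y ^ k)) + coeff P 0 + (if 1 \<le> d then coeff P 1 * y else 0)"
      by (simp add: sum.distrib)
    also have "(if 1 \<le> d then coeff P 1 * y else 0) = coeff P 1 * y"
      using deg coeff_eq_0[of P 1] by auto
    finally show ?thesis using P p0 by simp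
  qed
  also have "cmod \<dots> \<le> (\<Sum>k\<in>{..d}. B * (cmod y)\<^sup>2)"
  proof (rule sum_norm_le)
    fix k
    show "cmod (if k < 2 then 0 else coeff P k * y ^ k) \<le> B * (cmod y)\<^sup>2"
    proof (cases "k < 2")
      case False
      then have "cmod y ^ k \<le> (cmod y)\<^sup>2" using y by (intro power_decreasing) auto
      then show ?thesis using False B[of k] B0
        by (auto simp: norm_mult norm_power intro: mult_mono)
    qed (use B0 in auto)
  qed
  also have "\<dots> \<le> (real d + 1)\<^sup>2 * B * (cmod y)\<^sup>2"
  proof -
    have "real d + 1 \<le> (real d + 1)\<^sup>2" by (simp add: power2_eq_square algebra_simps)
    then show ?thesis using B0 mult_right_mono[of "real d + 1" "(real d + 1)\<^sup>2" "B * (cmod y)\<^sup>2"]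
      by (simp add: mult_ac add.commute)
  qed
  finally show "cmod (poly P y - poly P 0 - poly (pderiv P) 0 * y) \<le> (real d + 1)\<^sup>2 * B * (cmod y)\<^sup>2" .
  have dd: "degree (pderiv P) \<le> d" using deg by (simp add: degree_pderiv)
  have "poly (pderiv P) y - poly (pderiv P) 0 = (\<Sum>k\<le>d. if k = 0 then 0 else coeff (pderiv P) k * y ^ k)"
  proof -
    have "(\<Sum>k\<le>d. coeff (pderiv P) k * y ^ k) = (\<Sum>k\<le>d. (if k = 0 then 0 else coeff (pderiv P) k * y ^ k)
        + (if k = 0 then coeff (pderiv P) k * y ^ k else 0))"
      by (intro sum.cong) auto
    then show ?thesis using poly_eq_sum_le_degree[OF dd, of y] by (simp add: sum.distrib poly_0_coeff_0)
  qed
  also have "cmod \<dots> \<le> (\<Sum>k\<in>{..d}. (real d + 1) * B * cmod y)"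
  proof (rule sum_norm_le)
    fix k assume "k \<in> {..d}"
    show "cmod (if k = 0 then 0 else coeff (pderiv P) k * y ^ k) \<le> (real d + 1) * B * cmod y"
    proof (cases "k = 0")
      case False
      then have "cmod y ^ k \<le> (cmod y) ^ 1" using y by (intro power_decreasing) auto
      moreover have "cmod (coeff (pderiv P) k) \<le> (real d + 1) * B"
        using B[of "Suc k"] \<open>k \<in> {..d}\<close> B0 unfolding coeff_pderiv norm_mult norm_of_nat
        by (intro mult_mono) auto
      ultimately show ?thesis using False B0
        by (auto simp: norm_mult norm_power intro!: mult_mono)
    qed (use B0 in auto)
  qed
  also have "\<dots> = (real d + 1)\<^sup>2 * B * cmod y"
    by (simp add: power2_eq_square algebra_simps)
  finally show "cmod (poly (pderiv P) y - poly (pderiv P) 0) \<le> (real d + 1)\<^sup>2 * B * cmod y" .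
qed

text \<open>The logarithmic derivative is the sum of \<open>1 / (x - r)\<close> over the roots
  \<open>r\<close> with multiplicity, and each summand has modulus at most \<open>1 / D\<close>.
  Splitting off one root at a time gives the same bound without dividing by \<open>poly P x\<close>
  or by \<open>D\<close>.\<close>

lemma pderiv_le_of_roots_far:
  fixes P :: "complex poly"
  assumes "\<And>y. poly P y = 0 \<Longrightarrow> D \<le> cmod (x - y)" "0 \<le> D"
  shows "D * cmod (poly (pderiv P) x) \<le> degree P * cmod (poly P x)"
  using assms(1)
proof (induction "degree P" arbitrary: P)
  case 0
  then obtain a where "P = [:a:]" by (metis degree_eq_zeroE)
  then show ?case by simp
next
  case (Suc n)
  then have "\<not> constant (poly P)" by (simp add: constant_degree)
  then obtain r where r: "poly P r = 0" using fundamental_theorem_of_algebra by blast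
  then obtain Q where Q: "P = [:-r, 1:] * Q" by (metis dvdE poly_eq_0_iff_dvd)
  have "Q \<noteq> 0" using Q Suc(2) by auto
  then have n: "degree Q = n"
    using Q Suc(2) degree_mult_eq[of "[:-r,1:]" Q] by simp
  have roots: "D \<le> cmod (x - y)" if "poly Q y = 0" for y
    using Suc(3)[of y] Q that by simp
  have IH: "D * cmod (poly (pderiv Q) x) \<le> n * cmod (poly Q x)"
    using Suc(1)[OF n[symmetric] roots] n by simp
  have p': "pderiv P = Q + [:-r, 1:] * pderiv Q"
    unfolding Q pderiv_mult by (simp add: pderiv_pCons)
  have "D * cmod (poly (pderiv P) x) \<le> D * (cmod (poly Q x) + cmod (x - r) * cmod (poly (pderiv Q) x))"
    unfolding p' using assms(2) norm_triangle_ineq[of "poly Q x" "(x - r) * poly (pderiv Q) x"]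
    by (intro mult_left_mono) (auto simp: norm_mult[symmetric] algebra_simps)
  also have "\<dots> \<le> cmod (x - r) * cmod (poly Q x) + cmod (x - r) * (n * cmod (poly Q x))"
    using mult_left_mono[OF IH, of "cmod (x - r)"] mult_right_mono[OF Suc(3)[OF r], of "cmod (poly Q x)"]
    by (simp add: algebra_simps)
  also have "\<dots> = degree P * cmod (poly P x)"
  proof -
    have "poly P x = (x - r) * poly Q x" unfolding Q by (simp add: algebra_simps)
    then have "cmod (poly P x) = cmod (x - r) * cmod (poly Q x)" by (simp add: norm_mult)
    then show ?thesis unfolding Suc(2)[symmetric] by (simp add: distrib_right)
  qed
  finally show ?case .
qed

text \<open>Take the root nearest to \<open>x\<close>: no root is closer than that, so the preceding
  estimate applies with this distance as \<open>D\<close> and bounds it by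
  \<open>d * a / b\<close>.\<close>

lemma poly_root_near:
  fixes P :: "complex poly"
  assumes "cmod (poly P x) \<le> a" "b \<le> cmod (poly (pderiv P) x)" "0 < b" "degree P \<le> d"
  shows "\<exists>y. poly P y = 0 \<and> cmod (x - y) \<le> d * a / b"
proof -
  have P0: "P \<noteq> 0" using assms by auto
  have "degree P \<noteq> 0"
  proof
    assume "degree P = 0"
    then have "pderiv P = 0" by (simp add: pderiv_eq_0_iff)
    then show False using assms by simp
  qed
  then have "{y. poly P y = 0} \<noteq> {}"
    using fundamental_theorem_of_algebra[of P] by (auto simp: constant_degree)
  then obtain y where y: "poly P y = 0" "\<And>y'. poly P y' = 0 \<Longrightarrow> cmod (x - y) \<le> cmod (x - y')"
    using ex_min_if_finite[of "(\<lambda>y. cmod (x - y)) ` {y. poly P y = 0}"] poly_roots_finite[OF P0]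
    by (auto simp: not_less)
  have "cmod (x - y) * b \<le> cmod (x - y) * cmod (poly (pderiv P) x)"
    using assms by (intro mult_left_mono) auto
  also have "\<dots> \<le> degree P * cmod (poly P x)"
    by (rule pderiv_le_of_roots_far[OF y(2)]) auto
  also have "\<dots> \<le> d * a" using assms by (intro mult_mono) auto
  finally show ?thesis using y assms(3) by (auto simp: field_simps)
qed

lemma emeasure_cball_complex:
  "0 \<le> r \<Longrightarrow> emeasure lborel (cball (c::complex) r) = ennreal (pi * r\<^sup>2)"
  by (simp add: emeasure_cball unit_ball_vol_2)

text \<open>The points in question lie in at most \<open>d\<close> discs around the roots. The area
  is quadratic in \<open>a / b\<close>, which is the source of the square of \<open>\<delta>\<close>
  in the later tube estimates.\<close>

lemma emeasure_small_poly_le: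
  fixes P :: "complex poly"
  assumes "degree P \<le> d" "0 < b" "0 \<le> a"
  shows "emeasure lborel {x. cmod (poly P x) \<le> a \<and> b \<le> cmod (poly (pderiv P) x)}
    \<le> ennreal (d * (pi * (d * a / b)\<^sup>2))"
proof (cases "P = 0")
  case False
  let ?R = "{y. poly P y = 0}"
  have fin: "finite ?R" using poly_roots_finite[OF False] .
  have "card ?R \<le> d" using card_poly_roots_bound[OF False] assms by simp
  have "emeasure lborel {x. cmod (poly P x) \<le> a \<and> b \<le> cmod (poly (pderiv P) x)}
     \<le> emeasure lborel (\<Union>y\<in>?R. cball y (d * a / b))"
    by (rule emeasure_mono)
       (use poly_root_near[OF _ _ assms(2,1)] in \<open>auto simp: dist_norm norm_minus_commute fin\<close>)
  also have "\<dots> \<le> (\<Sum>y\<in>?R. emeasure lborel (cball y (d * a / b)))"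
    by (rule emeasure_subadditive_finite) (auto simp: fin)
  also have "\<dots> = (\<Sum>y\<in>?R. ennreal (pi * (d * a / b)\<^sup>2))"
    using assms by (intro sum.cong refl emeasure_cball_complex) auto
  also have "\<dots> = ennreal (card ?R * (pi * (d * a / b)\<^sup>2))"
    by (simp add: ennreal_mult ennreal_of_nat_eq_real_of_nat)
  also have "\<dots> \<le> ennreal (d * (pi * (d * a / b)\<^sup>2))"
    using \<open>card ?R \<le> d\<close> by (intro ennreal_leI mult_right_mono) auto
  finally show ?thesis .
qed (use assms in auto)

section \<open>Continuity and measurability of evaluation\<close>

lemma continuous_on_vector_scalar_mult [continuous_intros]:
  fixes g :: "'a::topological_space \<Rightarrow> complex^'n::finite"
  assumes "continuous_on S f" "continuous_on S g"
  shows "continuous_on S (\<lambda>x. f x *s g x)"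
  unfolding vector_scalar_mult_def using assms by (intro continuous_intros)

lemma continuous_on_peval [continuous_intros]:
  assumes "continuous_on S g"
  shows "continuous_on S (\<lambda>x. peval d c (g x))"
  unfolding peval_def using assms by (intro continuous_intros)

lemma continuous_on_dpeval [continuous_intros]:
  assumes "continuous_on S g"
  shows "continuous_on S (\<lambda>x. dpeval d i c (g x))"
  unfolding dpeval_def using assms by (intro continuous_intros)

lemma measurable_vector_scalar_mult [measurable]:
  fixes g :: "'a \<Rightarrow> complex^'n::finite"
  assumes [measurable]: "f \<in> borel_measurable M" "g \<in> borel_measurable M"
  shows "(\<lambda>x. f x *s g x) \<in> borel_measurable M"
proof -
  have "(\<lambda>w. fst w *s snd w) \<in> borel_measurable (borel :: (complex \<times> (complex^'n)) measure)"
    by (intro borel_measurable_continuous_onI continuous_intros)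
  then have "(\<lambda>w. fst w *s snd w) \<in> borel_measurable (borel \<Otimes>\<^sub>M borel :: (complex \<times> (complex^'n)) measure)"
    by (simp add: borel_prod)
  from measurable_compose[OF measurable_Pair[OF assms] this] show ?thesis by simp
qed

lemma measurable_peval [measurable]:
  assumes [measurable]: "g \<in> borel_measurable M"
  shows "(\<lambda>x. peval d c (g x)) \<in> borel_measurable M"
proof -
  have "peval d c \<in> borel_measurable borel"
    by (intro borel_measurable_continuous_onI continuous_intros)
  from measurable_compose[OF assms this] show ?thesis .
qed

lemma measurable_dpeval [measurable]:
  assumes [measurable]: "g \<in> borel_measurable M"
  shows "(\<lambda>x. dpeval d i c (g x)) \<in> borel_measurable M"
proof -
  have "dpeval d i c \<in> borel_measurable borel"
    by (intro borel_measurable_continuous_onI continuous_intros)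
  from measurable_compose[OF assms this] show ?thesis .
qed

lemma measurable_vec_nth [measurable]:
  assumes [measurable]: "g \<in> borel_measurable M"
  shows "(\<lambda>x. (g x :: complex^'n::finite) $ i) \<in> borel_measurable M"
proof -
  have "(\<lambda>z::complex^'n. z $ i) \<in> borel_measurable borel"
    by (intro borel_measurable_continuous_onI continuous_intros)
  from measurable_compose[OF assms this] show ?thesis .
qed

lemma measurable_dir_deriv [measurable]:
  assumes [measurable]: "g \<in> borel_measurable M" "h \<in> borel_measurable M"
  shows "(\<lambda>x. dir_deriv d c (g x) (h x)) \<in> borel_measurable M"
  unfolding dir_deriv_def by measurable

section \<open>Translation averages, decay integrals and quantitative nondegeneracy\<close>

lemma nn_integral_lborel_translate:
  fixes F :: "'a::euclidean_space \<Rightarrow> ennreal"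
  assumes [measurable]: "F \<in> borel_measurable borel"
  shows "(\<integral>\<^sup>+z. F (c + z) \<partial>lborel) = (\<integral>\<^sup>+z. F z \<partial>lborel)"
proof -
  have "(\<integral>\<^sup>+z. F z \<partial>lborel) = (\<integral>\<^sup>+z. F z \<partial>(distr lborel borel ((+) c)))"
    by (simp only: lborel_distr_plus)
  also have "\<dots> = (\<integral>\<^sup>+z. F (c + z) \<partial>lborel)"
    by (rule nn_integral_distr) auto
  finally show ?thesis by simp
qed

lemma measurable_pred_cball_0 [measurable]:
  fixes f :: "'a \<Rightarrow> complex"
  assumes [measurable]: "f \<in> borel_measurable M"
  shows "Measurable.pred M (\<lambda>x. f x \<in> cball 0 r)"
  unfolding mem_cball_0 by measurable

text \<open>Averaging over translations along a fixed complex direction replaces slicing by Fubini.\<close>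

lemma nn_integral_slice_le:
  fixes F :: "complex^'n::finite \<Rightarrow> ennreal"
  assumes [measurable]: "F \<in> borel_measurable borel" and r: "0 < r"
    and H: "\<And>z. (\<integral>\<^sup>+s. indicator (cball 0 r) s * F (z + s *s e) \<partial>lborel) \<le> H z"
  shows "ennreal (pi * r\<^sup>2) * (\<integral>\<^sup>+z. F z \<partial>lborel) \<le> (\<integral>\<^sup>+z. H z \<partial>lborel)"
proof -
  have "ennreal (pi * r\<^sup>2) * (\<integral>\<^sup>+z. F z \<partial>lborel) =
     (\<integral>\<^sup>+s. indicator (cball (0::complex) r) s * (\<integral>\<^sup>+z. F z \<partial>lborel) \<partial>lborel)"
    using r by (subst nn_integral_multc) (auto simp: emeasure_cball_complex intro!: borel_measurable_indicator)
  also have "\<dots> = (\<integral>\<^sup>+s. indicator (cball 0 r) s * (\<integral>\<^sup>+z. F (z + s *s e) \<partial>lborel) \<partial>lborel)"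
    using nn_integral_lborel_translate[OF assms(1), of "_ *s e"] by (simp add: add.commute)
  also have "\<dots> = (\<integral>\<^sup>+s. (\<integral>\<^sup>+z. indicator (cball 0 r) s * F (z + s *s e) \<partial>lborel) \<partial>lborel)"
    by (intro nn_integral_cong nn_integral_cmult[symmetric]) measurable
  also have "\<dots> = (\<integral>\<^sup>+z. (\<integral>\<^sup>+s. indicator (cball 0 r) s * F (z + s *s e) \<partial>lborel) \<partial>lborel)"
    by (rule lborel_pair.Fubini') measurable
  also have "\<dots> \<le> (\<integral>\<^sup>+z. H z \<partial>lborel)"
    by (intro nn_integral_mono H)
  finally show ?thesis .
qed

text \<open>On the shell of norms between \<open>k\<close> and \<open>k + 1\<close> the ball volume
  cancels the power \<open>DIM('a)\<close> of the weight and leaves a multiple of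
  \<open>1 / (k + 1)\<^sup>2\<close>.\<close>

lemma nn_integral_decay_finite:
  "(\<integral>\<^sup>+z. ennreal (1 / (1 + norm z) ^ (DIM('a) + 2)) \<partial>(lborel :: 'a::euclidean_space measure)) < \<infinity>"
proof -
  let ?N = "DIM('a)" and ?V = "unit_ball_vol DIM('a)"
  define f where "f k z = indicator (ball (0::'a) (real k + 1)) z * ennreal (1 / (1 + real k) ^ (?N + 2))" for k :: nat and z
  have [measurable]: "f k \<in> borel_measurable lborel" for k
    unfolding f_def by (intro borel_measurable_times_ennreal borel_measurable_indicator) auto
  have "(\<integral>\<^sup>+z. ennreal (1 / (1 + norm z) ^ (?N + 2)) \<partial>(lborel :: 'a measure)) \<le> (\<integral>\<^sup>+z. (\<Sum>k. f k z) \<partial>lborel)"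
  proof (rule nn_integral_mono)
    fix z :: 'a
    define k where "k = nat \<lfloor>norm z\<rfloor>"
    have k: "real k \<le> norm z" "norm z < real k + 1" by (auto simp: k_def)
    have "ennreal (1 / (1 + norm z) ^ (?N + 2)) \<le> f k z"
      unfolding f_def using k by (simp del: add_2_eq_Suc' power_Suc) (intro ennreal_leI divide_left_mono power_mono zero_less_power mult_pos_pos; simp add: add_pos_nonneg)
    also have "f k z \<le> (\<Sum>k. f k z)"
      using sum_le_suminf[of "\<lambda>k. f k z" "{k}"] by simp
    finally show "ennreal (1 / (1 + norm z) ^ (?N + 2)) \<le> (\<Sum>k. f k z)" .
  qed
  also have "\<dots> = (\<Sum>k. \<integral>\<^sup>+z. f k z \<partial>lborel)"
    by (rule nn_integral_suminf) measurable
  also have "\<dots> = (\<Sum>k. ennreal (?V * (1 / (real k + 1)\<^sup>2)))"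
  proof (rule suminf_cong)
    fix k
    have "(\<integral>\<^sup>+z. f k z \<partial>lborel) = ennreal (?V * (real k + 1) ^ ?N) * ennreal (1 / (1 + real k) ^ (?N + 2))"
      unfolding f_def by (subst nn_integral_multc) (auto intro!: borel_measurable_indicator simp: emeasure_ball)
    also have "\<dots> = ennreal (?V * (1 / (real k + 1)\<^sup>2))"
    proof -
      have "?V * (real k + 1) ^ ?N * (1 / (1 + real k) ^ (?N + 2)) = ?V * (1 / (real k + 1)\<^sup>2)"
        unfolding power_add by (simp add: add.commute)
      then show ?thesis by (simp add: ennreal_mult[symmetric] del: add_2_eq_Suc' power_Suc)
    qed
    finally show "(\<integral>\<^sup>+z. f k z \<partial>lborel) = ennreal (?V * (1 / (real k + 1)\<^sup>2))" .
  qed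
  also have "\<dots> < \<infinity>"
  proof -
    have "summable (\<lambda>k. 1 / (real k + 1)\<^sup>2)"
      using inverse_power_summable[of 2] summable_Suc_iff[of "\<lambda>n. inverse (real n ^ 2)"]
      by (simp add: inverse_eq_divide add.commute)
    then have "summable (\<lambda>k. ?V * (1 / (real k + 1)\<^sup>2))" by (rule summable_mult)
    then show ?thesis by (simp add: suminf_ennreal_eq[OF _ summable_sums])
  qed
  finally show ?thesis .
qed

text \<open>Completing the square bounds \<open>K * t\<close> by
  \<open>4 * K\<^sup>2 + t\<^sup>2 / 16\<close>. The factor 1/16 is a decay rate that survives when
  a Gaussian in \<open>(u, v)\<close> is rewritten in \<open>(u, z)\<close> with
  \<open>z = x *s u + v\<close> and \<open>cmod x \<le> 2\<close>.\<close>

lemma exp_neg_square_le: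
  assumes "0 \<le> t"
  shows "exp (- t\<^sup>2 / 16) \<le> exp (4 * (real K)\<^sup>2) / (1 + t) ^ K"
proof -
  have "(1 + t) ^ K \<le> exp t ^ K"
    using assms by (intro power_mono) auto
  also have "\<dots> = exp (K * t)" by (simp add: exp_of_nat_mult)
  also have "\<dots> \<le> exp (4 * (real K)\<^sup>2 + t\<^sup>2 / 16)"
    using zero_le_power2[of "t / 4 - 2 * K"] by (simp add: power2_eq_square field_simps)
  also have "\<dots> = exp (4 * (real K)\<^sup>2) / exp (- t\<^sup>2 / 16)"
    by (simp only: exp_add exp_minus minus_divide_left[symmetric] divide_inverse inverse_inverse_eq mult_minus_left)
  finally show ?thesis using assms by (simp add: field_simps)
qed

text \<open>The quantitative form of not being \<open>singular\<close>. The constants below depend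
  on a polynomial only through \<open>\<kappa>\<close> and a bound on its coefficients, which is
  what makes them uniform over compact families.\<close>

definition nondeg :: "nat \<Rightarrow> real \<Rightarrow> (('n::finite \<Rightarrow> nat) \<Rightarrow> complex) \<Rightarrow> bool" where
  "nondeg d \<kappa> c \<longleftrightarrow> (\<forall>z::complex^'n. norm z = 1 \<longrightarrow>
     \<kappa> \<le> cmod (peval d c z) + (\<Sum>i\<in>UNIV. cmod (dpeval d i c z)))"

lemma nondeg_partial:
  fixes z :: "complex^'n::finite"
  assumes "nondeg d \<kappa> c" "z \<noteq> 0" "cmod (peval d c z) \<le> \<kappa> / 2 * norm z ^ d"
  shows "\<exists>i. \<kappa> / (2 * CARD('n)) * norm z ^ (d - 1) \<le> cmod (dpeval d i c z)"
proof (rule ccontr)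
  assume "\<not> ?thesis"
  then have *: "cmod (dpeval d i c z) < \<kappa> / (2 * CARD('n)) * norm z ^ (d - 1)" for i
    by (simp add: not_le)
  define k where "k = complex_of_real (norm z)"
  define x where "x = inverse k *s z"
  have k: "k \<noteq> 0" "cmod k = norm z" using assms by (auto simp: k_def)
  have zx: "z = k *s x" using k by (simp add: x_def)
  have "norm x = 1" using k assms(2) by (simp add: x_def norm_vector_scalar_mult norm_inverse)
  then have 1: "\<kappa> \<le> cmod (peval d c x) + (\<Sum>i\<in>UNIV. cmod (dpeval d i c x))"
    using assms by (auto simp: nondeg_def)
  have "cmod (peval d c x) \<le> \<kappa> / 2"
    using assms(2,3) unfolding zx peval_homogeneous norm_mult norm_power k
    by (simp add: norm_vector_scalar_mult \<open>norm x = 1\<close> k zx[symmetric] mult.commute)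
  moreover have "(\<Sum>i\<in>UNIV. cmod (dpeval d i c x)) < (\<Sum>i\<in>(UNIV::'n set). \<kappa> / (2 * CARD('n)))"
  proof (rule sum_strict_mono)
    fix i
    show "cmod (dpeval d i c x) < \<kappa> / (2 * CARD('n))"
      using *[of i] assms(2) unfolding zx dpeval_homogeneous norm_mult norm_power k
      by (simp add: norm_vector_scalar_mult \<open>norm x = 1\<close> k zx[symmetric] mult.commute[of _ "norm z ^ _"]
          times_divide_eq_right[symmetric] del: times_divide_eq_right)
  qed auto
  ultimately show False using 1 by simp
qed

section \<open>Volume of tubes around nonsingular hypersurfaces\<close>

lemma dir_deriv_axis: "dir_deriv d c z (axis i 1) = dpeval d i c z"
  by (simp add: dir_deriv_def axis_def if_distrib cong: if_cong)

lemma norm_axis_complex [simp]: "norm (axis i (x::complex) :: complex^'n::finite) = cmod x"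
proof -
  have "(\<Sum>j\<in>UNIV. (cmod (axis i x $ j :: complex))\<^sup>2) = (\<Sum>j\<in>(UNIV::'n set). if j = i then (cmod x)\<^sup>2 else 0)"
    by (intro sum.cong) (auto simp: axis_def)
  then show ?thesis by (simp add: norm_vec_def L2_set_def)
qed

text \<open>Slicing by complex lines parallel to the axis \<open>i\<close> reduces the volume to the
  one-variable area bound. Translations of length at most \<open>r\<close> reach the ball of radius
  \<open>2 * r\<close> only from points of norm at most \<open>3 * r\<close>, whence the power of
  \<open>3 * r\<close>.\<close>

lemma tube_shell_coordinate:
  fixes c :: "('n::finite \<Rightarrow> nat) \<Rightarrow> complex" and d :: nat and i :: 'n and a b r :: real
  assumes "0 < b" "0 \<le> a" "0 < r"
  defines "A \<equiv> {z::complex^'n. norm z \<le> 2 * r \<and> cmod (peval d c z) \<le> a \<and> b \<le> cmod (dpeval d i c z)}"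
  shows "emeasure lborel A \<le> ennreal (unit_ball_vol DIM(complex^'n) * (3 * r) ^ DIM(complex^'n) * (d * (d * a / b)\<^sup>2) / r\<^sup>2)"
proof -
  let ?N = "DIM(complex^'n)"
  let ?V = "unit_ball_vol DIM(complex^'n)"
  let ?e = "axis i 1 :: complex^'n"
  let ?m = "d * (pi * (d * a / b)\<^sup>2)"
  have [measurable]: "A \<in> sets borel" unfolding A_def by measurable
  define H :: "complex^'n \<Rightarrow> ennreal" where "H z = indicator (cball 0 (3 * r)) z * ennreal ?m" for z
  have "(\<integral>\<^sup>+s. indicator (cball 0 r) s * indicator A (z + s *s ?e) \<partial>lborel) \<le> H z" for z
  proof (cases "norm z \<le> 3 * r")
    case True
    let ?P = "restr_poly d c ?e z"
    have "(\<integral>\<^sup>+s. indicator (cball 0 r) s * indicator A (z + s *s ?e) \<partial>lborel) \<le>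
      (\<integral>\<^sup>+s. indicator {x. cmod (poly ?P x) \<le> a \<and> b \<le> cmod (poly (pderiv ?P) x)} s \<partial>lborel)"
      by (rule nn_integral_mono)
         (auto simp: indicator_def A_def poly_restr_poly poly_pderiv_restr_poly dir_deriv_axis add.commute)
    also have "\<dots> = emeasure lborel {x. cmod (poly ?P x) \<le> a \<and> b \<le> cmod (poly (pderiv ?P) x)}"
      unfolding poly_restr_poly poly_pderiv_restr_poly
      by (rule nn_integral_indicator) measurable
    also have "\<dots> \<le> ennreal ?m"
      using assms by (intro emeasure_small_poly_le degree_restr_poly) auto
    finally show ?thesis using True by (simp add: H_def)
  next
    case False
    have "indicator (cball 0 r) s * indicator A (z + s *s ?e) = (0::ennreal)" for s
    proof -
      have "norm z \<le> norm (z + s *s ?e) + norm (s *s ?e)"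
        using norm_triangle_ineq4[of "z + s *s ?e" "s *s ?e"] by simp
      then have "norm z \<le> norm (z + s *s ?e) + cmod s"
        by (simp add: norm_vector_scalar_mult)
      then show ?thesis using False by (auto simp: indicator_def A_def)
    qed
    then show ?thesis by (simp only: nn_integral_const mult_zero_left zero_le)
  qed
  from nn_integral_slice_le[OF _ \<open>0 < r\<close> this]
  have "ennreal (pi * r\<^sup>2) * emeasure lborel A \<le> (\<integral>\<^sup>+z. H z \<partial>lborel)" by simp
  also have "\<dots> = ennreal (?V * (3 * r) ^ ?N) * ennreal ?m"
    unfolding H_def using assms
    by (subst nn_integral_multc) (auto intro!: borel_measurable_indicator simp: emeasure_cball)
  finally have *: "ennreal (pi * r\<^sup>2) * emeasure lborel A \<le> ennreal (?V * (3 * r) ^ ?N * ?m)"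
    using assms by (simp add: ennreal_mult)
  have "emeasure lborel A = ennreal (1 / (pi * r\<^sup>2)) * (ennreal (pi * r\<^sup>2) * emeasure lborel A)"
    using \<open>0 < r\<close> by (simp add: mult.assoc[symmetric] ennreal_mult[symmetric])
  also have "\<dots> \<le> ennreal (1 / (pi * r\<^sup>2)) * ennreal (?V * (3 * r) ^ ?N * ?m)"
    by (intro mult_left_mono *) auto
  also have "\<dots> = ennreal (?V * (3 * r) ^ ?N * (d * (d * a / b)\<^sup>2) / r\<^sup>2)"
    using assms by (subst ennreal_mult[symmetric]) (auto simp: field_simps)
  finally show ?thesis .
qed

text \<open>The factors come from the choice of the large partial derivative, from the volume of a
  ball of radius \<open>3 * r\<close>, and from the number of roots times the squared width
  \<open>d * a / b\<close>, for the \<open>a\<close> and \<open>b\<close> of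
  \<open>emeasure_tube_shell\<close>.\<close>

definition tube_const :: "nat \<Rightarrow> real \<Rightarrow> 'n::finite itself \<Rightarrow> real" where
  "tube_const d \<kappa> T = CARD('n) * (unit_ball_vol DIM(complex^'n) * 3 ^ DIM(complex^'n) *
     (d * (d * 2 ^ (d + 1) * CARD('n) / \<kappa>)\<^sup>2))"

lemma tube_const_nonneg: "0 \<le> tube_const d \<kappa> TYPE('n::finite)"
  by (simp add: tube_const_def)

text \<open>On one shell the homogeneous bounds freeze to constants: \<open>a\<close> is the largest
  admissible value, at norm \<open>2 * r\<close>, and \<open>b\<close> the smallest gradient entry,
  at norm \<open>r\<close>. Their quotient is a constant times \<open>\<eta> * r\<close>, so the
  dependence on \<open>r\<close> is that of a ball volume.\<close>

lemma emeasure_tube_shell: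
  fixes c :: "('n::finite \<Rightarrow> nat) \<Rightarrow> complex"
  assumes nd: "nondeg d \<kappa> c" and "0 < \<kappa>" "0 \<le> \<eta>" "\<eta> \<le> \<kappa> / 2" "0 < r" "1 \<le> d"
  shows "emeasure lborel {z::complex^'n. r \<le> norm z \<and> norm z \<le> 2 * r \<and> cmod (peval d c z) \<le> \<eta> * norm z ^ d}
     \<le> ennreal (tube_const d \<kappa> TYPE('n) * \<eta>\<^sup>2 * r ^ DIM(complex^'n))"
proof -
  let ?N = "DIM(complex^'n)" and ?V = "unit_ball_vol DIM(complex^'n)"
  define a where "a = \<eta> * (2 * r) ^ d"
  define b where "b = \<kappa> / (2 * CARD('n)) * r ^ (d - 1)"
  define A where "A i = {z::complex^'n. norm z \<le> 2 * r \<and> cmod (peval d c z) \<le> a \<and> b \<le> cmod (dpeval d i c z)}" for i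
  have b: "0 < b" using assms by (simp add: b_def)
  have [measurable]: "A i \<in> sets borel" for i unfolding A_def by measurable
  have "{z::complex^'n. r \<le> norm z \<and> norm z \<le> 2 * r \<and> cmod (peval d c z) \<le> \<eta> * norm z ^ d} \<subseteq> (\<Union>i. A i)"
  proof clarify
    fix z :: "complex^'n" assume z: "r \<le> norm z" "norm z \<le> 2 * r" "cmod (peval d c z) \<le> \<eta> * norm z ^ d"
    have "cmod (peval d c z) \<le> \<kappa> / 2 * norm z ^ d"
      using z(3) assms(4) mult_right_mono[of \<eta> "\<kappa>/2" "norm z ^ d"] by simp
    moreover have "z \<noteq> 0" using z assms by auto
    ultimately obtain i where i: "\<kappa> / (2 * CARD('n)) * norm z ^ (d - 1) \<le> cmod (dpeval d i c z)"
      using nondeg_partial[OF nd] by blast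
    have "b \<le> \<kappa> / (2 * CARD('n)) * norm z ^ (d - 1)"
      unfolding b_def using z assms by (intro mult_left_mono power_mono) auto
    moreover have "\<eta> * norm z ^ d \<le> a"
      unfolding a_def using z assms by (intro mult_left_mono power_mono) auto
    ultimately have "z \<in> A i" using i z unfolding A_def by (auto intro: order_trans)
    then show "z \<in> (\<Union>i. A i)" by blast
  qed
  then have "emeasure lborel {z::complex^'n. r \<le> norm z \<and> norm z \<le> 2 * r \<and> cmod (peval d c z) \<le> \<eta> * norm z ^ d}
     \<le> emeasure lborel (\<Union>i. A i)"
    by (rule emeasure_mono) simp
  also have "\<dots> \<le> (\<Sum>i\<in>UNIV. emeasure lborel (A i))"
    by (rule emeasure_subadditive_finite) auto
  also have "\<dots> \<le> (\<Sum>i\<in>(UNIV::'n set). ennreal (?V * (3 * r) ^ ?N * (d * (d * a / b)\<^sup>2) / r\<^sup>2))"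
    unfolding A_def using assms b by (intro sum_mono tube_shell_coordinate) (auto simp: a_def)
  also have "\<dots> = ennreal (CARD('n) * (?V * (3 * r) ^ ?N * (d * (d * a / b)\<^sup>2) / r\<^sup>2))"
    using assms by (subst sum_ennreal) auto
  also have "CARD('n) * (?V * (3 * r) ^ ?N * (d * (d * a / b)\<^sup>2) / r\<^sup>2) =
     tube_const d \<kappa> TYPE('n) * \<eta>\<^sup>2 * r ^ ?N"
  proof -
    have "r ^ d = r * r ^ (d - 1)" using assms(6) by (metis power_eq_if not_one_le_zero)
    then have "d * a / b = d * 2 ^ (d + 1) * CARD('n) / \<kappa> * \<eta> * r"
      using assms by (simp add: a_def b_def field_simps power_mult_distrib)
    then show ?thesis using assms
      unfolding tube_const_def by (simp only: power_mult_distrib) (simp add: field_simps)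
  qed
  finally show ?thesis .
qed

lemma dyadic_shell:
  fixes t :: real
  assumes "0 < t"
  shows "\<exists>k::nat. (2 ^ k \<le> t \<and> t \<le> 2 * 2 ^ k) \<or> (1 / 2 ^ k \<le> t \<and> t \<le> 2 * (1 / 2 ^ k))"
proof -
  define m where "m = \<lfloor>log 2 t\<rfloor>"
  have "2 powr m \<le> t" "t \<le> 2 powr (m + 1)"
    using assms by (auto simp: m_def powr_le_iff le_powr_iff le_log_iff log_le_iff less_log_iff intro: less_imp_le)
  then have *: "2 powr m \<le> t" "t \<le> 2 * 2 powr m" by (auto simp: powr_add)
  show ?thesis
  proof (cases "0 \<le> m")
    case True
    then have "2 powr m = 2 ^ nat m" by (simp add: powr_realpow[symmetric])
    then show ?thesis using * by (intro exI[of _ "nat m"]) auto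
  next
    case False
    then have "2 powr m = 1 / 2 ^ nat (- m)"
      by (simp add: powr_realpow[symmetric] powr_minus_divide[symmetric])
    then show ?thesis using * by (intro exI[of _ "nat (- m)"]) auto
  qed
qed

text \<open>Dyadic shells reduce the weighted integral to a geometric series. Outward, the decay of
  the weight beats the growth of the shells; inward, the pole \<open>1 / (norm z)\<^sup>2\<close>
  meets a volume of order \<open>r ^ DIM(complex^'n)\<close>, which wins because the real dimension
  is at least 4.\<close>

lemma nn_integral_tube_le:
  fixes c :: "('n::finite \<Rightarrow> nat) \<Rightarrow> complex"
  assumes nd: "nondeg d \<kappa> c" and "0 < \<kappa>" "0 \<le> \<eta>" "\<eta> \<le> \<kappa> / 2" "1 \<le> d" and card: "CARD('n) \<ge> 2"
  shows "(\<integral>\<^sup>+z. ennreal (1 / (1 + norm z) ^ (DIM(complex^'n) + 2) * (1 + 1 / (norm z)\<^sup>2)) *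
       indicator {z::complex^'n. z \<noteq> 0 \<and> cmod (peval d c z) \<le> \<eta> * norm z ^ d} z \<partial>lborel)
     \<le> ennreal (6 * tube_const d \<kappa> TYPE('n) * \<eta>\<^sup>2)"
proof -
  let ?N = "DIM(complex^'n)"
  have N: "4 \<le> ?N" using card by simp
  define C where "C = tube_const d \<kappa> TYPE('n)"
  have C: "0 \<le> C" by (simp add: C_def tube_const_nonneg)
  define Sh where "Sh r = {z::complex^'n. r \<le> norm z \<and> norm z \<le> 2 * r \<and> cmod (peval d c z) \<le> \<eta> * norm z ^ d}" for r
  have [measurable]: "Sh r \<in> sets borel" for r unfolding Sh_def by measurable
  define f where "f k z = ennreal (2 / (2 ^ k) ^ (?N + 2)) * indicator (Sh (2 ^ k)) z +
     ennreal (2 * (2 ^ k)\<^sup>2) * indicator (Sh (1 / 2 ^ k)) z" for k :: nat and z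
  have [measurable]: "f k \<in> borel_measurable lborel" for k unfolding f_def by measurable
  have "(\<integral>\<^sup>+z. ennreal (1 / (1 + norm z) ^ (?N + 2) * (1 + 1 / (norm z)\<^sup>2)) *
       indicator {z::complex^'n. z \<noteq> 0 \<and> cmod (peval d c z) \<le> \<eta> * norm z ^ d} z \<partial>lborel)
    \<le> (\<integral>\<^sup>+z. (\<Sum>k. f k z) \<partial>lborel)"
  proof (rule nn_integral_mono)
    fix z :: "complex^'n"
    let ?w = "1 / (1 + norm z) ^ (?N + 2) * (1 + 1 / (norm z)\<^sup>2)"
    show "ennreal ?w * indicator {z::complex^'n. z \<noteq> 0 \<and> cmod (peval d c z) \<le> \<eta> * norm z ^ d} z \<le> (\<Sum>k. f k z)"
    proof (cases "z \<noteq> 0 \<and> cmod (peval d c z) \<le> \<eta> * norm z ^ d")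
      case True
      then have "0 < norm z" by simp
      from dyadic_shell[OF this] obtain k :: nat
        where k: "(2 ^ k \<le> norm z \<and> norm z \<le> 2 * 2 ^ k) \<or> (1 / 2 ^ k \<le> norm z \<and> norm z \<le> 2 * (1 / 2 ^ k))"
        by blast
      have "ennreal ?w \<le> f k z"
        using k
      proof
        assume k: "2 ^ k \<le> norm z \<and> norm z \<le> 2 * 2 ^ k"
        have "1 \<le> norm z" using k one_le_power[of "2::real" k] by linarith
        then have "1 / (norm z)\<^sup>2 \<le> 1" using one_le_power[of "norm z" 2] by (simp add: divide_le_eq_1)
        then have "1 + 1 / (norm z)\<^sup>2 \<le> 2" by simp
        moreover have "1 / (1 + norm z) ^ (?N + 2) \<le> 1 / (2 ^ k) ^ (?N + 2)"
          using k by (intro divide_left_mono power_mono mult_pos_pos zero_less_power) (auto simp: add_pos_nonneg)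
        ultimately have "?w \<le> 1 / (2 ^ k) ^ (?N + 2) * 2" by (intro mult_mono) auto
        then have "ennreal ?w \<le> ennreal (2 / (2 ^ k) ^ (?N + 2)) * indicator (Sh (2 ^ k)) z"
          using k True by (auto simp: Sh_def intro: ennreal_leI)
        then show ?thesis unfolding f_def by (rule order_trans) simp
      next
        assume k: "1 / 2 ^ k \<le> norm z \<and> norm z \<le> 2 * (1 / 2 ^ k)"
        have "1 / (norm z)\<^sup>2 \<le> 1 / (1 / 2 ^ k)\<^sup>2"
          using k True by (intro divide_left_mono power_mono mult_pos_pos zero_less_power) auto
        moreover have "1 \<le> ((2::real) ^ k)\<^sup>2" by simp
        ultimately have "1 + 1 / (norm z)\<^sup>2 \<le> 2 * (2 ^ k)\<^sup>2"
          unfolding power_divide power_one div_by_1 divide_divide_eq_right mult_1_left by linarith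
        moreover have "1 / (1 + norm z) ^ (?N + 2) \<le> 1"
          using one_le_power[of "1 + norm z" "?N + 2"] by (simp add: divide_le_eq_1 add_pos_nonneg del: add_2_eq_Suc' power_Suc)
        ultimately have "?w \<le> 1 * (2 * (2 ^ k)\<^sup>2)" by (intro mult_mono) auto
        then have "ennreal ?w \<le> ennreal (2 * (2 ^ k)\<^sup>2) * indicator (Sh (1 / 2 ^ k)) z"
          using k True by (auto simp: Sh_def intro: ennreal_leI)
        then show ?thesis unfolding f_def by (rule order_trans) simp
      qed
      also have "f k z \<le> (\<Sum>k. f k z)"
        using sum_le_suminf[of "\<lambda>k. f k z" "{k}"] by simp
      finally show ?thesis using True by simp
    qed simp
  qed
  also have "\<dots> = (\<Sum>k. \<integral>\<^sup>+z. f k z \<partial>lborel)"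
    by (rule nn_integral_suminf) measurable
  also have "\<dots> \<le> (\<Sum>k. ennreal (C * \<eta>\<^sup>2 * 4 * (1 / 4) ^ k))"
  proof (rule suminf_le)
    fix k :: nat
    have S: "emeasure lborel (Sh r) \<le> ennreal (C * \<eta>\<^sup>2 * r ^ ?N)" if "0 < r" for r
      unfolding Sh_def C_def using assms that by (intro emeasure_tube_shell) auto
    have "(\<integral>\<^sup>+z. f k z \<partial>lborel) = ennreal (2 / (2 ^ k) ^ (?N + 2)) * emeasure lborel (Sh (2 ^ k)) +
      ennreal (2 * (2 ^ k)\<^sup>2) * emeasure lborel (Sh (1 / 2 ^ k))"
      unfolding f_def by (simp add: nn_integral_add nn_integral_cmult)
    also have "\<dots> \<le> ennreal (2 / (2 ^ k) ^ (?N + 2)) * ennreal (C * \<eta>\<^sup>2 * (2 ^ k) ^ ?N) +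
      ennreal (2 * (2 ^ k)\<^sup>2) * ennreal (C * \<eta>\<^sup>2 * (1 / 2 ^ k) ^ ?N)"
      by (intro add_mono mult_left_mono S) auto
    also have "\<dots> = ennreal (C * \<eta>\<^sup>2 * (2 / (2 ^ k)\<^sup>2 + 2 * (2 ^ k)\<^sup>2 * (1 / 2 ^ k) ^ ?N))"
    proof -
      have "2 / (2 ^ k) ^ (?N + 2) * (C * \<eta>\<^sup>2 * (2 ^ k) ^ ?N) + 2 * (2 ^ k)\<^sup>2 * (C * \<eta>\<^sup>2 * (1 / 2 ^ k) ^ ?N)
         = C * \<eta>\<^sup>2 * (2 / (2 ^ k)\<^sup>2 + 2 * (2 ^ k)\<^sup>2 * (1 / 2 ^ k) ^ ?N)"
        unfolding power_add[of "2 ^ k" ?N 2] by (simp add: distrib_left)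
      then show ?thesis using C by (subst (1 2) ennreal_mult[symmetric]) (auto simp flip: ennreal_plus)
    qed
    also have "\<dots> \<le> ennreal (C * \<eta>\<^sup>2 * 4 * (1 / 4) ^ k)"
    proof (rule ennreal_leI)
      have e: "((2::real) ^ k)\<^sup>2 = 4 ^ k" by (simp add: power2_eq_square flip: power_mult_distrib)
      have "(1 / 2 ^ k) ^ ?N \<le> (1 / 2 ^ k :: real) ^ 4"
        using N by (intro power_decreasing) auto
      also have "\<dots> = 1 / ((2 ^ k)\<^sup>2 * (2 ^ k)\<^sup>2)" by (simp add: power_divide power_add[symmetric] power2_eq_square power4_eq_xxxx)
      finally have "2 * (2 ^ k)\<^sup>2 * (1 / 2 ^ k) ^ ?N \<le> 2 * (2 ^ k)\<^sup>2 * (1 / (((2::real) ^ k)\<^sup>2 * (2 ^ k)\<^sup>2))"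
        by (intro mult_left_mono) auto
      then have "2 / (2 ^ k)\<^sup>2 + 2 * (2 ^ k)\<^sup>2 * (1 / 2 ^ k) ^ ?N \<le> 4 * (1 / (4::real)) ^ k"
        unfolding e by (simp add: power_divide field_simps)
      from mult_left_mono[OF this, of "C * \<eta>\<^sup>2"]
      show "C * \<eta>\<^sup>2 * (2 / (2 ^ k)\<^sup>2 + 2 * (2 ^ k)\<^sup>2 * (1 / 2 ^ k) ^ ?N) \<le> C * \<eta>\<^sup>2 * 4 * (1 / 4) ^ k"
        using C by (simp add: mult.assoc)
    qed
    finally show "(\<integral>\<^sup>+z. f k z \<partial>lborel) \<le> ennreal (C * \<eta>\<^sup>2 * 4 * (1 / 4) ^ k)" .
  qed auto
  \<comment> \<open>The series gives the factor 16/3, rounded up to the 6 of the statement.\<close>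
  also have "\<dots> = ennreal (C * \<eta>\<^sup>2 * 4 * (1 / (1 - 1 / 4)))"
    using C by (intro suminf_ennreal_eq sums_mult geometric_sums) auto
  also have "\<dots> \<le> ennreal (6 * C * \<eta>\<^sup>2)"
    using C mult_nonneg_nonneg[OF C, of "\<eta>\<^sup>2"] by (intro ennreal_leI) (simp add: mult_ac)
  finally show ?thesis unfolding C_def .
qed

text \<open>The set is a neighbourhood of the complex hyperplane on which the linear form
  \<open>g\<close> vanishes. Along the axis of a large entry, the parameters that stay inside lie in
  a disc of radius \<open>\<rho>\<close>; one complex condition costs two real dimensions, so the
  bound is quadratic in \<open>\<epsilon>\<close>.\<close>

lemma nn_integral_slab_le:
  fixes g :: "complex^'n::finite"
  assumes b: "b \<le> cmod (g $ i)" "0 < b" and "0 \<le> \<epsilon>" "0 \<le> m"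
  shows "(\<integral>\<^sup>+u. ennreal (1 / (1 + norm u) ^ (DIM(complex^'n) + 4)) *
       indicator {u::complex^'n. cmod (\<Sum>j\<in>UNIV. g $ j * u $ j) \<le> \<epsilon> * (1 + norm u + m)} u \<partial>lborel)
    \<le> ennreal (2 ^ (DIM(complex^'n) + 4) * (2 * \<epsilon> * (1 + m) / b)\<^sup>2) *
       (\<integral>\<^sup>+u. ennreal (1 / (1 + norm u) ^ (DIM(complex^'n) + 2)) \<partial>(lborel :: (complex^'n) measure))"
    (is "?L \<le> ennreal ?c * ?I")
proof -
  let ?N = "DIM(complex^'n)"
  let ?e = "axis i 1 :: complex^'n"
  define K where "K = ?N + 4"
  define S where "S u = (\<Sum>j\<in>UNIV. g $ j * u $ j)" for u :: "complex^'n"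
  define F where "F u = ennreal (1 / (1 + norm u) ^ K) * indicator {u::complex^'n. cmod (S u) \<le> \<epsilon> * (1 + norm u + m)} u" for u
  have [measurable]: "F \<in> borel_measurable borel"
    unfolding F_def S_def by measurable
  have gi: "g $ i \<noteq> 0" using b by auto
  have "(\<integral>\<^sup>+s. indicator (cball 0 1) s * F (u + s *s ?e) \<partial>lborel) \<le> ennreal (pi * ?c / (1 + norm u) ^ (?N + 2))" for u
  proof -
    \<comment> \<open>The width \<open>\<epsilon> * (1 + norm u + m)\<close> after a shift of length
      at most 1, majorised by a product so that the square of \<open>1 + norm u\<close> can be taken
      from the weight.\<close>
    define \<rho> where "\<rho> = \<epsilon> * (2 * (1 + norm u) * (1 + m)) / b"
    have \<rho>: "0 \<le> \<rho>" using assms by (simp add: \<rho>_def)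
    have "(\<integral>\<^sup>+s. indicator (cball 0 1) s * F (u + s *s ?e) \<partial>lborel) \<le>
       (\<integral>\<^sup>+s. ennreal (2 ^ K / (1 + norm u) ^ K) * indicator (cball (- S u / g $ i) \<rho>) s \<partial>lborel)"
    proof (rule nn_integral_mono)
      fix s :: complex
      show "indicator (cball 0 1) s * F (u + s *s ?e) \<le> ennreal (2 ^ K / (1 + norm u) ^ K) * indicator (cball (- S u / g $ i) \<rho>) s"
      proof (cases "cmod s \<le> 1 \<and> cmod (S (u + s *s ?e)) \<le> \<epsilon> * (1 + norm (u + s *s ?e) + m)")
        case True
        have n: "norm (s *s ?e) \<le> 1" using True by (simp add: norm_vector_scalar_mult)
        have n1: "norm (u + s *s ?e) \<le> norm u + 1"
          using norm_triangle_ineq[of u "s *s ?e"] n by linarith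
        have n2: "norm u \<le> norm (u + s *s ?e) + 1"
          using norm_triangle_ineq4[of "u + s *s ?e" "s *s ?e"] n by simp
        have "S (u + s *s ?e) = S u + s * g $ i"
        proof -
          have "S (u + s *s ?e) = (\<Sum>j\<in>UNIV. g $ j * u $ j + (if j = i then s * g $ i else 0))"
            unfolding S_def by (intro sum.cong) (auto simp: axis_def algebra_simps)
          then show ?thesis by (simp add: sum.distrib S_def)
        qed
        also have "\<dots> = g $ i * (s - (- S u / g $ i))" using gi by (simp add: field_simps)
        finally have "cmod (g $ i) * cmod (s - (- S u / g $ i)) \<le> \<epsilon> * (1 + norm (u + s *s ?e) + m)"
          using True by (simp add: norm_mult[symmetric])
        also have "\<dots> \<le> \<epsilon> * (2 * (1 + norm u) * (1 + m))"
        proof (intro mult_left_mono \<open>0 \<le> \<epsilon>\<close>)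
          have "0 \<le> norm u * m" using \<open>0 \<le> m\<close> by simp
          moreover have "2 * (1 + norm u) * (1 + m) = 2 + 2 * norm u + 2 * m + 2 * (norm u * m)"
            by (simp add: algebra_simps)
          ultimately show "1 + norm (u + s *s ?e) + m \<le> 2 * (1 + norm u) * (1 + m)"
            using n1 \<open>0 \<le> m\<close> norm_ge_zero[of u] by linarith
        qed
        finally have "b * cmod (s - (- S u / g $ i)) \<le> \<epsilon> * (2 * (1 + norm u) * (1 + m))"
          using mult_right_mono[OF b(1), of "cmod (s - (- S u / g $ i))"] by simp
        then have 1: "s \<in> cball (- S u / g $ i) \<rho>"
          using b by (simp add: \<rho>_def dist_norm norm_minus_commute field_simps)
        have "(1 + norm u) ^ K \<le> (2 * (1 + norm (u + s *s ?e))) ^ K"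
        proof (rule power_mono)
          have "1 + norm u \<le> 2 * (1 + n)" if "norm u \<le> n + 1" "0 \<le> n" for n using that by simp
          from this[OF n2 norm_ge_zero] show "1 + norm u \<le> 2 * (1 + norm (u + s *s ?e))" .
        qed simp
        then have "1 / (1 + norm (u + s *s ?e)) ^ K \<le> 2 ^ K / (1 + norm u) ^ K"
          unfolding power_mult_distrib by (simp add: field_simps add_pos_nonneg)
        then show ?thesis using 1 True by (simp add: F_def ennreal_leI)
      qed (auto simp: F_def)
    qed
    also have "\<dots> = ennreal (2 ^ K / (1 + norm u) ^ K) * ennreal (pi * \<rho>\<^sup>2)"
      using \<rho> by (subst nn_integral_cmult) (auto intro!: borel_measurable_indicator simp: emeasure_cball_complex)
    also have "\<dots> = ennreal (2 ^ K / (1 + norm u) ^ K * (pi * \<rho>\<^sup>2))"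
      by (simp add: ennreal_mult[symmetric])
    also have "2 ^ K / (1 + norm u) ^ K * (pi * \<rho>\<^sup>2) = pi * ?c / (1 + norm u) ^ (?N + 2)"
    proof -
      have "\<rho> = (2 * \<epsilon> * (1 + m) / b) * (1 + norm u)" by (simp add: \<rho>_def)
      then have "\<rho>\<^sup>2 = (2 * \<epsilon> * (1 + m) / b)\<^sup>2 * (1 + norm u)\<^sup>2" by (simp only: power_mult_distrib)
      moreover have "(1 + norm u) ^ K = (1 + norm u) ^ (?N + 2) * (1 + norm u)\<^sup>2"
        unfolding K_def by (simp only: power_add[symmetric]) (simp add: eval_nat_numeral)
      moreover have "1 + norm u > 0" by (simp add: add_pos_nonneg)
      ultimately show ?thesis unfolding K_def
        by (simp add: field_simps del: add_2_eq_Suc' power_Suc)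
    qed
    finally show ?thesis .
  qed
  from nn_integral_slice_le[OF _ _ this]
  have "ennreal (pi * 1\<^sup>2) * (\<integral>\<^sup>+u. F u \<partial>lborel) \<le> (\<integral>\<^sup>+u. ennreal (pi * ?c / (1 + norm u) ^ (?N + 2)) \<partial>(lborel :: (complex^'n) measure))"
    by simp
  also have "\<dots> = (\<integral>\<^sup>+u. ennreal pi * (ennreal ?c * ennreal (1 / (1 + norm u) ^ (?N + 2))) \<partial>(lborel :: (complex^'n) measure))"
    by (intro nn_integral_cong) (simp add: ennreal_mult[symmetric] del: add_2_eq_Suc' power_Suc)
  also have "\<dots> = ennreal pi * (ennreal ?c * ?I)"
    by (simp add: nn_integral_cmult del: add_2_eq_Suc' power_Suc)
  finally have "ennreal pi * (\<integral>\<^sup>+u. F u \<partial>lborel) \<le> ennreal pi * (ennreal ?c * ?I)" by simp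
  then have "(\<integral>\<^sup>+u. F u \<partial>lborel) \<le> ennreal ?c * ?I"
    by (subst (asm) ennreal_mult_le_mult_iff) auto
  then show ?thesis unfolding F_def S_def K_def .
qed

text \<open>The two indicators detect points of the line that are within \<open>\<delta>\<close> of the
  hypersurface, and those at which, moreover, the line is nearly tangent to it.\<close>

definition tube_density :: "nat \<Rightarrow> (('n::finite \<Rightarrow> nat) \<Rightarrow> complex) \<Rightarrow> real \<Rightarrow> real \<Rightarrow>
    complex^'n \<Rightarrow> complex^'n \<Rightarrow> ennreal" where
  "tube_density d c C \<delta> u z = ennreal (1 + (norm u)\<^sup>2 / (norm z)\<^sup>2) *
     (indicator {z. z \<noteq> 0 \<and> cmod (peval d c z) \<le> C * \<delta> * norm z ^ d} z *
      (1 + ennreal (1 / \<delta>) * indicator {u. cmod (dir_deriv d c z u) \<le>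
          C * sqrt \<delta> * norm z ^ (d - 1) * max (norm u) (norm z)} u))"

text \<open>The parameter \<open>x\<close> covers the line except for the point \<open>u\<close>.
  Only roots with \<open>cmod x \<le> 1\<close> are examined in this chart, the others after
  exchanging \<open>u\<close> and \<open>v\<close>; the radius 2 leaves room for discs around such
  roots.\<close>

definition line_defect :: "nat \<Rightarrow> (('n::finite \<Rightarrow> nat) \<Rightarrow> complex) \<Rightarrow> real \<Rightarrow> real \<Rightarrow>
    complex^'n \<Rightarrow> complex^'n \<Rightarrow> ennreal" where
  "line_defect d c C \<delta> u v =
     (\<integral>\<^sup>+x. indicator (cball 0 2) x * tube_density d c C \<delta> u (x *s u + v) \<partial>lborel)"

lemma measurable_tube_density [measurable]:
  assumes [measurable]: "f \<in> borel_measurable M" "g \<in> borel_measurable M"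
  shows "(\<lambda>x. tube_density d c C \<delta> (f x) (g x)) \<in> borel_measurable M"
proof -
  have [measurable]: "(\<lambda>x. indicator {u. cmod (dir_deriv d c (g x) u) \<le>
          C * sqrt \<delta> * norm (g x) ^ (d - 1) * max (norm u) (norm (g x))} (f x) :: ennreal) \<in> borel_measurable M"
    unfolding indicator_def mem_Collect_eq by measurable
  show ?thesis unfolding tube_density_def by measurable
qed

lemma measurable_line_defect [measurable]:
  assumes [measurable]: "f \<in> borel_measurable M" "g \<in> borel_measurable M"
  shows "(\<lambda>x. line_defect d c C \<delta> (f x) (g x)) \<in> borel_measurable M"
  unfolding line_defect_def by measurable

text \<open>For fixed \<open>z\<close> in the tube, nondegeneracy forces a large gradient, and near
  tangency confines the direction \<open>u\<close> to a slab around the kernel of that gradient. The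
  slab has width of order \<open>sqrt \<delta>\<close>, hence measure of order
  \<open>\<delta>\<close>, which cancels the factor \<open>1 / \<delta>\<close> of
  \<open>tube_density\<close>.\<close>

lemma nn_integral_tube_density_le:
  fixes c :: "('n::finite \<Rightarrow> nat) \<Rightarrow> complex" and z :: "complex^'n"
  assumes nd: "nondeg d \<kappa> c" and "0 < \<kappa>" "0 < \<delta>" "0 \<le> C" "C * \<delta> \<le> \<kappa> / 2"
  defines "I \<equiv> (\<integral>\<^sup>+u. ennreal (1 / (1 + norm u) ^ (DIM(complex^'n) + 2)) \<partial>(lborel :: (complex^'n) measure))"
  shows "(\<integral>\<^sup>+u. ennreal (1 / (1 + norm u) ^ (DIM(complex^'n) + 6)) * tube_density d c C \<delta> u z \<partial>lborel)
    \<le> ennreal (1 + 2 ^ (DIM(complex^'n) + 4) * (4 * C * CARD('n) / \<kappa>)\<^sup>2) * I *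
       (ennreal ((1 + norm z)\<^sup>2 * (1 + 1 / (norm z)\<^sup>2)) *
        indicator {z. z \<noteq> 0 \<and> cmod (peval d c z) \<le> C * \<delta> * norm z ^ d} z)"
proof (cases "z \<noteq> 0 \<and> cmod (peval d c z) \<le> C * \<delta> * norm z ^ d")
  case True
  let ?N = "DIM(complex^'n)"
  define m where "m = norm z"
  have m: "0 < m" using True by (simp add: m_def)
  have "cmod (peval d c z) \<le> \<kappa> / 2 * norm z ^ d"
    using True order_trans[OF _ mult_right_mono[OF assms(5), of "norm z ^ d"]] by simp
  then obtain i where i: "\<kappa> / (2 * CARD('n)) * m ^ (d - 1) \<le> cmod (dpeval d i c z)"
    using nondeg_partial[OF nd] True unfolding m_def by blast
  define g where "g = (\<chi> j. dpeval d j c z)"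
  define b where "b = \<kappa> / (2 * CARD('n)) * m ^ (d - 1)"
  define \<epsilon> where "\<epsilon> = C * sqrt \<delta> * m ^ (d - 1)"
  define Slab where "Slab = {u::complex^'n. cmod (\<Sum>j\<in>UNIV. g $ j * u $ j) \<le> \<epsilon> * (1 + norm u + m)}"
  have [measurable]: "Slab \<in> sets borel" unfolding Slab_def by measurable
  have b: "b \<le> cmod (g $ i)" "0 < b" using i m assms by (auto simp: b_def g_def)
  have \<epsilon>: "0 \<le> \<epsilon>" using assms m by (simp add: \<epsilon>_def)
  let ?W = "ennreal (1 + 1 / m\<^sup>2)"
  have pt: "ennreal (1 / (1 + norm u) ^ (?N + 6)) * tube_density d c C \<delta> u z
    \<le> ?W * (ennreal (1 / (1 + norm u) ^ (?N + 2)) + ennreal (1 / \<delta>) * (ennreal (1 / (1 + norm u) ^ (?N + 4)) * indicator Slab u))" for u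
  proof -
    \<comment> \<open>Two of the six extra powers of the weight pay for the growth of
      \<open>tube_density\<close> in \<open>u\<close>, two more for the widening of the slab, and
      the last two make \<open>I\<close> finite.\<close>
    have "1 + (norm u)\<^sup>2 / m\<^sup>2 \<le> (1 + norm u)\<^sup>2 * (1 + 1 / m\<^sup>2)"
    proof -
      have a: "1 \<le> (1 + norm u)\<^sup>2" by simp
      have b: "(norm u)\<^sup>2 \<le> (1 + norm u)\<^sup>2" by (intro power_mono) auto
      show ?thesis using add_mono[OF a divide_right_mono[OF b, of "m\<^sup>2"]] by (simp add: distrib_left)
    qed
    then have "1 / (1 + norm u) ^ (?N + 6) * (1 + (norm u)\<^sup>2 / m\<^sup>2) \<le> 1 / (1 + norm u) ^ (?N + 6) * ((1 + norm u)\<^sup>2 * (1 + 1 / m\<^sup>2))"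
      by (intro mult_left_mono) auto
    also have "\<dots> = 1 / (1 + norm u) ^ (?N + 4) * (1 + 1 / m\<^sup>2)"
    proof -
      have "(1 + norm u) ^ (?N + 6) = (1 + norm u) ^ (?N + 4) * (1 + norm u)\<^sup>2"
        by (simp only: power_add[symmetric]) (simp add: eval_nat_numeral)
      moreover have "1 + norm u > 0" by (simp add: add_pos_nonneg)
      ultimately show ?thesis by (simp add: field_simps del: power_Suc)
    qed
    finally have w: "1 / (1 + norm u) ^ (?N + 6) * (1 + (norm u)\<^sup>2 / m\<^sup>2) \<le> 1 / (1 + norm u) ^ (?N + 4) * (1 + 1 / m\<^sup>2)" .
    have ind: "indicator {u. cmod (dir_deriv d c z u) \<le> C * sqrt \<delta> * norm z ^ (d - 1) * max (norm u) (norm z)} u \<le> (indicator Slab u :: ennreal)"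
    proof -
      have "\<epsilon> * max (norm u) m \<le> \<epsilon> * (1 + norm u + m)" using \<epsilon> m by (intro mult_left_mono) auto
      then show ?thesis
        by (auto simp: indicator_def Slab_def dir_deriv_def g_def \<epsilon>_def m_def)
    qed
    have p42: "1 / (1 + norm u) ^ (?N + 4) \<le> 1 / (1 + norm u) ^ (?N + 2)"
      by (intro divide_left_mono power_increasing mult_pos_pos zero_less_power) (auto simp: add_pos_nonneg)
    have "ennreal (1 / (1 + norm u) ^ (?N + 6)) * tube_density d c C \<delta> u z \<le>
      ennreal (1 / (1 + norm u) ^ (?N + 6) * (1 + (norm u)\<^sup>2 / m\<^sup>2)) * (1 + ennreal (1 / \<delta>) * indicator Slab u)"
    proof -
      have "tube_density d c C \<delta> u z \<le> ennreal (1 + (norm u)\<^sup>2 / m\<^sup>2) * (1 + ennreal (1 / \<delta>) * indicator Slab u)"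
      proof -
        have "indicator {z. z \<noteq> 0 \<and> cmod (peval d c z) \<le> C * \<delta> * norm z ^ d} z = (1::ennreal)"
          using True by simp
        then show ?thesis unfolding tube_density_def
          by (simp only: mult_1_left m_def) (intro mult_left_mono add_left_mono ind; simp)
      qed
      then have "ennreal (1 / (1 + norm u) ^ (?N + 6)) * tube_density d c C \<delta> u z \<le>
        ennreal (1 / (1 + norm u) ^ (?N + 6)) * (ennreal (1 + (norm u)\<^sup>2 / m\<^sup>2) * (1 + ennreal (1 / \<delta>) * indicator Slab u))"
        by (rule mult_left_mono) simp
      then show ?thesis by (subst ennreal_mult) (auto simp: mult.assoc)
    qed
    also have "\<dots> \<le> ennreal (1 / (1 + norm u) ^ (?N + 4) * (1 + 1 / m\<^sup>2)) * (1 + ennreal (1 / \<delta>) * indicator Slab u)"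
      by (intro mult_right_mono ennreal_leI w) auto
    also have "\<dots> = ?W * (ennreal (1 / (1 + norm u) ^ (?N + 4)) + ennreal (1 / \<delta>) * (ennreal (1 / (1 + norm u) ^ (?N + 4)) * indicator Slab u))"
      by (subst ennreal_mult) (auto simp: distrib_left distrib_right mult_ac simp del: ennreal_plus)
    also have "\<dots> \<le> ?W * (ennreal (1 / (1 + norm u) ^ (?N + 2)) + ennreal (1 / \<delta>) * (ennreal (1 / (1 + norm u) ^ (?N + 4)) * indicator Slab u))"
      by (intro mult_left_mono add_right_mono ennreal_leI p42) auto
    finally show ?thesis .
  qed
  have "(\<integral>\<^sup>+u. ennreal (1 / (1 + norm u) ^ (?N + 6)) * tube_density d c C \<delta> u z \<partial>lborel) \<le>
    (\<integral>\<^sup>+u. ?W * (ennreal (1 / (1 + norm u) ^ (?N + 2)) + ennreal (1 / \<delta>) * (ennreal (1 / (1 + norm u) ^ (?N + 4)) * indicator Slab u)) \<partial>lborel)"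
    by (intro nn_integral_mono pt)
  also have "\<dots> = ?W * (I + ennreal (1 / \<delta>) * (\<integral>\<^sup>+u. ennreal (1 / (1 + norm u) ^ (?N + 4)) * indicator Slab u \<partial>lborel))"
    unfolding I_def by (simp add: nn_integral_cmult nn_integral_add del: ennreal_plus power_Suc add_2_eq_Suc')
  also have "\<dots> \<le> ?W * (I + ennreal (1 / \<delta>) * (ennreal (2 ^ (?N + 4) * (2 * \<epsilon> * (1 + m) / b)\<^sup>2) * I))"
    unfolding Slab_def I_def using b \<epsilon> m
    by (intro mult_left_mono add_left_mono nn_integral_slab_le) auto
  also have "\<dots> = ?W * (I + ennreal (1 / \<delta> * (2 ^ (?N + 4) * (2 * \<epsilon> * (1 + m) / b)\<^sup>2)) * I)"
    using assms(3) by (subst (2) ennreal_mult) (auto simp only: mult.assoc, auto)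
  also have "1 / \<delta> * (2 ^ (?N + 4) * (2 * \<epsilon> * (1 + m) / b)\<^sup>2) = 2 ^ (?N + 4) * (4 * C * CARD('n) / \<kappa>)\<^sup>2 * (1 + m)\<^sup>2"
  proof -
    have "2 * \<epsilon> * (1 + m) / b = 4 * C * CARD('n) / \<kappa> * (1 + m) * sqrt \<delta>"
      using m assms(2) by (simp add: \<epsilon>_def b_def field_simps)
    then have "(2 * \<epsilon> * (1 + m) / b)\<^sup>2 = (4 * C * CARD('n) / \<kappa>)\<^sup>2 * (1 + m)\<^sup>2 * \<delta>"
      using assms(3) by (simp only: power_mult_distrib) simp
    then show ?thesis using assms(3) by simp
  qed
  also have "?W * (I + ennreal (2 ^ (?N + 4) * (4 * C * CARD('n) / \<kappa>)\<^sup>2 * (1 + m)\<^sup>2) * I) \<le>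
    ?W * (ennreal ((1 + m)\<^sup>2) * I + ennreal (2 ^ (?N + 4) * (4 * C * CARD('n) / \<kappa>)\<^sup>2 * (1 + m)\<^sup>2) * I)"
  proof -
    have "1 \<le> (1 + m)\<^sup>2" using m by simp
    then have "ennreal 1 * I \<le> ennreal ((1 + m)\<^sup>2) * I"
      by (intro mult_right_mono ennreal_leI) auto
    then show ?thesis by (intro mult_left_mono add_right_mono) auto
  qed
  also have "\<dots> = ennreal (1 + 2 ^ (?N + 4) * (4 * C * CARD('n) / \<kappa>)\<^sup>2) * I * ennreal ((1 + m)\<^sup>2 * (1 + 1 / m\<^sup>2))"
  proof -
    define Q where "Q = 2 ^ (?N + 4) * (4 * C * CARD('n) / \<kappa>)\<^sup>2"
    have Q: "0 \<le> Q" by (simp add: Q_def)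
    have 1: "ennreal (Q * (1 + m)\<^sup>2) = ennreal Q * ennreal ((1 + m)\<^sup>2)"
      using Q by (intro ennreal_mult) auto
    have 2: "ennreal (1 + Q) = 1 + ennreal Q"
      using Q by (subst ennreal_plus) auto
    have 3: "ennreal ((1 + m)\<^sup>2 * (1 + 1 / m\<^sup>2)) = ennreal ((1 + m)\<^sup>2) * ?W"
      by (intro ennreal_mult) auto
    have "W * (M * I + q * M * I) = (1 + q) * I * (M * W)" for W M q :: ennreal
      by (simp only: distrib_left distrib_right mult_ac mult_1_left)
    then show ?thesis unfolding Q_def[symmetric] 1 2 3 .
  qed
  finally show ?thesis using True by (simp add: m_def)
qed (auto simp: tube_density_def)

section \<open>Gaussian lines\<close>

lemma measurable_fst_borel [measurable]:
  "fst \<in> borel_measurable (borel :: ('a::second_countable_topology \<times> 'b::second_countable_topology) measure)"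
  by (simp add: borel_prod[symmetric])

lemma measurable_snd_borel [measurable]:
  "snd \<in> borel_measurable (borel :: ('a::second_countable_topology \<times> 'b::second_countable_topology) measure)"
  by (simp add: borel_prod[symmetric])

lemma gauss_dens_eq: "gauss_dens w = exp (- (norm w)\<^sup>2)"
  by (cases w) (simp add: gauss_dens_def norm_Pair)

lemma continuous_on_gauss_dens: "continuous_on UNIV gauss_dens"
  unfolding gauss_dens_eq[abs_def] by (intro continuous_intros)

lemma measurable_gauss_dens [measurable]: "gauss_dens \<in> borel_measurable borel"
  by (intro borel_measurable_continuous_onI continuous_on_gauss_dens)

lemma measurable_gauss_dens_prod [measurable]: "gauss_dens \<in> borel_measurable (borel \<Otimes>\<^sub>M borel)"
  using measurable_gauss_dens by (simp add: borel_prod)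

lemma nn_integral_gauss_dens_finite:
  "(\<integral>\<^sup>+w. ennreal (gauss_dens w) \<partial>(lborel :: ((complex^'n::finite) \<times> (complex^'n)) measure)) < \<infinity>"
proof -
  let ?N = "DIM((complex^'n) \<times> (complex^'n))"
  let ?E = "exp (4 * (real (?N + 2))\<^sup>2)"
  have "(\<integral>\<^sup>+w. ennreal (gauss_dens w) \<partial>(lborel :: ((complex^'n) \<times> (complex^'n)) measure)) \<le>
    (\<integral>\<^sup>+w. ennreal ?E * ennreal (1 / (1 + norm w) ^ (?N + 2)) \<partial>(lborel :: ((complex^'n) \<times> (complex^'n)) measure))"
  proof (rule nn_integral_mono)
    fix w :: "(complex^'n) \<times> (complex^'n)"
    have "gauss_dens w \<le> exp (- (norm w)\<^sup>2 / 16)" by (simp add: gauss_dens_eq)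
    also have "\<dots> \<le> ?E / (1 + norm w) ^ (?N + 2)" by (rule exp_neg_square_le) simp
    finally have "ennreal (gauss_dens w) \<le> ennreal (?E * (1 / (1 + norm w) ^ (?N + 2)))" by (intro ennreal_leI) simp
    then show "ennreal (gauss_dens w) \<le> ennreal ?E * ennreal (1 / (1 + norm w) ^ (?N + 2))"
      by (subst ennreal_mult[symmetric]) auto
  qed
  also have "\<dots> = ennreal ?E * (\<integral>\<^sup>+w. ennreal (1 / (1 + norm w) ^ (?N + 2)) \<partial>(lborel :: ((complex^'n) \<times> (complex^'n)) measure))"
    by (rule nn_integral_cmult) measurable
  also have "\<dots> < \<infinity>"
    using nn_integral_decay_finite[where 'a="(complex^'n) \<times> (complex^'n)"]
    by (simp only: infinity_ennreal_def ennreal_mult_less_top ennreal_less_top simp_thms)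
  finally show ?thesis .
qed

lemma nn_integral_gauss_dens_pos:
  "(\<integral>\<^sup>+w. ennreal (gauss_dens w) \<partial>(lborel :: ((complex^'n::finite) \<times> (complex^'n)) measure)) \<noteq> 0"
proof
  assume "(\<integral>\<^sup>+w. ennreal (gauss_dens w) \<partial>(lborel :: ((complex^'n::finite) \<times> (complex^'n)) measure)) = 0"
  then have "AE w in (lborel :: ((complex^'n) \<times> (complex^'n)) measure). ennreal (gauss_dens w) = 0"
    by (subst (asm) nn_integral_0_iff_AE) auto
  then have "AE w in (lborel :: ((complex^'n) \<times> (complex^'n)) measure). False"
    by (rule AE_mp) (auto simp: gauss_dens_eq)
  then have "emeasure (lborel :: ((complex^'n) \<times> (complex^'n)) measure) UNIV = 0"
    by (simp add: AE_iff_measurable[of UNIV])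
  then show False by simp
qed

definition gauss_total :: "'n::finite itself \<Rightarrow> real" where
  "gauss_total T = enn2real (\<integral>\<^sup>+w. ennreal (gauss_dens w) \<partial>(lborel :: ((complex^'n) \<times> (complex^'n)) measure))"

lemma ennreal_gauss_total:
  "(\<integral>\<^sup>+w. ennreal (gauss_dens w) \<partial>(lborel :: ((complex^'n::finite) \<times> (complex^'n)) measure)) = ennreal (gauss_total TYPE('n))"
  unfolding gauss_total_def using nn_integral_gauss_dens_finite[where 'n='n] by simp

lemma gauss_total_pos: "0 < gauss_total TYPE('n::finite)"
  using nn_integral_gauss_dens_finite[where 'n='n] nn_integral_gauss_dens_pos[where 'n='n]
  unfolding gauss_total_def by (simp add: enn2real_positive_iff zero_less_iff_neq_zero)

lemma gauss_altdef:
  "(gauss :: ((complex^'n::finite) \<times> (complex^'n)) measure) =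
     density lborel (\<lambda>w. ennreal (1 / gauss_total TYPE('n)) * ennreal (gauss_dens w))"
  unfolding gauss_def ennreal_gauss_total using gauss_total_pos[where 'n='n]
  by (intro arg_cong2[where f=density] refl ext)
     (simp add: divide_ennreal_def inverse_ennreal mult.commute inverse_eq_divide)

lemma sets_gauss [simp, measurable_cong]: "sets gauss = sets borel"
  by (simp add: gauss_def)

lemma space_gauss [simp]: "space gauss = UNIV"
  by (simp add: gauss_def)

lemma nn_integral_gauss:
  fixes F :: "(complex^'n::finite) \<times> (complex^'n) \<Rightarrow> ennreal"
  assumes [measurable]: "F \<in> borel_measurable borel"
  shows "(\<integral>\<^sup>+w. F w \<partial>gauss) = ennreal (1 / gauss_total TYPE('n)) * (\<integral>\<^sup>+w. ennreal (gauss_dens w) * F w \<partial>lborel)"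
  unfolding gauss_altdef
  by (subst nn_integral_density) (auto simp: mult.assoc nn_integral_cmult)

lemma emeasure_gauss_UNIV: "emeasure (gauss :: ((complex^'n::finite) \<times> (complex^'n)) measure) UNIV = 1"
proof -
  have "emeasure (gauss :: ((complex^'n) \<times> (complex^'n)) measure) UNIV = (\<integral>\<^sup>+w. 1 \<partial>(gauss :: ((complex^'n) \<times> (complex^'n)) measure))"
    by simp
  also have "\<dots> = 1"
    using gauss_total_pos[where 'n='n]
    by (subst nn_integral_gauss) (auto simp: ennreal_gauss_total ennreal_mult[symmetric])
  finally show ?thesis .
qed

lemma AE_gauss_I:
  assumes "AE w in lborel. P w"
  shows "AE w in gauss. P w"
  unfolding gauss_altdef using assms by (subst AE_density) auto

text \<open>For fixed \<open>u\<close> and \<open>x\<close> the substitution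
  \<open>z = x *s u + v\<close> turns an average over lines into an average over points
  \<open>z\<close> of space, with \<open>u\<close> as a direction attached to \<open>z\<close>. The
  integral over \<open>u\<close> is then the slab estimate, and the integral over \<open>z\<close>
  the tube estimate.\<close>

lemma nn_integral_gauss_dens_line_defect_le:
  fixes c :: "('n::finite \<Rightarrow> nat) \<Rightarrow> complex"
  assumes nd: "nondeg d \<kappa> c" and "0 < \<kappa>" "0 < \<delta>" "0 \<le> C" "C * \<delta> \<le> \<kappa> / 2" "1 \<le> d" "CARD('n) \<ge> 2"
  shows "(\<integral>\<^sup>+u. (\<integral>\<^sup>+v. ennreal (gauss_dens (u, v)) * line_defect d c C \<delta> u v \<partial>lborel) \<partial>lborel)
    \<le> ennreal (exp (4 * (real (DIM(complex^'n) + 6))\<^sup>2) * exp (4 * (real (DIM(complex^'n) + 4))\<^sup>2) * (4 * pi)) *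
      (ennreal (1 + 2 ^ (DIM(complex^'n) + 4) * (4 * C * CARD('n) / \<kappa>)\<^sup>2) *
        (\<integral>\<^sup>+u. ennreal (1 / (1 + norm u) ^ (DIM(complex^'n) + 2)) \<partial>(lborel :: (complex^'n) measure)) *
        ennreal (6 * tube_const d \<kappa> TYPE('n) * (C * \<delta>)\<^sup>2))"
proof -
  let ?N = "DIM(complex^'n)"
  define E1 where "E1 = exp (4 * (real (?N + 6))\<^sup>2)"
  define E2 where "E2 = exp (4 * (real (?N + 4))\<^sup>2)"
  define D where "D = ennreal (1 + 2 ^ (?N + 4) * (4 * C * CARD('n) / \<kappa>)\<^sup>2) *
        (\<integral>\<^sup>+u. ennreal (1 / (1 + norm u) ^ (?N + 2)) \<partial>(lborel :: (complex^'n) measure))"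
  define td where "td = tube_density d c C \<delta>"
  have [measurable]: "(\<lambda>x. td (f x) (g x)) \<in> borel_measurable M" if "f \<in> borel_measurable M" "g \<in> borel_measurable M"
    for f g and M :: "'m measure"
    unfolding td_def using that by measurable
  define K where "K u z = ennreal (E1 * E2) * (ennreal (1 / (1 + norm z) ^ (?N + 4)) * (ennreal (1 / (1 + norm u) ^ (?N + 6)) * td u z))"
    for u z :: "complex^'n"
  have [measurable]: "(\<lambda>x. K (f x) (g x)) \<in> borel_measurable M" if [measurable]: "f \<in> borel_measurable M" "g \<in> borel_measurable M"
    for f g and M :: "'m measure"
    unfolding K_def by measurable
  \<comment> \<open>Since \<open>norm z \<le> norm (z - x *s u) + 2 * norm u\<close>, the density
    still decays in the new variables. The powers are what the two inner estimates consume; in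
    \<open>z\<close> two of them go to the factor \<open>(1 + norm z)\<^sup>2\<close> left by the
    slab.\<close>
  have ex: "gauss_dens (u, z - x *s u) \<le> E1 / (1 + norm u) ^ (?N + 6) * (E2 / (1 + norm z) ^ (?N + 4))"
    if "cmod x \<le> 2" for u z :: "complex^'n" and x
  proof -
    have "norm z \<le> norm (z - x *s u) + norm (x *s u)"
      using norm_triangle_ineq[of "z - x *s u" "x *s u"] by simp
    also have "\<dots> \<le> norm (z - x *s u) + 2 * norm u"
      using that by (simp add: norm_vector_scalar_mult mult_right_mono)
    finally have "(norm z)\<^sup>2 \<le> (norm (z - x *s u) + 2 * norm u)\<^sup>2" by (intro power_mono) auto
    also have "\<dots> \<le> 2 * (norm (z - x *s u))\<^sup>2 + 8 * (norm u)\<^sup>2"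
      using zero_le_power2[of "norm (z - x *s u) - 2 * norm u"] by (simp add: power2_eq_square algebra_simps)
    finally have "- ((norm u)\<^sup>2 + (norm (z - x *s u))\<^sup>2) \<le> - (norm u)\<^sup>2 / 16 + - (norm z)\<^sup>2 / 16"
      using zero_le_power2[of "norm u"] zero_le_power2[of "norm (z - x *s u)"] by linarith
    then have "gauss_dens (u, z - x *s u) \<le> exp (- (norm u)\<^sup>2 / 16) * exp (- (norm z)\<^sup>2 / 16)"
      unfolding gauss_dens_def exp_add[symmetric] by simp
    also have "\<dots> \<le> E1 / (1 + norm u) ^ (?N + 6) * (E2 / (1 + norm z) ^ (?N + 4))"
      unfolding E1_def E2_def by (intro mult_mono exp_neg_square_le) auto
    finally show ?thesis .
  qed
  have inner: "(\<integral>\<^sup>+v. ennreal (gauss_dens (u, v)) * line_defect d c C \<delta> u v \<partial>lborel) \<le>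
      ennreal (4 * pi) * (\<integral>\<^sup>+z. K u z \<partial>lborel)" for u
  proof -
    have "(\<integral>\<^sup>+v. ennreal (gauss_dens (u, v)) * line_defect d c C \<delta> u v \<partial>lborel) =
      (\<integral>\<^sup>+v. (\<integral>\<^sup>+x. ennreal (gauss_dens (u, v)) * (indicator (cball 0 2) x * td u (x *s u + v)) \<partial>lborel) \<partial>lborel)"
      unfolding line_defect_def td_def by (intro nn_integral_cong nn_integral_cmult[symmetric]) measurable
    also have "\<dots> = (\<integral>\<^sup>+x. (\<integral>\<^sup>+v. ennreal (gauss_dens (u, v)) * (indicator (cball 0 2) x * td u (x *s u + v)) \<partial>lborel) \<partial>lborel)"
      by (rule lborel_pair.Fubini') measurable
    also have "\<dots> = (\<integral>\<^sup>+x. (\<integral>\<^sup>+z. ennreal (gauss_dens (u, z - x *s u)) * (indicator (cball 0 2) x * td u z) \<partial>lborel) \<partial>lborel)"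
    proof (rule nn_integral_cong)
      fix x :: complex
      have [measurable]: "(\<lambda>z. ennreal (gauss_dens (u, z - x *s u)) * (indicator (cball 0 2) x * td u z)) \<in> borel_measurable borel"
        by measurable
      show "(\<integral>\<^sup>+v. ennreal (gauss_dens (u, v)) * (indicator (cball 0 2) x * td u (x *s u + v)) \<partial>lborel) =
        (\<integral>\<^sup>+z. ennreal (gauss_dens (u, z - x *s u)) * (indicator (cball 0 2) x * td u z) \<partial>lborel)"
        using nn_integral_lborel_translate[of "\<lambda>z. ennreal (gauss_dens (u, z - x *s u)) * (indicator (cball 0 2) x * td u z)" "x *s u"]
        by simp
    qed
    also have "\<dots> \<le> (\<integral>\<^sup>+x. (\<integral>\<^sup>+z. indicator (cball (0::complex) 2) x * K u z \<partial>lborel) \<partial>lborel)"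
    proof (intro nn_integral_mono)
      fix x :: complex and z :: "complex^'n"
      show "ennreal (gauss_dens (u, z - x *s u)) * (indicator (cball 0 2) x * td u z) \<le> indicator (cball 0 2) x * K u z"
      proof (cases "cmod x \<le> 2")
        case True
        have "ennreal (gauss_dens (u, z - x *s u)) * td u z \<le> ennreal (E1 / (1 + norm u) ^ (?N + 6) * (E2 / (1 + norm z) ^ (?N + 4))) * td u z"
          by (intro mult_right_mono ennreal_leI ex True) auto
        also have "ennreal (E1 / (1 + norm u) ^ (?N + 6) * (E2 / (1 + norm z) ^ (?N + 4))) =
          ennreal (E1 * E2 * (1 / (1 + norm z) ^ (?N + 4) * (1 / (1 + norm u) ^ (?N + 6))))"
          by (simp add: mult_ac)
        also have "\<dots> = ennreal (E1 * E2) * (ennreal (1 / (1 + norm z) ^ (?N + 4)) * ennreal (1 / (1 + norm u) ^ (?N + 6)))"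
          by (subst ennreal_mult, simp add: E1_def E2_def, simp, subst ennreal_mult, auto)
        finally show ?thesis using True by (simp add: K_def mult.assoc)
      qed simp
    qed
    also have "\<dots> = (\<integral>\<^sup>+x. indicator (cball (0::complex) 2) x * (\<integral>\<^sup>+z. K u z \<partial>lborel) \<partial>lborel)"
      by (intro nn_integral_cong nn_integral_cmult) measurable
    also have "\<dots> = ennreal (4 * pi) * (\<integral>\<^sup>+z. K u z \<partial>lborel)"
      by (subst nn_integral_multc) (auto intro!: borel_measurable_indicator simp: emeasure_cball_complex mult.commute)
    finally show ?thesis .
  qed
  have "(\<integral>\<^sup>+u. (\<integral>\<^sup>+v. ennreal (gauss_dens (u, v)) * line_defect d c C \<delta> u v \<partial>lborel) \<partial>lborel) \<le>
     (\<integral>\<^sup>+u. ennreal (4 * pi) * (\<integral>\<^sup>+z. K u z \<partial>lborel) \<partial>lborel)"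
    by (intro nn_integral_mono inner)
  also have "\<dots> = ennreal (4 * pi) * (\<integral>\<^sup>+u. (\<integral>\<^sup>+z. K u z \<partial>lborel) \<partial>lborel)"
    by (rule nn_integral_cmult) measurable
  also have "(\<integral>\<^sup>+u. (\<integral>\<^sup>+z. K u z \<partial>lborel) \<partial>lborel) = (\<integral>\<^sup>+z. (\<integral>\<^sup>+u. K u z \<partial>lborel) \<partial>lborel)"
    by (rule lborel_pair.Fubini') measurable
  also have "\<dots> = ennreal (E1 * E2) * (\<integral>\<^sup>+z. ennreal (1 / (1 + norm z) ^ (?N + 4)) *
        (\<integral>\<^sup>+u. ennreal (1 / (1 + norm u) ^ (?N + 6)) * td u z \<partial>lborel) \<partial>lborel)"
  proof -
    have "(\<integral>\<^sup>+u. K u z \<partial>lborel) = ennreal (E1 * E2) * (ennreal (1 / (1 + norm z) ^ (?N + 4)) *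
        (\<integral>\<^sup>+u. ennreal (1 / (1 + norm u) ^ (?N + 6)) * td u z \<partial>lborel))" for z
    proof -
      have "(\<integral>\<^sup>+u. K u z \<partial>lborel) = ennreal (E1 * E2) * (\<integral>\<^sup>+u. ennreal (1 / (1 + norm z) ^ (?N + 4)) *
         (ennreal (1 / (1 + norm u) ^ (?N + 6)) * td u z) \<partial>lborel)"
        unfolding K_def by (rule nn_integral_cmult) measurable
      also have "(\<integral>\<^sup>+u. ennreal (1 / (1 + norm z) ^ (?N + 4)) *
         (ennreal (1 / (1 + norm u) ^ (?N + 6)) * td u z) \<partial>lborel) = ennreal (1 / (1 + norm z) ^ (?N + 4)) *
         (\<integral>\<^sup>+u. ennreal (1 / (1 + norm u) ^ (?N + 6)) * td u z \<partial>lborel)"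
        by (rule nn_integral_cmult) measurable
      finally show ?thesis .
    qed
    then show ?thesis by (simp only:) (rule nn_integral_cmult, measurable)
  qed
  also have "(\<integral>\<^sup>+z. ennreal (1 / (1 + norm z) ^ (?N + 4)) *
        (\<integral>\<^sup>+u. ennreal (1 / (1 + norm u) ^ (?N + 6)) * td u z \<partial>lborel) \<partial>lborel) \<le>
     (\<integral>\<^sup>+z. D * (ennreal (1 / (1 + norm z) ^ (?N + 2) * (1 + 1 / (norm z)\<^sup>2)) *
       indicator {z::complex^'n. z \<noteq> 0 \<and> cmod (peval d c z) \<le> (C * \<delta>) * norm z ^ d} z) \<partial>lborel)"
  proof (rule nn_integral_mono)
    fix z :: "complex^'n"
    let ?ind = "indicator {z::complex^'n. z \<noteq> 0 \<and> cmod (peval d c z) \<le> C * \<delta> * norm z ^ d} z :: ennreal"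
    have "(\<integral>\<^sup>+u. ennreal (1 / (1 + norm u) ^ (?N + 6)) * td u z \<partial>lborel) \<le>
       D * (ennreal ((1 + norm z)\<^sup>2 * (1 + 1 / (norm z)\<^sup>2)) * ?ind)"
      unfolding D_def td_def using assms by (intro nn_integral_tube_density_le) auto
    then have "ennreal (1 / (1 + norm z) ^ (?N + 4)) * (\<integral>\<^sup>+u. ennreal (1 / (1 + norm u) ^ (?N + 6)) * td u z \<partial>lborel)
      \<le> ennreal (1 / (1 + norm z) ^ (?N + 4)) * (D * (ennreal ((1 + norm z)\<^sup>2 * (1 + 1 / (norm z)\<^sup>2)) * ?ind))"
      by (rule mult_left_mono) simp
    also have "\<dots> = D * (ennreal (1 / (1 + norm z) ^ (?N + 4)) * ennreal ((1 + norm z)\<^sup>2 * (1 + 1 / (norm z)\<^sup>2)) * ?ind)"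
      by (simp only: mult_ac)
    also have "ennreal (1 / (1 + norm z) ^ (?N + 4)) * ennreal ((1 + norm z)\<^sup>2 * (1 + 1 / (norm z)\<^sup>2)) =
       ennreal (1 / (1 + norm z) ^ (?N + 2) * (1 + 1 / (norm z)\<^sup>2))"
    proof -
      have "(1 + norm z) ^ (?N + 4) = (1 + norm z) ^ (?N + 2) * (1 + norm z)\<^sup>2"
        by (simp only: power_add[symmetric]) (simp add: eval_nat_numeral)
      moreover have "1 + norm z > 0" by (simp add: add_pos_nonneg)
      ultimately have "1 / (1 + norm z) ^ (?N + 4) * ((1 + norm z)\<^sup>2 * (1 + 1 / (norm z)\<^sup>2)) = 1 / (1 + norm z) ^ (?N + 2) * (1 + 1 / (norm z)\<^sup>2)"
        by (simp del: power_Suc add_2_eq_Suc')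
      then show ?thesis by (subst ennreal_mult[symmetric]) auto
    qed
    finally show "ennreal (1 / (1 + norm z) ^ (?N + 4)) * (\<integral>\<^sup>+u. ennreal (1 / (1 + norm u) ^ (?N + 6)) * td u z \<partial>lborel)
      \<le> D * (ennreal (1 / (1 + norm z) ^ (?N + 2) * (1 + 1 / (norm z)\<^sup>2)) * ?ind)" .
  qed
  also have "\<dots> = D * (\<integral>\<^sup>+z. ennreal (1 / (1 + norm z) ^ (?N + 2) * (1 + 1 / (norm z)\<^sup>2)) *
       indicator {z::complex^'n. z \<noteq> 0 \<and> cmod (peval d c z) \<le> (C * \<delta>) * norm z ^ d} z \<partial>lborel)"
    by (rule nn_integral_cmult) measurable
  also have "\<dots> \<le> D * ennreal (6 * tube_const d \<kappa> TYPE('n) * (C * \<delta>)\<^sup>2)"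
    using assms by (intro mult_left_mono nn_integral_tube_le) auto
  finally have "(\<integral>\<^sup>+u. (\<integral>\<^sup>+v. ennreal (gauss_dens (u, v)) * line_defect d c C \<delta> u v \<partial>lborel) \<partial>lborel) \<le>
     ennreal (4 * pi) * (ennreal (E1 * E2) * (D * ennreal (6 * tube_const d \<kappa> TYPE('n) * (C * \<delta>)\<^sup>2)))"
    by (simp add: mult_left_mono)
  also have "\<dots> = ennreal (E1 * E2 * (4 * pi)) * (D * ennreal (6 * tube_const d \<kappa> TYPE('n) * (C * \<delta>)\<^sup>2))"
    by (subst ennreal_mult[of "E1 * E2"]) (auto simp: E1_def E2_def mult_ac)
  finally show ?thesis unfolding D_def E1_def E2_def .
qed

lemma expected_line_defect_le:
  assumes "0 < \<kappa>" "0 \<le> C" "1 \<le> d" "CARD('n::finite) \<ge> 2"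
  shows "\<exists>B\<ge>0. \<forall>(c :: ('n \<Rightarrow> nat) \<Rightarrow> complex) \<delta>. nondeg d \<kappa> c \<longrightarrow> 0 < \<delta> \<longrightarrow> C * \<delta> \<le> \<kappa> / 2 \<longrightarrow>
    (\<integral>\<^sup>+w. line_defect d c C \<delta> (fst w) (snd w) + line_defect d c C \<delta> (snd w) (fst w) \<partial>gauss) \<le> ennreal (B * \<delta>\<^sup>2)"
proof -
  let ?N = "DIM(complex^'n)"
  define I where "I = enn2real (\<integral>\<^sup>+u. ennreal (1 / (1 + norm u) ^ (?N + 2)) \<partial>(lborel :: (complex^'n) measure))"
  have I: "(\<integral>\<^sup>+u. ennreal (1 / (1 + norm u) ^ (?N + 2)) \<partial>(lborel :: (complex^'n) measure)) = ennreal I"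
    unfolding I_def using nn_integral_decay_finite[where 'a="complex^'n"] by simp
  have I0: "0 \<le> I" by (simp add: I_def)
  define E where "E = exp (4 * (real (?N + 6))\<^sup>2) * exp (4 * (real (?N + 4))\<^sup>2) * (4 * pi)"
  define A where "A = 1 + 2 ^ (?N + 4) * (4 * C * CARD('n) / \<kappa>)\<^sup>2"
  define T where "T = 6 * tube_const d \<kappa> TYPE('n)"
  have pos: "0 \<le> E" "0 \<le> A" "0 \<le> T" by (simp_all add: E_def A_def T_def tube_const_nonneg)
  define J where "J = E * (A * I * (T * C\<^sup>2))"
  define G where "G = 1 / gauss_total TYPE('n)"
  have G: "0 \<le> G" using gauss_total_pos[where 'n='n] by (simp add: G_def)
  show ?thesis
  proof (intro exI[of _ "G * (2 * J)"] conjI allI impI)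
    show "0 \<le> G * (2 * J)" using pos I0 G by (simp add: J_def)
    fix c :: "('n \<Rightarrow> nat) \<Rightarrow> complex" and \<delta>
    assume as: "nondeg d \<kappa> c" "0 < \<delta>" "C * \<delta> \<le> \<kappa> / 2"
    have "(\<integral>\<^sup>+u. (\<integral>\<^sup>+v. ennreal (gauss_dens (u, v)) * line_defect d c C \<delta> u v \<partial>lborel) \<partial>lborel)
      \<le> ennreal E * (ennreal A * ennreal I * ennreal (T * (C * \<delta>)\<^sup>2))"
      unfolding E_def A_def T_def I[symmetric]
      using as assms by (intro nn_integral_gauss_dens_line_defect_le) auto
    also have "\<dots> = ennreal (J * \<delta>\<^sup>2)"
    proof -
      have "E * (A * I * (T * (C * \<delta>)\<^sup>2)) = J * \<delta>\<^sup>2" by (simp add: J_def power_mult_distrib)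
      then show ?thesis using pos I0 by (simp add: ennreal_mult[symmetric])
    qed
    finally have J1: "(\<integral>\<^sup>+u. (\<integral>\<^sup>+v. ennreal (gauss_dens (u, v)) * line_defect d c C \<delta> u v \<partial>lborel) \<partial>lborel) \<le> ennreal (J * \<delta>\<^sup>2)" .
    have "(\<integral>\<^sup>+w. ennreal (gauss_dens w) * line_defect d c C \<delta> (fst w) (snd w) \<partial>lborel) =
       (\<integral>\<^sup>+u. (\<integral>\<^sup>+v. ennreal (gauss_dens (u, v)) * line_defect d c C \<delta> u v \<partial>lborel) \<partial>lborel)"
      unfolding lborel_prod[symmetric] by (subst lborel.nn_integral_fst[symmetric]) auto
    then have a: "(\<integral>\<^sup>+w. ennreal (gauss_dens w) * line_defect d c C \<delta> (fst w) (snd w) \<partial>lborel) \<le> ennreal (J * \<delta>\<^sup>2)"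
      using J1 by simp
    have "(\<integral>\<^sup>+w. ennreal (gauss_dens w) * line_defect d c C \<delta> (snd w) (fst w) \<partial>lborel) =
       (\<integral>\<^sup>+v. (\<integral>\<^sup>+u. ennreal (gauss_dens (u, v)) * line_defect d c C \<delta> v u \<partial>lborel) \<partial>lborel)"
      unfolding lborel_prod[symmetric] by (subst lborel_pair.nn_integral_snd[symmetric]) auto
    \<comment> \<open>The Gaussian is symmetric in its two vectors, so the chart with
      \<open>u\<close> and \<open>v\<close> exchanged obeys the same bound.\<close>
    also have "\<dots> = (\<integral>\<^sup>+v. (\<integral>\<^sup>+u. ennreal (gauss_dens (v, u)) * line_defect d c C \<delta> v u \<partial>lborel) \<partial>lborel)"
      by (simp add: gauss_dens_def add.commute)
    finally have b: "(\<integral>\<^sup>+w. ennreal (gauss_dens w) * line_defect d c C \<delta> (snd w) (fst w) \<partial>lborel) \<le> ennreal (J * \<delta>\<^sup>2)"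
      using J1 by simp
    have "(\<integral>\<^sup>+w. line_defect d c C \<delta> (fst w) (snd w) + line_defect d c C \<delta> (snd w) (fst w) \<partial>gauss) =
      ennreal G * ((\<integral>\<^sup>+w. ennreal (gauss_dens w) * line_defect d c C \<delta> (fst w) (snd w) \<partial>lborel) +
       (\<integral>\<^sup>+w. ennreal (gauss_dens w) * line_defect d c C \<delta> (snd w) (fst w) \<partial>lborel))"
      unfolding G_def by (subst nn_integral_gauss) (auto simp: distrib_left nn_integral_add)
    also have "\<dots> \<le> ennreal G * (ennreal (J * \<delta>\<^sup>2) + ennreal (J * \<delta>\<^sup>2))"
      by (intro mult_left_mono add_mono a b) auto
    also have "\<dots> = ennreal (G * (2 * J) * \<delta>\<^sup>2)"
      using G pos I0 by (simp add: ennreal_mult[symmetric] ennreal_plus[symmetric] J_def del: ennreal_plus)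
    finally show "(\<integral>\<^sup>+w. line_defect d c C \<delta> (fst w) (snd w) + line_defect d c C \<delta> (snd w) (fst w) \<partial>gauss) \<le> ennreal (G * (2 * J) * \<delta>\<^sup>2)" .
  qed
qed

section \<open>Exceptional pairs of spanning vectors form null sets\<close>

lemma AE_lborel_fst_snd:
  fixes P :: "'a::euclidean_space \<Rightarrow> bool"
  assumes "AE z in lborel. P z"
  shows "AE w in (lborel :: ('a \<times> 'a) measure). P (fst w) \<and> P (snd w)"
proof -
  obtain N where N: "{z. \<not> P z} \<subseteq> N" "N \<in> sets borel" "emeasure lborel N = 0"
    using AE_E[OF assms] by auto
  show ?thesis
  proof (rule AE_I')
    show "N \<times> UNIV \<union> UNIV \<times> N \<in> null_sets (lborel :: ('a \<times> 'a) measure)"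
      unfolding lborel_prod[symmetric] using N
      by (intro null_sets.Un) (auto simp: null_sets_def lborel.emeasure_pair_measure_Times)
  qed (use N in auto)
qed

text \<open>The tube estimate at width \<open>\<eta> = 0\<close>: a positive weight has integral
  zero over the zero set.\<close>

lemma AE_lborel_peval_nonzero:
  fixes c :: "('n::finite \<Rightarrow> nat) \<Rightarrow> complex"
  assumes nd: "nondeg d \<kappa> c" and "0 < \<kappa>" "1 \<le> d" "CARD('n) \<ge> 2"
  shows "AE z in lborel. peval d c z \<noteq> 0"
proof -
  let ?N = "DIM(complex^'n)"
  let ?f = "\<lambda>z. ennreal (1 / (1 + norm z) ^ (?N + 2) * (1 + 1 / (norm z)\<^sup>2)) *
       indicator {z::complex^'n. z \<noteq> 0 \<and> cmod (peval d c z) \<le> 0 * norm z ^ d} z"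
  have "(\<integral>\<^sup>+z. ?f z \<partial>lborel) \<le> ennreal (6 * tube_const d \<kappa> TYPE('n) * 0\<^sup>2)"
    using assms by (intro nn_integral_tube_le) auto
  then have "(\<integral>\<^sup>+z. ?f z \<partial>lborel) = 0" by simp
  then have "AE z in lborel. ?f z = 0"
    by (subst (asm) nn_integral_0_iff_AE) measurable
  moreover have "AE z in (lborel :: (complex^'n) measure). z \<noteq> 0"
    by (rule AE_lborel_singleton)
  ultimately show ?thesis
  proof eventually_elim
    case (elim z)
    have "0 < 1 / (1 + norm z) ^ (?N + 2) * (1 + 1 / (norm z)\<^sup>2)"
      by (intro mult_pos_pos divide_pos_pos zero_less_power) (auto simp: add_pos_nonneg)
    then have "ennreal (1 / (1 + norm z) ^ (?N + 2) * (1 + 1 / (norm z)\<^sup>2)) \<noteq> 0"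
      by (simp only: ennreal_eq_0_iff not_le)
    then have "indicator {z::complex^'n. z \<noteq> 0 \<and> cmod (peval d c z) \<le> 0 * norm z ^ d} z = (0::ennreal)"
      using elim(1) by (simp only: mult_eq_0_iff simp_thms)
    then show ?case using elim(2) by (auto simp: indicator_def split: if_splits)
  qed
qed

lemma AE_lborel_independent:
  assumes "CARD('n::finite) \<ge> 2"
  shows "AE w in (lborel :: ((complex^'n) \<times> (complex^'n)) measure). \<forall>x. x *s fst w + snd w \<noteq> 0"
proof -
  obtain i j :: 'n where ij: "i \<noteq> j"
    using assms card_le_Suc0_iff_eq[of "UNIV :: 'n set"] by (auto simp: numeral_2_eq_2)
  \<comment> \<open>The vanishing of one minor of size 2 contains all dependent pairs, and for
    \<open>u $ i \<noteq> 0\<close> its slices along the coordinate \<open>j\<close> of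
    \<open>v\<close> are single points.\<close>
  define S where "S = {w :: (complex^'n) \<times> (complex^'n). fst w $ i * snd w $ j = fst w $ j * snd w $ i}"
  have S1: "S \<in> sets borel" unfolding S_def by measurable
  have S2 [measurable]: "S \<in> sets (borel \<Otimes>\<^sub>M borel)" using S1 unfolding borel_prod .
  note S1 [measurable]
  have sl: "(\<integral>\<^sup>+v. indicator S (u, v) \<partial>lborel) = 0" if "u $ i \<noteq> 0" for u
  proof -
    have [measurable]: "(\<lambda>v. indicator S (u, v) :: ennreal) \<in> borel_measurable borel"
      unfolding S_def indicator_def by measurable
    have "(\<integral>\<^sup>+s. indicator (cball 0 1) s * (indicator S (u, v + s *s axis j 1) :: ennreal) \<partial>lborel) \<le> 0" for v
    proof -
      have "(\<integral>\<^sup>+s. indicator (cball 0 1) s * (indicator S (u, v + s *s axis j 1) :: ennreal) \<partial>lborel) \<le>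
        (\<integral>\<^sup>+s. indicator {u $ j * v $ i / u $ i - v $ j} s \<partial>lborel)"
        using that ij by (intro nn_integral_mono) (auto simp: indicator_def S_def axis_def field_simps)
      then show ?thesis by simp
    qed
    from nn_integral_slice_le[OF _ _ this] have "ennreal (pi * 1\<^sup>2) * (\<integral>\<^sup>+v. indicator S (u, v) \<partial>lborel) \<le> 0"
      by simp
    then show ?thesis using pi_gt_zero by (auto simp: ennreal_eq_0_iff)
  qed
  have ui: "AE u in (lborel :: (complex^'n) measure). u $ i \<noteq> 0"
  proof -
    have [measurable]: "(\<lambda>u. indicator {u :: complex^'n. u $ i = 0} u :: ennreal) \<in> borel_measurable borel"
      by measurable
    have "(\<integral>\<^sup>+s. indicator (cball 0 1) s * (indicator {u :: complex^'n. u $ i = 0} (u + s *s axis i 1) :: ennreal) \<partial>lborel) \<le> 0" for u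
    proof -
      have "(\<integral>\<^sup>+s. indicator (cball 0 1) s * (indicator {u :: complex^'n. u $ i = 0} (u + s *s axis i 1) :: ennreal) \<partial>lborel) \<le>
        (\<integral>\<^sup>+s. indicator {- u $ i} s \<partial>lborel)"
        by (intro nn_integral_mono) (auto simp: indicator_def axis_def add_eq_0_iff)
      then show ?thesis by simp
    qed
    from nn_integral_slice_le[OF _ _ this] have "ennreal (pi * 1\<^sup>2) * (\<integral>\<^sup>+u. indicator {u :: complex^'n. u $ i = 0} u \<partial>lborel) \<le> 0"
      by simp
    then have "(\<integral>\<^sup>+u. indicator {u :: complex^'n. u $ i = 0} u \<partial>lborel) = 0" using pi_gt_zero by (auto simp: ennreal_eq_0_iff)
    then show ?thesis by (subst (asm) nn_integral_0_iff_AE) (auto simp: indicator_def)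
  qed
  have "emeasure lborel S = (\<integral>\<^sup>+w. indicator S w \<partial>(lborel \<Otimes>\<^sub>M lborel))"
    unfolding lborel_prod by simp
  also have "\<dots> = (\<integral>\<^sup>+u. (\<integral>\<^sup>+v. indicator S (u, v) \<partial>lborel) \<partial>lborel)"
    by (subst lborel.nn_integral_fst[symmetric]) auto
  also have "\<dots> = (\<integral>\<^sup>+u. 0 \<partial>(lborel :: (complex^'n) measure))"
    using ui by (intro nn_integral_cong_AE) (auto elim!: eventually_mono simp: sl)
  finally have "S \<in> null_sets lborel" by (auto simp: null_sets_def)
  then show ?thesis
  proof (rule AE_I')
    show "{w \<in> space lborel. \<not> (\<forall>x. x *s fst w + snd w \<noteq> 0)} \<subseteq> S"
    proof
      fix w :: "(complex^'n) \<times> (complex^'n)"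
      assume "w \<in> {w \<in> space lborel. \<not> (\<forall>x. x *s fst w + snd w \<noteq> 0)}"
      then obtain x where "x *s fst w + snd w = 0" by auto
      then have "snd w = - (x *s fst w)" by (simp only: add_eq_0_iff)
      then show "w \<in> S" by (simp add: S_def)
    qed
  qed
qed

lemma AE_gauss_generic:
  fixes c :: "('n::finite \<Rightarrow> nat) \<Rightarrow> complex"
  assumes "nondeg d \<kappa> c" "0 < \<kappa>" "1 \<le> d" "CARD('n) \<ge> 2"
  shows "AE w in gauss. peval d c (fst w) \<noteq> 0 \<and> peval d c (snd w) \<noteq> 0 \<and> (\<forall>x. x *s fst w + snd w \<noteq> 0)"
  using AE_lborel_fst_snd[OF AE_lborel_peval_nonzero[OF assms]] AE_lborel_independent[OF assms(4)]
  by (intro AE_gauss_I) (auto elim: eventually_elim2)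

section \<open>Measurable labelling of roots\<close>

text \<open>By compactness the infimum of \<open>cmod (f x)\<close> over \<open>K\<close> is
  attained, so having a zero amounts to having arbitrarily small values on a countable dense set.
  This turns an uncountable existential into a measurable condition.\<close>

lemma exists_zero_iff_countable:
  fixes f :: "'a::metric_space \<Rightarrow> complex"
  assumes K: "compact K" and D: "D \<subseteq> K" "K \<subseteq> closure D" and f: "continuous_on UNIV f"
  shows "(\<exists>x\<in>K. f x = 0) \<longleftrightarrow> (\<forall>n::nat. \<exists>q\<in>D. cmod (f q) < 1 / Suc n)"
proof
  assume "\<exists>x\<in>K. f x = 0"
  then obtain x where x: "x \<in> K" "f x = 0" by blast
  then have "x \<in> closure D" using D by auto
  then obtain q where q: "\<And>n::nat. q n \<in> D" "q \<longlonglongrightarrow> x"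
    unfolding closure_sequential by blast
  have "(\<lambda>n. f (q n)) \<longlonglongrightarrow> f x"
    using f q(2) by (auto simp: continuous_on_eq_continuous_at intro: isCont_tendsto_compose)
  then have lim: "(\<lambda>n. cmod (f (q n))) \<longlonglongrightarrow> 0" using x by (auto intro: tendsto_norm_zero)
  show "\<forall>n::nat. \<exists>q\<in>D. cmod (f q) < 1 / Suc n"
  proof
    fix n :: nat
    have "eventually (\<lambda>k. cmod (f (q k)) < 1 / Suc n) sequentially"
      by (rule order_tendstoD(2)[OF lim]) simp
    then obtain k where "cmod (f (q k)) < 1 / Suc n" by (auto simp: eventually_sequentially)
    then show "\<exists>q\<in>D. cmod (f q) < 1 / Suc n" using q(1) by blast
  qed
next
  assume *: "\<forall>n::nat. \<exists>q\<in>D. cmod (f q) < 1 / Suc n"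
  then have "K \<noteq> {}" using D by auto
  moreover have "continuous_on K (\<lambda>x. cmod (f x))"
    using f by (intro continuous_intros) (auto intro: continuous_on_subset)
  ultimately obtain x where x: "x \<in> K" "\<And>y. y \<in> K \<Longrightarrow> cmod (f x) \<le> cmod (f y)"
    using continuous_attains_inf[OF K] by metis
  have "f x = 0"
  proof (rule ccontr)
    assume "f x \<noteq> 0"
    then obtain n :: nat where "1 / Suc n < cmod (f x)"
      using reals_Archimedean[of "cmod (f x)"] by (auto simp: inverse_eq_divide)
    moreover obtain q where "q \<in> D" "cmod (f q) < 1 / Suc n" using * by blast
    ultimately show False using x(2)[of q] D by auto
  qed
  then show "\<exists>x\<in>K. f x = 0" using x by blast
qed

lemma measurable_exists_zero:
  fixes F :: "'w \<Rightarrow> 'a::{metric_space, second_countable_topology} \<Rightarrow> complex"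
  assumes K: "compact K" and [measurable]: "\<And>x. (\<lambda>w. F w x) \<in> borel_measurable M"
    and F: "\<And>w. continuous_on UNIV (F w)"
  shows "Measurable.pred M (\<lambda>w. \<exists>x\<in>K. F w x = 0)"
proof -
  obtain D where D: "countable D" "D \<subseteq> K" "K \<subseteq> closure D" using separable by metis
  show ?thesis
    unfolding exists_zero_iff_countable[OF K D(2,3) F]
    using D(1) by (intro pred_intros_countable pred_intros_countable_bounded) measurable
qed

text \<open>The lexicographically least root is a measurable function of the coefficients.\<close>

lemma measurable_root_selection:
  fixes G :: "'w \<Rightarrow> complex poly"
  assumes coeff [measurable]: "\<And>k. (\<lambda>w. coeff (G w) k) \<in> borel_measurable M"
    and deg: "\<And>w. degree (G w) = Suc d"
  shows "\<exists>X\<in>borel_measurable M. \<forall>w. poly (G w) (X w) = 0"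
proof -
  have [measurable]: "(\<lambda>w. poly (G w) (f w)) \<in> borel_measurable M" if [measurable]: "f \<in> borel_measurable M" for f
  proof -
    have "(\<lambda>w. poly (G w) (f w)) = (\<lambda>w. \<Sum>k\<le>Suc d. coeff (G w) k * f w ^ k)"
      using deg by (intro ext poly_eq_sum_le_degree) simp
    then show ?thesis by simp
  qed
  define R where "R w = {x. poly (G w) x = 0}" for w
  have nz: "G w \<noteq> 0" for w using deg[of w] by auto
  have fin: "finite (R w)" for w unfolding R_def using poly_roots_finite[OF nz] .
  have ne: "R w \<noteq> {}" for w
    using fundamental_theorem_of_algebra[of "G w"] deg[of w] by (auto simp: R_def constant_degree)
  define m1 where "m1 w = Min (Re ` R w)" for w
  \<comment> \<open>The half-plane is exhausted by compact pieces, to each of which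
    \<open>measurable_exists_zero\<close> applies.\<close>
  have m1_le: "m1 w \<le> a \<longleftrightarrow> (\<exists>k::nat. \<exists>x\<in>cball 0 k \<inter> {x. Re x \<le> a}. poly (G w) x = 0)" for w a
  proof -
    have "m1 w \<le> a \<longleftrightarrow> (\<exists>x\<in>R w. Re x \<le> a)"
      unfolding m1_def using fin ne by (subst Min_le_iff) auto
    also have "\<dots> \<longleftrightarrow> (\<exists>k::nat. \<exists>x\<in>cball 0 k \<inter> {x. Re x \<le> a}. poly (G w) x = 0)"
      unfolding R_def using real_arch_simple by fastforce
    finally show ?thesis .
  qed
  have [measurable]: "m1 \<in> borel_measurable M"
    unfolding borel_measurable_iff_le
  proof
    fix a
    have "compact (cball 0 (real k) \<inter> {x. Re x \<le> a})" for k :: nat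
      by (intro compact_Int_closed closed_halfspace_Re_le) auto
    then have "Measurable.pred M (\<lambda>w. \<exists>k::nat. \<exists>x\<in>cball 0 k \<inter> {x. Re x \<le> a}. poly (G w) x = 0)"
      by (intro pred_intros_countable measurable_exists_zero) (auto intro!: continuous_intros)
    then show "{w \<in> space M. m1 w \<le> a} \<in> sets M"
      unfolding m1_le by (simp add: pred_def)
  qed
  define S where "S w = {y. poly (G w) (Complex (m1 w) y) = 0}" for w
  have finS: "finite (S w)" for w
  proof -
    have "S w \<subseteq> Im ` R w" by (force simp: S_def R_def)
    then show ?thesis using fin finite_subset by blast
  qed
  have neS: "S w \<noteq> {}" for w
  proof -
    have "m1 w \<in> Re ` R w" unfolding m1_def using fin ne by (intro Min_in) auto
    then obtain x where "x \<in> R w" "Re x = m1 w" by auto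
    then have "Im x \<in> S w" by (simp add: S_def R_def flip: \<open>Re x = m1 w\<close>)
    then show ?thesis by blast
  qed
  define m2 where "m2 w = Min (S w)" for w
  have m2_le: "m2 w \<le> a \<longleftrightarrow> (\<exists>k::nat. \<exists>y\<in>{- real k..a}. poly (G w) (Complex (m1 w) y) = 0)" for w a
  proof -
    have "m2 w \<le> a \<longleftrightarrow> (\<exists>y\<in>S w. y \<le> a)"
      unfolding m2_def using finS neS by (subst Min_le_iff) auto
    also have "\<dots> \<longleftrightarrow> (\<exists>k::nat. \<exists>y\<in>{- real k..a}. poly (G w) (Complex (m1 w) y) = 0)"
    proof
      assume "\<exists>y\<in>S w. y \<le> a"
      then obtain y where y: "poly (G w) (Complex (m1 w) y) = 0" "y \<le> a" by (auto simp: S_def)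
      obtain k :: nat where "- y \<le> k" using real_arch_simple by blast
      then show "\<exists>k::nat. \<exists>y\<in>{- real k..a}. poly (G w) (Complex (m1 w) y) = 0"
        using y by (intro exI[of _ k] bexI[of _ y]) auto
    qed (auto simp: S_def)
    finally show ?thesis .
  qed
  have [measurable]: "m2 \<in> borel_measurable M"
    unfolding borel_measurable_iff_le
  proof
    fix a
    have C: "Complex (m1 w) y = complex_of_real (m1 w) + \<i> * complex_of_real y" for w y
      by (simp add: complex_eq_iff)
    have "Measurable.pred M (\<lambda>w. \<exists>k::nat. \<exists>y\<in>{- real k..a}. poly (G w) (Complex (m1 w) y) = 0)"
      unfolding C
      by (intro pred_intros_countable measurable_exists_zero) (auto intro!: continuous_intros)
    then show "{w \<in> space M. m2 w \<le> a} \<in> sets M"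
      unfolding m2_le by (simp add: pred_def)
  qed
  show ?thesis
  proof (intro bexI[of _ "\<lambda>w. complex_of_real (m1 w) + \<i> * complex_of_real (m2 w)"] allI)
    fix w
    have "m2 w \<in> S w" unfolding m2_def using finS neS by (intro Min_in) auto
    moreover have "Complex (m1 w) (m2 w) = complex_of_real (m1 w) + \<i> * complex_of_real (m2 w)"
      by (simp add: complex_eq_iff)
    ultimately show "poly (G w) (complex_of_real (m1 w) + \<i> * complex_of_real (m2 w)) = 0"
      by (simp add: S_def)
  qed measurable
qed

text \<open>Induction on the degree: a measurably chosen root is divided out, and the point is that
  the quotient again has measurable coefficients.\<close>

lemma measurable_root_labelling:
  fixes G :: "'w \<Rightarrow> complex poly"
  assumes "\<And>k. (\<lambda>w. coeff (G w) k) \<in> borel_measurable M" and "\<And>w. degree (G w) = d"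
  shows "\<exists>X. (\<forall>i. X i \<in> borel_measurable M) \<and> (\<forall>w. G w = smult (lead_coeff (G w)) (\<Prod>i<d. [:- X i w, 1:]))"
  using assms
proof (induction d arbitrary: G)
  case 0
  show ?case
  proof (intro exI[of _ "\<lambda>_ _. 0"] conjI allI)
    fix w
    obtain a where "G w = [:a:]" using 0(2)[of w] by (metis degree_eq_zeroE)
    then show "G w = smult (lead_coeff (G w)) (\<Prod>i<(0::nat). [:- 0, 1:])" by simp
  qed simp
next
  case (Suc d)
  note [measurable] = Suc.prems(1)
  obtain x where x [measurable]: "x \<in> borel_measurable M" and root: "\<And>w. poly (G w) (x w) = 0"
    using measurable_root_selection[OF Suc.prems] by blast
  define H where "H w = synthetic_div (G w) (x w)" for w
  have GH: "G w = [:- x w, 1:] * H w" for w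
    using synthetic_div_correct'[of "x w" "G w"] root by (simp add: H_def)
  have degH: "degree (H w) = d" for w
    using Suc.prems(2)[of w] by (simp add: H_def degree_synthetic_div)
  have rec: "coeff (H w) k = coeff (G w) (Suc k) + x w * coeff (H w) (Suc k)" for w k
    by (subst GH) simp
  \<comment> \<open>The recursion \<open>rec\<close> computes a coefficient from the next higher
    one, so the induction runs downwards from index \<open>Suc d\<close>, where the coefficient of
    \<open>H w\<close> is 0.\<close>
  have "(\<lambda>w. coeff (H w) (Suc d - j)) \<in> borel_measurable M" for j
  proof (induction j)
    case 0
    then show ?case using degH by (simp add: coeff_eq_0)
  next
    case (Suc j)
    show ?case
    proof (cases "j < Suc d")
      case True
      then have "Suc (Suc d - Suc j) = Suc d - j" by simp
      then have "(\<lambda>w. coeff (H w) (Suc d - Suc j)) = (\<lambda>w. coeff (G w) (Suc d - j) + x w * coeff (H w) (Suc d - j))"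
        using rec[of _ "Suc d - Suc j"] by simp
      then show ?thesis using Suc by simp
    next
      case False
      then show ?thesis using Suc by simp
    qed
  qed
  note m = this
  have "(\<lambda>w. coeff (H w) k) \<in> borel_measurable M" for k
  proof (cases "k \<le> Suc d")
    case True
    then show ?thesis using m[of "Suc d - k"] by simp
  next
    case False
    then show ?thesis using degH by (simp add: coeff_eq_0)
  qed
  from Suc.IH[OF this degH] obtain X where X: "\<And>i. X i \<in> borel_measurable M"
    "\<And>w. H w = smult (lead_coeff (H w)) (\<Prod>i<d. [:- X i w, 1:])" by blast
  have lc: "lead_coeff (G w) = lead_coeff (H w)" for w
    using Suc.prems(2)[of w] degH[of w] GH[of w] coeff_eq_0[of "H w" "Suc d"] by simp
  show ?case
  proof (intro exI[of _ "\<lambda>i. if i < d then X i else x"] conjI allI)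
    fix w
    have "G w = [:- x w, 1:] * smult (lead_coeff (G w)) (\<Prod>i<d. [:- X i w, 1:])"
      using GH[of w] X(2)[of w] lc[of w] by simp
    also have "\<dots> = smult (lead_coeff (G w)) (\<Prod>i<Suc d. [:- (if i < d then X i else x) w, 1:])"
      by (simp add: mult.commute)
    finally show "G w = smult (lead_coeff (G w)) (\<Prod>i<Suc d. [:- (if i < d then X i else x) w, 1:])" .
  qed (use X in auto)
qed

section \<open>Multiplicities and the labelled roots of a random line\<close>

lemma order_linear_factor: "order x [:- a, 1:] = (if x = (a::complex) then 1 else 0)"
  using order_power_n_n[of a 1] by (auto intro: order_0I)

lemma order_prod_linear:
  "finite A \<Longrightarrow> order x (\<Prod>i\<in>A. [:- X i, 1:]) = card {i\<in>A. X i = (x::complex)}"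
proof (induction A rule: finite_induct)
  case (insert j A)
  have "{i \<in> insert j A. X i = x} = (if X j = x then insert j {i\<in>A. X i = x} else {i\<in>A. X i = x})" by auto
  then show ?case using insert by (auto simp: order_mult order_linear_factor simp del: mult_pCons_left)
qed (simp add: order_0I)

text \<open>Grouping the labels by the root that they name turns a sum with multiplicities into a
  plain sum over \<open>d\<close> labels, the form on which permutations act.\<close>

lemma sum_order_roots:
  fixes f :: "complex \<Rightarrow> ennreal" and d :: nat
  assumes "a \<noteq> 0" and g: "g = smult a (\<Prod>i<d. [:- X i, 1:])"
  shows "(\<Sum>x\<in>{x. poly g x = 0}. of_nat (order x g) * f x) = (\<Sum>i<d. f (X i))"
proof -
  have roots: "{x. poly g x = 0} = X ` {..<d}" using assms by (auto simp: poly_prod)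
  have ord: "order x g = card {i\<in>{..<d}. X i = x}" for x
    unfolding g using assms(1) by (simp add: order_smult order_prod_linear)
  have "(\<Sum>x\<in>{x. poly g x = 0}. of_nat (order x g) * f x) = (\<Sum>x\<in>X ` {..<d}. \<Sum>i\<in>{i\<in>{..<d}. X i = x}. f (X i))"
    unfolding roots ord by (intro sum.cong) auto
  also have "\<dots> = (\<Sum>i<d. f (X i))" by (rule sum.group) auto
  finally show ?thesis .
qed

lemma measurable_coeff_prod:
  assumes "finite A" "\<And>i k. i \<in> A \<Longrightarrow> (\<lambda>w. coeff (G i w) k :: complex) \<in> borel_measurable M"
  shows "(\<lambda>w. coeff (\<Prod>i\<in>A. G i w) k) \<in> borel_measurable M"
  using assms
proof (induction A arbitrary: k rule: finite_induct)
  case (insert j A)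
  have [measurable]: "\<And>k. (\<lambda>w. coeff (G j w) k) \<in> borel_measurable M"
    "\<And>k. (\<lambda>w. coeff (\<Prod>i\<in>A. G i w) k) \<in> borel_measurable M"
    using insert by auto
  then show ?case using insert by (simp add: coeff_mult)
qed simp

lemma measurable_coeff_restr_poly:
  assumes [measurable]: "f \<in> borel_measurable M" "g \<in> borel_measurable M"
  shows "(\<lambda>w. coeff (restr_poly d c (f w) (g w)) k) \<in> borel_measurable M"
proof -
  have "(\<lambda>w. coeff [:g w $ i, f w $ i:] k) \<in> borel_measurable M" for i k
    by (cases k; cases "k - 1") (auto simp: coeff_pCons split: nat.split)
  then have "(\<lambda>w. coeff ([:g w $ i, f w $ i:] ^ m) k) \<in> borel_measurable M" for i m k
    using measurable_coeff_prod[of "{..<m}" "\<lambda>_ w. [:g w $ i, f w $ i:]" M k] by simp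
  then have [measurable]: "(\<lambda>w. coeff (\<Prod>i\<in>UNIV. [:g w $ i, f w $ i:] ^ \<alpha> i) k) \<in> borel_measurable M" for \<alpha> k
    by (intro measurable_coeff_prod) auto
  show ?thesis unfolding restr_poly_def coeff_sum by simp
qed

lemma root_labelling:
  fixes c :: "('n::finite \<Rightarrow> nat) \<Rightarrow> complex"
  shows "\<exists>X. (\<forall>i. X i \<in> borel_measurable borel) \<and>
    (\<forall>u v. peval d c u \<noteq> 0 \<longrightarrow> restr_poly d c u v = smult (peval d c u) (\<Prod>i<d. [:- X i (u, v), 1:]))"
proof -
  \<comment> \<open>The value \<open>monom 1 d\<close> on the exceptional set keeps the degree equal
    to \<open>d\<close> everywhere, as \<open>measurable_root_labelling\<close> demands.\<close>
  define G where "G w = (if peval d c (fst w) \<noteq> 0 then restr_poly d c (fst w) (snd w) else monom 1 d)"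
    for w :: "(complex^'n) \<times> (complex^'n)"
  have [measurable]: "(\<lambda>w. coeff (restr_poly d c (fst w) (snd w)) k) \<in> borel_measurable borel" for k
    by (rule measurable_coeff_restr_poly) measurable
  have co: "(\<lambda>w. coeff (G w) k) \<in> borel_measurable borel" for k
    unfolding G_def if_distrib[of "\<lambda>p. coeff p k"] by measurable
  have deg: "degree (restr_poly d c u v) = d" if "peval d c u \<noteq> 0" for u v
    using degree_restr_poly[of d c u v] le_degree[of "restr_poly d c u v" d] coeff_restr_poly[of d c u v] that
    by auto
  have "degree (G w) = d" for w
    using deg[of "fst w" "snd w"] by (auto simp: G_def degree_monom_eq)
  from measurable_root_labelling[OF co this] obtain X where
    X: "\<And>i. X i \<in> borel_measurable borel" "\<And>w. G w = smult (lead_coeff (G w)) (\<Prod>i<d. [:- X i w, 1:])"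
    by blast
  have "restr_poly d c u v = smult (peval d c u) (\<Prod>i<d. [:- X i (u, v), 1:])" if "peval d c u \<noteq> 0" for u v
    using X(2)[of "(u, v)"] that deg[OF that, of v] coeff_restr_poly[of d c u v] by (simp add: G_def)
  then show ?thesis using X(1) by blast
qed

text \<open>Since \<open>u\<close> is not a zero of the form, the degree is full, and the term for
  the point at infinity in \<open>line_count\<close> has coefficient
  \<open>d - d = 0\<close>.\<close>

lemma line_count_eq:
  assumes "peval d c u \<noteq> 0" "restr_poly d c u v = smult (peval d c u) (\<Prod>i<d. [:- X i, 1:])"
  shows "line_count d c A (u, v) = (\<Sum>i<d. indicator A (X i *s u + v))"
proof -
  let ?g = "restr_poly d c u v"
  have "?g \<noteq> 0" using coeff_restr_poly[of d c u v] assms(1) by auto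
  moreover have "degree ?g = d"
    using degree_restr_poly[of d c u v] le_degree[of ?g d] coeff_restr_poly[of d c u v] assms(1) by auto
  ultimately show ?thesis
    using sum_order_roots[OF assms, of "\<lambda>x. indicator A (x *s u + v)"]
    by (simp add: line_count_def Let_def)
qed

section \<open>Couplings induced by matchings\<close>

lemma finite_measure_gauss: "finite_measure (gauss :: ((complex^'n::finite) \<times> (complex^'n)) measure)"
  by (rule finite_measureI) (simp add: emeasure_gauss_UNIV)

lemma sigma_finite_gauss: "sigma_finite_measure (gauss :: ((complex^'n::finite) \<times> (complex^'n)) measure)"
  using finite_measure_gauss by (rule finite_measure.axioms(1))

text \<open>Choosing a random line together with the label of one of its \<open>d\<close> intersection points.\<close>

definition labelled_gauss :: "nat \<Rightarrow> (nat \<times> (complex^'n::finite) \<times> (complex^'n)) measure" where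
  "labelled_gauss d = uniform_count_measure {..<d} \<Otimes>\<^sub>M gauss"

lemma measurable_labelled_gauss:
  assumes "\<And>i. i < d \<Longrightarrow> (\<lambda>w. F (i, w)) \<in> measurable gauss N"
  shows "F \<in> measurable (labelled_gauss d) N"
proof -
  have "sets (labelled_gauss d :: (nat \<times> (complex^'a) \<times> (complex^'a)) measure) = sets (count_space {..<d} \<Otimes>\<^sub>M gauss)"
    unfolding labelled_gauss_def by (intro sets_pair_measure_cong) (auto simp: sets_uniform_count_measure)
  moreover have "F \<in> measurable (count_space {..<d} \<Otimes>\<^sub>M gauss) N"
    using assms by (intro measurable_pair_measure_countable1) auto
  ultimately show ?thesis by (simp cong: measurable_cong_sets)
qed

lemma nn_integral_labelled_gauss:
  assumes F: "F \<in> borel_measurable (labelled_gauss d)" and "1 \<le> d"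
  shows "(\<integral>\<^sup>+x. F x \<partial>labelled_gauss d) = ennreal (1 / d) * (\<Sum>i<d. \<integral>\<^sup>+w. F (i, w) \<partial>gauss)"
proof -
  interpret sigma_finite_measure "gauss :: ((complex^'a) \<times> (complex^'a)) measure" by (rule sigma_finite_gauss)
  have "(\<integral>\<^sup>+x. F x \<partial>labelled_gauss d) = (\<integral>\<^sup>+i. (\<integral>\<^sup>+w. F (i, w) \<partial>gauss) \<partial>uniform_count_measure {..<d})"
    using F unfolding labelled_gauss_def by (simp add: nn_integral_fst)
  also have "\<dots> = (\<Sum>i<d. ennreal (1 / d) * (\<integral>\<^sup>+w. F (i, w) \<partial>gauss))"
    unfolding uniform_count_measure_def using assms(2)
    by (subst nn_integral_point_measure_finite) (auto simp: mult.commute)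
  finally show ?thesis by (simp add: sum_distrib_left)
qed

lemma emeasure_distr_labelled_gauss:
  fixes Z :: "nat \<Rightarrow> (complex^'n::finite) \<times> (complex^'n) \<Rightarrow> 'b::topological_space"
  assumes [measurable]: "\<And>i. Z i \<in> borel_measurable borel" "A \<in> sets borel" and "1 \<le> d"
  shows "emeasure (distr (labelled_gauss d) borel (\<lambda>x. Z (fst x) (snd x))) A =
     ennreal (1 / d) * (\<integral>\<^sup>+w. (\<Sum>i<d. indicator A (Z i w)) \<partial>gauss)"
proof -
  have m: "(\<lambda>x. Z (fst x) (snd x)) \<in> measurable (labelled_gauss d) borel"
    by (rule measurable_labelled_gauss) simp
  have "emeasure (distr (labelled_gauss d) borel (\<lambda>x. Z (fst x) (snd x))) A =
    (\<integral>\<^sup>+x. indicator A x \<partial>distr (labelled_gauss d) borel (\<lambda>x. Z (fst x) (snd x)))" by simp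
  also have "\<dots> = (\<integral>\<^sup>+x. indicator A (Z (fst x) (snd x)) \<partial>labelled_gauss d)"
    using m by (intro nn_integral_distr) auto
  also have "\<dots> = ennreal (1 / d) * (\<Sum>i<d. \<integral>\<^sup>+w. indicator A (Z i w) \<partial>gauss)"
    using assms(3) by (subst nn_integral_labelled_gauss) (auto intro!: measurable_labelled_gauss)
  also have "(\<Sum>i<d. \<integral>\<^sup>+w. indicator A (Z i w) \<partial>gauss) = (\<integral>\<^sup>+w. (\<Sum>i<d. indicator A (Z i w)) \<partial>gauss)"
    by (rule nn_integral_sum[symmetric]) measurable
  finally show ?thesis .
qed

text \<open>Writing \<open>mu\<close> as the push-forward under a labelled root makes couplings
  available: the roots of a second polynomial, relabelled at will, are another map on the same
  probability space.\<close>

lemma mu_eq_distr: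
  fixes c :: "('n::finite \<Rightarrow> nat) \<Rightarrow> complex"
  assumes X [measurable]: "\<And>i. X i \<in> borel_measurable borel" and d: "1 \<le> d"
    and roots: "\<And>u v. peval d c u \<noteq> 0 \<Longrightarrow> restr_poly d c u v = smult (peval d c u) (\<Prod>i<d. [:- X i (u, v), 1:])"
    and ae: "AE w in gauss. peval d c (fst w) \<noteq> 0"
  shows "mu d c = distr (labelled_gauss d) borel (\<lambda>x. X (fst x) (snd x) *s fst (snd x) + snd (snd x))"
    (is "_ = ?N")
proof -
  define Z where "Z i w = X i w *s fst w + snd w" for i and w :: "(complex^'n) \<times> (complex^'n)"
  have Z [measurable]: "Z i \<in> borel_measurable borel" for i unfolding Z_def by measurable
  have N: "?N = distr (labelled_gauss d) borel (\<lambda>x. Z (fst x) (snd x))" by (simp add: Z_def)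
  have "(\<integral>\<^sup>+w. line_count d c A w \<partial>gauss) / of_nat d = emeasure ?N A" if A: "A \<in> sets borel" for A
  proof -
    have "(\<integral>\<^sup>+w. line_count d c A w \<partial>gauss) = (\<integral>\<^sup>+w. (\<Sum>i<d. indicator A (Z i w)) \<partial>gauss)"
    proof (rule nn_integral_cong_AE, use ae in eventually_elim)
      case (elim w)
      then show ?case
        using line_count_eq[OF elim roots[OF elim], where A=A and v="snd w"] by (simp add: Z_def)
    qed
    moreover have "ennreal (1 / d) = 1 / of_nat d"
      using d by (simp add: divide_ennreal[symmetric] ennreal_of_nat_eq_real_of_nat)
    ultimately show ?thesis unfolding N using d A
      by (subst emeasure_distr_labelled_gauss) (auto simp: divide_ennreal_def mult.commute)
  qed
  \<comment> \<open>Only the values of the set function on Borel sets enter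
    \<open>measure_of\<close>, so agreement there suffices.\<close>
  then have "mu d c = measure_of UNIV (sets borel) (emeasure ?N)"
    unfolding mu_def by (intro measure_of_eq) (auto simp: sets.sigma_sets_eq[of borel, simplified])
  also have "\<dots> = ?N"
    using measure_of_of_measure[of ?N] by simp
  finally show ?thesis .
qed

section \<open>The projective distance and the cost of a matching\<close>

lemma dpt_arg_le_1: "cmod (\<Sum>i\<in>UNIV. z$i * cnj (w$i)) \<le> norm z * norm (w :: complex^'n::finite)"
proof -
  have "cmod (\<Sum>i\<in>UNIV. z$i * cnj (w$i)) \<le> (\<Sum>i\<in>UNIV. \<bar>cmod (z$i)\<bar> * \<bar>cmod (w$i)\<bar>)"
    by (rule sum_norm_le) (simp add: norm_mult)
  also have "\<dots> \<le> norm z * norm w"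
    unfolding norm_vec_def by (rule L2_set_mult_ineq)
  finally show ?thesis .
qed

lemma dpt_bounds: "0 \<le> dpt z w" "dpt z w \<le> pi / 2"
proof -
  let ?t = "min 1 (cmod (\<Sum>i\<in>UNIV. z$i * cnj (w$i)) / (norm z * norm w))"
  have t: "0 \<le> ?t" "?t \<le> 1" by auto
  have "-1 \<le> ?t" using t(1) by linarith
  then show "0 \<le> dpt z w" "dpt z w \<le> pi / 2"
    unfolding dpt_def using t by (blast intro: arccos_lbound arccos_le_pi2)+
qed

lemma dpt_scale:
  assumes "a \<noteq> 0" "b \<noteq> 0"
  shows "dpt (a *s z) (b *s w) = dpt z w"
proof -
  have "(\<Sum>i\<in>UNIV. (a *s z)$i * cnj ((b *s w)$i)) = a * cnj b * (\<Sum>i\<in>UNIV. z$i * cnj (w$i))"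
    by (simp add: sum_distrib_left mult_ac)
  then show ?thesis using assms
    by (simp add: dpt_def norm_vector_scalar_mult norm_mult)
qed

lemma measurable_dpt [measurable]:
  assumes [measurable]: "f \<in> borel_measurable M" "g \<in> borel_measurable M"
  shows "(\<lambda>x. dpt (f x) (g x)) \<in> borel_measurable M"
proof -
  have "(\<lambda>t::real. arccos (max (-1) (min 1 t))) \<in> borel_measurable borel"
    by (intro borel_measurable_continuous_onI continuous_intros) auto
  moreover have "(\<lambda>x. cmod (\<Sum>i\<in>UNIV. f x$i * cnj (g x$i)) / (norm (f x) * norm (g x))) \<in> borel_measurable M"
  proof -
    have [measurable]: "cnj \<in> borel_measurable borel"
      by (intro borel_measurable_continuous_onI continuous_intros)
    show ?thesis by measurable
  qed
  ultimately have "(\<lambda>x. arccos (max (-1) (min 1 (cmod (\<Sum>i\<in>UNIV. f x$i * cnj (g x$i)) / (norm (f x) * norm (g x)))))) \<in> borel_measurable M"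
    by (rule measurable_compose[rotated])
  moreover have "max (-1) (min 1 (cmod (\<Sum>i\<in>UNIV. f x$i * cnj (g x$i)) / (norm (f x) * norm (g x)))) =
    min 1 (cmod (\<Sum>i\<in>UNIV. f x$i * cnj (g x$i)) / (norm (f x) * norm (g x)))" for x
  proof -
    have "0 \<le> cmod (\<Sum>i\<in>UNIV. f x$i * cnj (g x$i)) / (norm (f x) * norm (g x))" by simp
    then have "-1 \<le> min 1 (cmod (\<Sum>i\<in>UNIV. f x$i * cnj (g x$i)) / (norm (f x) * norm (g x)))"
      by linarith
    then show ?thesis by (rule max_absorb2)
  qed
  ultimately show ?thesis unfolding dpt_def by simp
qed

text \<open>A cheap permutation exists for almost every line but is not given measurably. As there
  are finitely many permutations, the first one of minimal cost is a measurable choice and is no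
  dearer than the given one. Relabelling does not change the second marginal, which only sees the
  sum over all labels.\<close>

lemma W2_le_matching_cost:
  fixes Z Z' :: "nat \<Rightarrow> (complex^'n::finite) \<times> (complex^'n) \<Rightarrow> complex^'n"
  assumes Z [measurable]: "\<And>i. Z i \<in> borel_measurable borel" and Z' [measurable]: "\<And>i. Z' i \<in> borel_measurable borel"
    and d: "1 \<le> d" and b: "0 \<le> b"
    and ae: "AE w in gauss. \<exists>\<sigma>. bij_betw \<sigma> {..<d} {..<d} \<and> (\<Sum>i<d. ennreal ((dpt (Z i w) (Z' (\<sigma> i) w))\<^sup>2)) \<le> B w"
    and B: "(\<integral>\<^sup>+w. B w \<partial>gauss) \<le> ennreal b"
  shows "W2 (distr (labelled_gauss d) borel (\<lambda>x. Z (fst x) (snd x))) (distr (labelled_gauss d) borel (\<lambda>x. Z' (fst x) (snd x))) \<le> sqrt b"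
proof -
  define Pm where "Pm = {\<sigma> \<in> {..<d} \<rightarrow>\<^sub>E {..<d}. bij_betw \<sigma> {..<d} {..<d}}"
  have "finite Pm" unfolding Pm_def by (rule finite_subset[of _ "{..<d} \<rightarrow>\<^sub>E {..<d}"]) (auto intro: finite_PiE)
  then obtain N :: nat and h where h: "Pm = h ` {i. i < N}"
    using finite_imp_nat_seg_image_inj_on by metis
  have "restrict id {..<d} \<in> Pm" by (auto simp: Pm_def bij_betw_def inj_on_def)
  then have N: "0 < N" using h by auto
  define cost where "cost k w = (\<Sum>i<d. ennreal ((dpt (Z i w) (Z' (h k i) w))\<^sup>2))" for k w
  have [measurable]: "cost k \<in> borel_measurable borel" for k unfolding cost_def by measurable
  define good where "good w k \<longleftrightarrow> k < N \<and> (\<forall>j<N. cost k w \<le> cost j w)" for w k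
  define k where "k w = (LEAST k. good w k)" for w
  have good: "good w (k w)" for w
  proof -
    obtain j where "j \<in> {..<N}" "\<forall>l\<in>{..<N}. cost j w \<le> cost l w"
      using ex_min_if_finite[of "(\<lambda>j. cost j w) ` {..<N}"] N by (auto simp: not_less)
    then have "good w j" by (auto simp: good_def)
    then show ?thesis unfolding k_def by (rule LeastI)
  qed
  have k [measurable]: "k \<in> measurable borel (count_space UNIV)"
    unfolding k_def good_def by measurable
  have bij: "bij_betw (h (k w)) {..<d} {..<d}" for w
  proof -
    have "h (k w) \<in> Pm" using good[of w] h by (auto simp: good_def)
    then show ?thesis by (simp add: Pm_def)
  qed
  have minc: "cost (k w) w \<le> (\<Sum>i<d. ennreal ((dpt (Z i w) (Z' (\<sigma> i) w))\<^sup>2))" if "bij_betw \<sigma> {..<d} {..<d}" for \<sigma> w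
  proof -
    have "restrict \<sigma> {..<d} \<in> Pm" using that by (auto simp: Pm_def bij_betw_def inj_on_def)
    then obtain j where "j < N" "h j = restrict \<sigma> {..<d}" using h by auto
    then have "cost (k w) w \<le> cost j w" using good[of w] by (auto simp: good_def)
    also have "cost j w = (\<Sum>i<d. ennreal ((dpt (Z i w) (Z' (\<sigma> i) w))\<^sup>2))"
      unfolding cost_def \<open>h j = _\<close> by simp
    finally show ?thesis .
  qed
  define Y where "Y i w = Z' (h (k w) i) w" for i w
  have Y [measurable]: "Y i \<in> borel_measurable borel" for i
    unfolding Y_def using measurable_compose_countable[of "\<lambda>j w. Z' (h j i) w" borel borel k] by simp
  let ?L = "labelled_gauss d :: (nat \<times> (complex^'n) \<times> (complex^'n)) measure"
  have mZ: "(\<lambda>x. Z (fst x) (snd x)) \<in> borel_measurable ?L" and mY: "(\<lambda>x. Y (fst x) (snd x)) \<in> borel_measurable ?L"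
    by (rule measurable_labelled_gauss, simp)+
  have mP: "(\<lambda>x. (Z (fst x) (snd x), Y (fst x) (snd x))) \<in> measurable ?L borel"
    using measurable_Pair[OF mZ mY] by (simp add: borel_prod)
  define \<pi> where "\<pi> = distr ?L borel (\<lambda>x. (Z (fst x) (snd x), Y (fst x) (snd x)))"
  have "distr \<pi> borel fst = distr ?L borel (\<lambda>x. Z (fst x) (snd x))"
    unfolding \<pi>_def using mP by (subst distr_distr) (auto simp: o_def)
  moreover have "distr \<pi> borel snd = distr ?L borel (\<lambda>x. Z' (fst x) (snd x))"
  proof (rule measure_eqI)
    fix A :: "(complex^'n) set" assume "A \<in> sets (distr \<pi> borel snd)"
    then have A: "A \<in> sets borel" by simp
    have "distr \<pi> borel snd = distr ?L borel (\<lambda>x. Y (fst x) (snd x))"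
      unfolding \<pi>_def using mP by (subst distr_distr) (auto simp: o_def)
    then have "emeasure (distr \<pi> borel snd) A = ennreal (1 / d) * (\<integral>\<^sup>+w. (\<Sum>i<d. indicator A (Y i w)) \<partial>gauss)"
      using emeasure_distr_labelled_gauss[OF Y A d] by simp
    also have "\<dots> = ennreal (1 / d) * (\<integral>\<^sup>+w. (\<Sum>i<d. indicator A (Z' i w)) \<partial>gauss)"
    proof -
      have "(\<Sum>i<d. indicator A (Y i w)) = (\<Sum>i<d. indicator A (Z' i w) :: ennreal)" for w
        unfolding Y_def by (rule sum.reindex_bij_betw[OF bij, of "\<lambda>i. indicator A (Z' i w)"])
      then show ?thesis by simp
    qed
    finally show "emeasure (distr \<pi> borel snd) A = emeasure (distr ?L borel (\<lambda>x. Z' (fst x) (snd x))) A"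
      using emeasure_distr_labelled_gauss[of Z', OF Z' A d] by simp
  qed simp
  ultimately have coup: "\<pi> \<in> couplings (distr ?L borel (\<lambda>x. Z (fst x) (snd x))) (distr ?L borel (\<lambda>x. Z' (fst x) (snd x)))"
    by (simp add: couplings_def \<pi>_def)
  have [measurable]: "(\<lambda>w. (dpt (fst w) (snd w))\<^sup>2) \<in> borel_measurable (borel :: ((complex^'n) \<times> (complex^'n)) measure)"
    by measurable
  have "(\<integral>\<^sup>+w. ennreal ((dpt (fst w) (snd w))\<^sup>2) \<partial>\<pi>) = (\<integral>\<^sup>+x. ennreal ((dpt (Z (fst x) (snd x)) (Y (fst x) (snd x)))\<^sup>2) \<partial>?L)"
    unfolding \<pi>_def using mP by (subst nn_integral_distr) auto
  also have "\<dots> = ennreal (1 / d) * (\<Sum>i<d. \<integral>\<^sup>+w. ennreal ((dpt (Z i w) (Y i w))\<^sup>2) \<partial>gauss)"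
    using d mZ mY by (subst nn_integral_labelled_gauss) auto
  also have "(\<Sum>i<d. \<integral>\<^sup>+w. ennreal ((dpt (Z i w) (Y i w))\<^sup>2) \<partial>gauss) = (\<integral>\<^sup>+w. cost (k w) w \<partial>gauss)"
    unfolding cost_def Y_def[symmetric] by (rule nn_integral_sum[symmetric]) measurable
  \<comment> \<open>The averaging factor \<open>1 / d\<close> is simply discarded; it would only
    improve the constant.\<close>
  also have "ennreal (1 / d) * \<dots> \<le> ennreal 1 * (\<integral>\<^sup>+w. cost (k w) w \<partial>gauss)"
    using d by (intro mult_right_mono ennreal_leI) auto
  also have "\<dots> \<le> (\<integral>\<^sup>+w. B w \<partial>gauss)"
    unfolding ennreal_1 mult_1_left
  proof (rule nn_integral_mono_AE, use ae in eventually_elim)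
    case (elim w)
    then obtain \<sigma> where "bij_betw \<sigma> {..<d} {..<d}" "(\<Sum>i<d. ennreal ((dpt (Z i w) (Z' (\<sigma> i) w))\<^sup>2)) \<le> B w" by blast
    with minc[of \<sigma> w] show ?case by (auto intro: order_trans)
  qed
  also note B
  finally have nn: "(\<integral>\<^sup>+w. ennreal ((dpt (fst w) (snd w))\<^sup>2) \<partial>\<pi>) \<le> ennreal b" .
  have "(\<integral>w. (dpt (fst w) (snd w))\<^sup>2 \<partial>\<pi>) = enn2real (\<integral>\<^sup>+w. ennreal ((dpt (fst w) (snd w))\<^sup>2) \<partial>\<pi>)"
    by (rule integral_eq_nn_integral) (auto simp: \<pi>_def)
  also have "\<dots> \<le> b" using nn b enn2real_mono[OF nn] by simp
  finally have "(\<integral>w. (dpt (fst w) (snd w))\<^sup>2 \<partial>\<pi>) \<le> b" .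
  moreover have "Inf ((\<lambda>\<pi>. \<integral> w. (dpt (fst w) (snd w))\<^sup>2 \<partial>\<pi>) ` couplings (distr ?L borel (\<lambda>x. Z (fst x) (snd x))) (distr ?L borel (\<lambda>x. Z' (fst x) (snd x))))
     \<le> (\<integral>w. (dpt (fst w) (snd w))\<^sup>2 \<partial>\<pi>)"
    using coup by (intro cInf_lower bdd_belowI[of _ 0]) (auto intro!: integral_nonneg)
  ultimately show ?thesis unfolding W2_def by (intro real_sqrt_le_mono) simp
qed

section \<open>Matching the roots on a single line\<close>

text \<open>Follows from \<open>x * cos x \<le> sin x\<close> at half the angle and the double-angle
  formulas; the sharp constant would be \<open>pi / 2\<close>.\<close>

lemma le_two_sin:
  fixes t :: real
  assumes "0 \<le> t" "t \<le> pi / 2"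
  shows "t \<le> 2 * sin t"
proof -
  have "sin 0 - 0 * cos 0 \<le> sin (t/2) - (t/2) * cos (t/2)"
  proof (rule DERIV_nonneg_imp_nondecreasing[of 0 "t/2" "\<lambda>x. sin x - x * cos x"])
    fix x assume x: "0 \<le> x" "x \<le> t / 2"
    have "((\<lambda>x. sin x - x * cos x) has_real_derivative x * sin x) (at x)"
      by (auto intro!: derivative_eq_intros)
    moreover have "0 \<le> x * sin x" using x assms by (intro mult_nonneg_nonneg sin_ge_zero) auto
    ultimately show "\<exists>y. ((\<lambda>x. sin x - x * cos x) has_real_derivative y) (at x) \<and> 0 \<le> y" by blast
  qed (use assms in auto)
  then have 1: "(t/2) * cos (t/2) \<le> sin (t/2)" by simp
  have c: "0 \<le> cos (t/2)" using assms by (intro cos_ge_zero) auto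
  have "0 \<le> cos t" using assms by (intro cos_ge_zero) auto
  then have "1 / 2 \<le> (cos (t/2))\<^sup>2" using cos_double_cos[of "t/2"] by simp
  then have "t / 2 \<le> t * (cos (t/2))\<^sup>2"
    using mult_left_mono[of "1/2" "(cos (t/2))\<^sup>2" t] assms by simp
  also have "\<dots> = 2 * ((t/2) * cos (t/2)) * cos (t/2)" by (simp add: power2_eq_square)
  also have "\<dots> \<le> 2 * sin (t/2) * cos (t/2)"
    using 1 c by (intro mult_right_mono) auto
  also have "\<dots> = sin t" using sin_double[of "t/2"] by simp
  finally show ?thesis by simp
qed

lemma norm_vec_diff_sq:
  fixes z w :: "complex^'n::finite"
  shows "(norm (z - w))\<^sup>2 = (norm z)\<^sup>2 + (norm w)\<^sup>2 - 2 * Re (\<Sum>i\<in>UNIV. z$i * cnj (w$i))"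
proof -
  have e: "(norm x)\<^sup>2 = (\<Sum>i\<in>UNIV. (cmod (x$i))\<^sup>2)" for x :: "complex^'n"
    unfolding norm_vec_def L2_set_def by (simp add: sum_nonneg)
  have "(cmod (a - b))\<^sup>2 = (cmod a)\<^sup>2 + (cmod b)\<^sup>2 - 2 * Re (a * cnj b)" for a b
    unfolding cmod_power2 by (simp add: power2_eq_square algebra_simps)
  then show ?thesis
    unfolding e by (simp add: sum.distrib sum_subtractf sum_distrib_left)
qed

text \<open>The sine of the angle between two complex lines is the distance from the unit vector of
  \<open>z\<close> to the line of \<open>w\<close>, hence at most
  \<open>norm (z - w) / norm z\<close>. For \<open>w = 0\<close> the formula for \<open>dpt\<close>
  gives \<open>pi / 2\<close>, which is still below 2.\<close>

lemma dpt_le: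
  fixes z w :: "complex^'n::finite"
  assumes "z \<noteq> 0"
  shows "dpt z w \<le> 2 * (norm (z - w) / norm z)"
proof (cases "w = 0")
  case True
  then show ?thesis using dpt_bounds(2)[of z w] assms pi_less_4 by simp
next
  case False
  define h where "h = cmod (\<Sum>i\<in>UNIV. z$i * cnj (w$i))"
  define t where "t = h / (norm z * norm w)"
  have h: "0 \<le> h" "h \<le> norm z * norm w" by (simp_all add: h_def dpt_arg_le_1)
  have t: "0 \<le> t" "t \<le> 1" using h assms False by (auto simp: t_def divide_le_eq_1)
  have "dpt z w = arccos t"
    unfolding dpt_def h_def[symmetric] t_def[symmetric] using t by simp
  moreover have "arccos t \<le> 2 * sin (arccos t)"
    using t by (intro le_two_sin arccos_lbound arccos_le_pi2) auto
  moreover have "sin (arccos t) = sqrt (1 - t\<^sup>2)" using t by (intro sin_arccos) auto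
  moreover have "sqrt (1 - t\<^sup>2) \<le> norm (z - w) / norm z"
  proof (rule real_le_lsqrt)
    have "Re (\<Sum>i\<in>UNIV. z$i * cnj (w$i)) \<le> h" unfolding h_def by (rule complex_Re_le_cmod)
    then have 1: "(norm z)\<^sup>2 + (norm w)\<^sup>2 - 2 * h \<le> (norm (z - w))\<^sup>2"
      unfolding norm_vec_diff_sq by simp
    \<comment> \<open>Completing the square; \<open>(norm z)\<^sup>2 - (h / norm w)\<^sup>2\<close>
      is the squared distance from \<open>z\<close> to the complex line of \<open>w\<close>.\<close>
    have "0 \<le> (norm w - h / norm w)\<^sup>2" by simp
    also have "(norm w - h / norm w)\<^sup>2 = (norm w)\<^sup>2 - 2 * h + (h / norm w)\<^sup>2"
      using False by (simp add: power2_eq_square field_simps)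
    finally have "(norm z)\<^sup>2 - (h / norm w)\<^sup>2 \<le> (norm (z - w))\<^sup>2" using 1 by linarith
    then have "((norm z)\<^sup>2 - (h / norm w)\<^sup>2) / (norm z)\<^sup>2 \<le> (norm (z - w))\<^sup>2 / (norm z)\<^sup>2"
      by (rule divide_right_mono) simp
    moreover have "((norm z)\<^sup>2 - (h / norm w)\<^sup>2) / (norm z)\<^sup>2 = 1 - t\<^sup>2"
      using assms False by (simp add: t_def power_divide power_mult_distrib diff_divide_distrib mult.commute)
    ultimately show "1 - t\<^sup>2 \<le> (norm (z - w) / norm z)\<^sup>2" by (simp add: power_divide)
  qed simp
  ultimately show ?thesis by simp
qed

text \<open>Chordal distance on the Riemann sphere of diameter 1. Unlike the distance of the
  parameters it is invariant under inversion, so separation statements obtained in the two charts of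
  a line can be compared.\<close>

definition chord :: "complex \<Rightarrow> complex \<Rightarrow> real" where
  "chord x y = cmod (x - y) / (sqrt (1 + (cmod x)\<^sup>2) * sqrt (1 + (cmod y)\<^sup>2))"

lemma chord_commute: "chord x y = chord y x"
  by (simp add: chord_def norm_minus_commute mult.commute)

text \<open>Stereographic projection realises \<open>chord\<close> as a Euclidean distance.\<close>

lemma chord_eq_dist:
  "chord x y = dist (x / of_real (1 + (cmod x)\<^sup>2), 1 / (1 + (cmod x)\<^sup>2)) (y / of_real (1 + (cmod y)\<^sup>2), 1 / (1 + (cmod y)\<^sup>2))"
proof -
  define A where "A = 1 + (cmod x)\<^sup>2"
  define B where "B = 1 + (cmod y)\<^sup>2"
  have AB: "0 < A" "0 < B" by (simp_all add: A_def B_def add_pos_nonneg)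
  have sq: "(cmod (a - b))\<^sup>2 = (cmod a)\<^sup>2 + (cmod b)\<^sup>2 - 2 * Re (a * cnj b)" for a b
    unfolding cmod_power2 by (simp add: power2_eq_square algebra_simps)
  define r where "r = Re (x * cnj y)"
  have R: "Re (x / of_real A * cnj (y / of_real B)) = r / (A * B)"
    by (simp add: r_def Re_divide_of_real[symmetric] del: Re_divide_of_real)
  have n: "(cmod x)\<^sup>2 = A - 1" "(cmod y)\<^sup>2 = B - 1" by (simp_all add: A_def B_def)
  have "(cmod (x / of_real A - y / of_real B))\<^sup>2 = (A - 1) / A\<^sup>2 + (B - 1) / B\<^sup>2 - 2 * (r / (A * B))"
    unfolding sq R by (simp add: norm_divide power_divide n)
  then have "(cmod (x / of_real A - y / of_real B))\<^sup>2 + (1 / A - 1 / B)\<^sup>2 = ((A - 1) + (B - 1) - 2 * r) / (A * B)"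
    using AB by (simp add: field_simps power2_eq_square)
  also have "(A - 1) + (B - 1) - 2 * r = (cmod (x - y))\<^sup>2" unfolding sq by (simp add: A_def B_def r_def)
  finally have "sqrt ((cmod (x / of_real A - y / of_real B))\<^sup>2 + (1 / A - 1 / B)\<^sup>2) = cmod (x - y) / (sqrt A * sqrt B)"
    using AB by (simp add: real_sqrt_divide real_sqrt_mult)
  then show ?thesis unfolding chord_def A_def[symmetric] B_def[symmetric]
    by (simp add: dist_norm norm_Pair)
qed

lemma chord_triangle: "chord x z \<le> chord x y + chord y z"
  unfolding chord_eq_dist by (rule dist_triangle)

lemma chord_le: "chord x y \<le> cmod (x - y)"
proof -
  have "1 * 1 \<le> sqrt (1 + (cmod x)\<^sup>2) * sqrt (1 + (cmod y)\<^sup>2)"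
    by (intro mult_mono) auto
  then show ?thesis unfolding chord_def by (simp add: divide_le_eq mult_le_cancel_left1)
qed

lemma chord_inverse:
  assumes "x \<noteq> 0" "y \<noteq> 0"
  shows "chord (1 / x) (1 / y) = chord x y"
proof -
  have s: "sqrt (1 + (cmod (1 / a))\<^sup>2) = sqrt (1 + (cmod a)\<^sup>2) / cmod a" if "a \<noteq> 0" for a
  proof -
    have "1 + (cmod (1 / a))\<^sup>2 = (1 + (cmod a)\<^sup>2) / (cmod a)\<^sup>2"
      using that by (simp add: norm_divide power_divide field_simps)
    then show ?thesis by (simp add: real_sqrt_divide)
  qed
  have "1 / x - 1 / y = (y - x) / (x * y)" using assms by (simp add: field_simps)
  then have "cmod (1 / x - 1 / y) = cmod (x - y) / (cmod x * cmod y)"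
    by (simp add: norm_divide norm_mult norm_minus_commute)
  then show ?thesis using assms by (simp add: chord_def s)
qed

text \<open>For \<open>y\<close> in a bounded region the two distances are comparable; for distant
  \<open>y\<close> the chord merely stays bounded below, which is why \<open>b\<close> is capped by
  1.\<close>

lemma chord_ge:
  assumes "cmod x \<le> 1" "b \<le> 1" "b \<le> cmod (x - y)" "0 \<le> b"
  shows "b / 4 \<le> chord x y"
proof -
  have "(1 + (cmod x)\<^sup>2) * (1 + (cmod y)\<^sup>2) * b\<^sup>2 \<le> (4 * cmod (x - y))\<^sup>2"
  proof (cases "cmod y \<le> 2")
    case True
    have "(1 + (cmod x)\<^sup>2) * (1 + (cmod y)\<^sup>2) \<le> (1 + 1\<^sup>2) * (1 + 2\<^sup>2)"
      using assms True by (intro mult_mono add_left_mono power_mono) auto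
    then have "(1 + (cmod x)\<^sup>2) * (1 + (cmod y)\<^sup>2) * b\<^sup>2 \<le> 16 * (cmod (x - y))\<^sup>2"
      using assms by (intro mult_mono power_mono) auto
    then show ?thesis by (simp add: power_mult_distrib)
  next
    case False
    have "cmod y - 1 \<le> cmod (x - y)"
      using norm_triangle_ineq2[of y x] assms(1) by (simp add: norm_minus_commute)
    then have "(4 * (cmod y - 1))\<^sup>2 \<le> (4 * cmod (x - y))\<^sup>2" using False by (intro power_mono) auto
    moreover have "(1 + (cmod x)\<^sup>2) * (1 + (cmod y)\<^sup>2) * b\<^sup>2 \<le> 2 * (1 + (cmod y)\<^sup>2) * 1"
      using assms by (intro mult_mono) (auto simp: power_le_one)
    moreover have "2 * (1 + (cmod y)\<^sup>2) \<le> (4 * (cmod y - 1))\<^sup>2"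
    proof -
      have "0 \<le> (cmod y - 2) * (14 * cmod y - 4)" using False by (intro mult_nonneg_nonneg) auto
      then show ?thesis by (simp add: power2_eq_square algebra_simps)
    qed
    ultimately show ?thesis by linarith
  qed
  then have "sqrt ((1 + (cmod x)\<^sup>2) * (1 + (cmod y)\<^sup>2) * b\<^sup>2) \<le> 4 * cmod (x - y)"
    by (intro real_le_lsqrt) auto
  then have "sqrt (1 + (cmod x)\<^sup>2) * sqrt (1 + (cmod y)\<^sup>2) * b \<le> 4 * cmod (x - y)"
    using assms by (simp add: real_sqrt_mult)
  moreover have "0 < sqrt (1 + (cmod x)\<^sup>2) * sqrt (1 + (cmod y)\<^sup>2)"
    by (intro mult_pos_pos) (auto simp: add_pos_nonneg)
  ultimately show ?thesis unfolding chord_def by (simp add: pos_le_divide_eq mult.commute)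
qed

text \<open>Serves to pair the well-separated roots as dictated and the remaining ones
  arbitrarily.\<close>

lemma extend_inj_to_bij:
  assumes "finite A" "G \<subseteq> A" "inj_on f G" "f ` G \<subseteq> A"
  shows "\<exists>\<sigma>. bij_betw \<sigma> A A \<and> (\<forall>i\<in>G. \<sigma> i = f i)"
proof -
  have "card (A - G) = card (A - f ` G)"
    using assms by (simp add: card_Diff_subset finite_subset card_image)
  then obtain g where g: "bij_betw g (A - G) (A - f ` G)"
    using assms(1) by (metis finite_same_card_bij finite_Diff)
  let ?s = "\<lambda>i. if i \<in> G then f i else g i"
  have "bij_betw ?s G (f ` G)"
    using assms(3) by (auto simp: bij_betw_def inj_on_def)
  moreover have "bij_betw ?s (A - G) (A - f ` G)"
    using g by (subst bij_betw_cong[of _ _ g]) auto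
  ultimately have "bij_betw ?s (G \<union> (A - G)) (f ` G \<union> (A - f ` G))"
    by (rule bij_betw_combine) auto
  moreover have "G \<union> (A - G) = A" "f ` G \<union> (A - f ` G) = A" using assms by auto
  ultimately show ?thesis by (intro exI[of _ ?s]) auto
qed

section \<open>Local analysis at one root of the restricted polynomial\<close>

lemma line_defect_ge:
  assumes "0 \<le> s" "0 \<le> q"
    and "\<And>x. cmod (x - x0) \<le> s \<Longrightarrow> cmod x \<le> 2 \<and> ennreal q \<le> tube_density d c C \<delta> u (x *s u + v)"
  shows "ennreal (q * (pi * s\<^sup>2)) \<le> line_defect d c C \<delta> u v"
proof -
  have "ennreal (q * (pi * s\<^sup>2)) = ennreal q * emeasure lborel (cball x0 s)"
    using assms by (simp add: emeasure_cball_complex ennreal_mult)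
  also have "\<dots> = (\<integral>\<^sup>+x. ennreal q * indicator (cball x0 s) x \<partial>lborel)"
    by (subst nn_integral_cmult) (auto intro!: borel_measurable_indicator)
  also have "\<dots> \<le> line_defect d c C \<delta> u v"
    unfolding line_defect_def
  proof (rule nn_integral_mono)
    fix x
    show "ennreal q * indicator (cball x0 s) x \<le> indicator (cball 0 2) x * tube_density d c C \<delta> u (x *s u + v)"
      using assms(3)[of x] by (auto simp: indicator_def dist_norm norm_minus_commute)
  qed
  finally show ?thesis .
qed

lemma restr_poly_diff: "restr_poly d (\<lambda>a. c a - c' a) u v = restr_poly d c u v - restr_poly d c' u v"
proof -
  have "[:c a - c' a:] * P = [:c a:] * P - [:c' a:] * P" for a and P :: "complex poly"
    by (simp add: smult_diff_left)
  then show ?thesis by (simp add: restr_poly_def sum_subtractf)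
qed

lemma pderiv_zero_at_double_root:
  fixes P :: "complex poly"
  assumes "[:- x, 1:] * ([:- x, 1:] * Q) = P"
  shows "poly (pderiv P) x = 0"
  unfolding assms[symmetric] pderiv_mult by simp

text \<open>Local picture at a root \<open>x0\<close> in the unit disc, in the coordinate \<open>y\<close> with
  \<open>x = x0 + \<sigma> y\<close>, which is normalised so that all constants depend only on \<open>d\<close> and \<open>R\<close>.\<close>

context
  fixes d :: nat and p :: "('n::finite \<Rightarrow> nat) \<Rightarrow> complex" and u v :: "complex^'n" and x0 :: complex
    and R \<delta> A M C \<sigma> m :: real and P :: "complex poly"
  assumes d1: "1 \<le> d" and R: "coeff_norm d p \<le> R" and \<delta>: "0 < \<delta>" "\<delta> \<le> 1 / 4"
    and u0: "u \<noteq> 0" and z0: "x0 *s u + v \<noteq> 0" and x0: "cmod x0 \<le> 1"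
    and root: "peval d p (x0 *s u + v) = 0"
  defines "M \<equiv> (real d + 1)\<^sup>2 * (2 ^ d * R) + 1"
    and "A \<equiv> 256 * (real d + 1)\<^sup>2 * 4 ^ (d + 1) * M"
    and "C \<equiv> 2 ^ d * (sqrt A + M) + 2 ^ (d + 1)"
    and "m \<equiv> norm (x0 *s u + v)"
    and "\<sigma> \<equiv> min 1 (m / norm u)"
    and "P \<equiv> restr_poly d p (of_real (\<sigma> / m) *s u) (of_real (1 / m) *s (x0 *s u + v))"
begin

lemma M_ge_1: "1 \<le> M"
proof -
  have "0 \<le> R" using R coeff_norm_nonneg[of d p] by linarith
  then show ?thesis unfolding M_def by simp
qed

text \<open>The three bounds are the three uses of \<open>A\<close>: the first keeps the derivative
  of the perturbed polynomial above \<open>a / 2\<close> and the displacement \<open>\<rho>\<close>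
  below a small multiple of \<open>sqrt \<delta>\<close>, the second separates the root from the
  others, the third keeps the quadratic Taylor term below \<open>\<delta>\<close> on the disc of
  radius \<open>\<rho>\<close>.\<close>

lemma A_ge: "256 * (real d + 1)\<^sup>2 * 4 ^ (d + 1) \<le> A" "256 * (real d + 1)\<^sup>2 * M \<le> A" "M \<le> A"
proof -
  have p4: "1 \<le> (4::real) ^ (d + 1)" by (rule one_le_power) simp
  have d2: "1 \<le> (real d + 1)\<^sup>2" by simp
  show "256 * (real d + 1)\<^sup>2 * 4 ^ (d + 1) \<le> A"
    unfolding A_def using mult_left_mono[OF M_ge_1, of "256 * (real d + 1)\<^sup>2 * 4 ^ (d + 1)"] by simp
  have "256 * (real d + 1)\<^sup>2 * M * 1 \<le> 256 * (real d + 1)\<^sup>2 * M * 4 ^ (d + 1)"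
    using M_ge_1 p4 by (intro mult_left_mono) auto
  then show A2: "256 * (real d + 1)\<^sup>2 * M \<le> A" unfolding A_def by (simp add: mult_ac)
  have "1 * M \<le> 256 * (real d + 1)\<^sup>2 * M"
    using M_ge_1 d2 by (intro mult_right_mono) linarith+
  then show "M \<le> A" using A2 by simp
qed

lemma A_nonneg: "0 \<le> A"
  using A_ge(3) M_ge_1 by linarith

lemma sqrt_A_ge: "16 * (real d + 1) * 2 ^ (d + 1) \<le> sqrt A"
proof (rule real_le_rsqrt)
  have "((2::real) ^ (d + 1))\<^sup>2 = 4 ^ (d + 1)" by (simp add: power2_eq_square flip: power_mult_distrib)
  then have "(16 * (real d + 1) * 2 ^ (d + 1))\<^sup>2 = 256 * (real d + 1)\<^sup>2 * 4 ^ (d + 1)"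
    by (simp only: power_mult_distrib) simp
  then show "(16 * (real d + 1) * 2 ^ (d + 1))\<^sup>2 \<le> A" using A_ge(1) by simp
qed

lemma m_pos: "0 < m" using z0 by (simp add: m_def)

lemma \<sigma>_pos: "0 < \<sigma>" using m_pos u0 by (simp add: \<sigma>_def)

lemma \<sigma>_le_1: "\<sigma> \<le> 1" by (simp add: \<sigma>_def)

text \<open>This is what \<open>\<sigma>\<close> is chosen for: after rescaling, both vectors
  spanning the line lie in the unit ball, so the coefficients of \<open>P\<close> are bounded
  however long \<open>u\<close> is compared with the base point. The cap at 1 keeps the discs inside
  the parameter range of \<open>line_defect\<close>.\<close>

lemma norm_dir: "norm (of_real (\<sigma> / m) *s u) \<le> 1"
proof -
  have "\<sigma> * norm u \<le> m / norm u * norm u" unfolding \<sigma>_def by (intro mult_right_mono) auto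
  then have "\<sigma> * norm u \<le> m" using u0 by simp
  then show ?thesis using \<sigma>_pos m_pos by (simp add: norm_vector_scalar_mult norm_divide)
qed

lemma norm_base: "norm (of_real (1 / m) *s (x0 *s u + v)) = 1"
  using m_pos unfolding norm_vector_scalar_mult m_def[symmetric] by (simp add: norm_divide)

lemma line_point:
  "(x0 + of_real \<sigma> * y) *s u + v = of_real m *s (y *s (of_real (\<sigma> / m) *s u) + of_real (1 / m) *s (x0 *s u + v))"
  using m_pos by (simp add: vec_eq_iff field_simps)

lemma peval_point: "peval d c ((x0 + of_real \<sigma> * y) *s u + v) =
   of_real m ^ d * poly (restr_poly d c (of_real (\<sigma> / m) *s u) (of_real (1 / m) *s (x0 *s u + v))) y"
  unfolding line_point peval_homogeneous poly_restr_poly ..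

lemma dir_deriv_point: "dir_deriv d p ((x0 + of_real \<sigma> * y) *s u + v) u =
   of_real (m ^ (d - 1) * (m / \<sigma>)) * poly (pderiv P) y"
proof -
  show ?thesis
    unfolding P_def poly_pderiv_restr_poly dir_deriv_def line_point dpeval_homogeneous sum_distrib_left
    using m_pos \<sigma>_pos by (intro sum.cong refl) (simp add: mult_ac)
qed

lemma P_0: "poly P 0 = 0"
  using peval_point[of p 0] root m_pos by (simp add: P_def)

lemma taylor:
  assumes "cmod y \<le> 1"
  shows "cmod (poly P y - poly (pderiv P) 0 * y) \<le> M * (cmod y)\<^sup>2"
    and "cmod (poly (pderiv P) y - poly (pderiv P) 0) \<le> M * cmod y"
proof -
  have deg: "degree P \<le> d" unfolding P_def by (rule degree_restr_poly)
  have co: "cmod (coeff P k) \<le> 2 ^ d * R" for k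
  proof -
    have "cmod (coeff P k) \<le> 2 ^ d * coeff_norm d p"
      unfolding P_def using norm_dir norm_base by (intro cmod_coeff_restr_poly_le) auto
    also have "\<dots> \<le> 2 ^ d * R" using R by (intro mult_left_mono) auto
    finally show ?thesis .
  qed
  have le: "(real d + 1)\<^sup>2 * (2 ^ d * R) \<le> M" by (simp add: M_def)
  show "cmod (poly P y - poly (pderiv P) 0 * y) \<le> M * (cmod y)\<^sup>2"
    using poly_taylor_bounds(1)[OF deg co assms] mult_right_mono[OF le, of "(cmod y)\<^sup>2"] by (simp add: P_0)
  show "cmod (poly (pderiv P) y - poly (pderiv P) 0) \<le> M * cmod y"
    using poly_taylor_bounds(2)[OF deg co assms] mult_right_mono[OF le, of "cmod y"] by simp
qed

text \<open>The last bound explains the weight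
  \<open>1 + (norm u)\<^sup>2 / (norm z)\<^sup>2\<close> in \<open>tube_density\<close>: a disc of
  radius \<open>\<sigma> * r\<close> in \<open>x\<close> has area proportional to
  \<open>\<sigma>\<^sup>2\<close>, and the weight restores this factor up to a constant 4.\<close>

lemma point_bounds:
  assumes "cmod y \<le> 1 / 2"
  defines "x \<equiv> x0 + of_real \<sigma> * y"
  shows "cmod x \<le> 2" "m \<le> 2 * norm (x *s u + v)" "x *s u + v \<noteq> 0"
    "1 \<le> 4 * \<sigma>\<^sup>2 * (1 + (norm u)\<^sup>2 / (norm (x *s u + v))\<^sup>2)"
proof -
  let ?z = "x *s u + v"
  have "cmod (of_real \<sigma> * y) \<le> 1 * (1/2)"
    unfolding norm_mult using assms \<sigma>_le_1 \<sigma>_pos by (intro mult_mono) auto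
  then show "cmod x \<le> 2"
    using norm_triangle_ineq[of x0 "of_real \<sigma> * y"] x0 by (simp add: x_def)
  have z: "norm ?z = m * norm (y *s (of_real (\<sigma> / m) *s u) + of_real (1 / m) *s (x0 *s u + v))"
    unfolding x_def line_point using m_pos by (simp only: norm_vector_scalar_mult) simp
  have "norm (y *s (of_real (\<sigma> / m) *s u)) \<le> (1/2) * 1"
    unfolding norm_vector_scalar_mult[of y] using assms norm_dir by (intro mult_mono) auto
  then have "1 / 2 \<le> norm (y *s (of_real (\<sigma> / m) *s u) + of_real (1 / m) *s (x0 *s u + v))"
    "norm (y *s (of_real (\<sigma> / m) *s u) + of_real (1 / m) *s (x0 *s u + v)) \<le> 3 / 2"
    using norm_base norm_triangle_ineq[of "y *s (of_real (\<sigma> / m) *s u)" "of_real (1 / m) *s (x0 *s u + v)"]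
      norm_triangle_ineq2[of "of_real (1 / m) *s (x0 *s u + v)" "- (y *s (of_real (\<sigma> / m) *s u))"]
    by (auto simp: add.commute)
  from mult_left_mono[OF this(1), of m] mult_left_mono[OF this(2), of m]
  have le: "m / 2 \<le> norm ?z" "norm ?z \<le> 3 / 2 * m" using m_pos unfolding z by auto
  then show "m \<le> 2 * norm ?z" by simp
  have pos: "0 < norm ?z" using le m_pos by linarith
  then show "?z \<noteq> 0" by auto
  show "1 \<le> 4 * \<sigma>\<^sup>2 * (1 + (norm u)\<^sup>2 / (norm ?z)\<^sup>2)"
  proof (cases "\<sigma> = 1")
    case True
    have "0 \<le> (norm u)\<^sup>2 / (norm ?z)\<^sup>2" by simp
    then show ?thesis unfolding True by simp
  next
    case False
    then have s: "\<sigma> = m / norm u" by (simp add: \<sigma>_def min_def split: if_splits)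
    have "(norm ?z)\<^sup>2 \<le> (2 * m)\<^sup>2" using le m_pos by (intro power_mono) auto
    then have "1 \<le> 4 * m\<^sup>2 / (norm ?z)\<^sup>2" using pos by (simp add: power_mult_distrib)
    also have "4 * m\<^sup>2 / (norm ?z)\<^sup>2 = 4 * \<sigma>\<^sup>2 * ((norm u)\<^sup>2 / (norm ?z)\<^sup>2)"
      unfolding s using u0 by (simp add: power_divide)
    also have "\<dots> \<le> 4 * \<sigma>\<^sup>2 * (1 + (norm u)\<^sup>2 / (norm ?z)\<^sup>2)" by (intro mult_left_mono) auto
    finally show ?thesis .
  qed
qed

text \<open>Translates smallness of the normalised polynomial into the homogeneous conditions of
  \<open>tube_density\<close>. The loss \<open>2 ^ d\<close> comes from replacing powers of
  \<open>m\<close> by powers of \<open>2 * norm z\<close> and accounts for the powers of 2 in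
  \<open>C\<close>.\<close>

lemma tube_point:
  assumes y: "cmod y \<le> 1 / 2" and K: "0 \<le> K" "2 ^ d * K \<le> C" and small: "cmod (poly P y) \<le> K * \<delta>"
  defines "z \<equiv> (x0 + of_real \<sigma> * y) *s u + v"
  shows "ennreal (1 / (4 * \<sigma>\<^sup>2)) \<le> tube_density d p C \<delta> u z"
    and "cmod (poly (pderiv P) y) \<le> K * sqrt \<delta> \<Longrightarrow> ennreal (1 / (4 * \<sigma>\<^sup>2 * \<delta>)) \<le> tube_density d p C \<delta> u z"
proof -
  note pb = point_bounds[OF y, folded z_def]
  have md: "m ^ k \<le> 2 ^ k * norm z ^ k" for k
    using power_mono[OF pb(2), of k] m_pos by (simp add: power_mult_distrib)
  have "cmod (peval d p z) = m ^ d * cmod (poly P y)"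
    unfolding z_def peval_point P_def using m_pos by (simp add: norm_mult norm_power)
  also have "\<dots> \<le> (2 ^ d * norm z ^ d) * (K * \<delta>)"
    using small md K m_pos \<delta> by (intro mult_mono) auto
  also have "\<dots> = (2 ^ d * K) * (\<delta> * norm z ^ d)" by (simp add: mult_ac)
  also have "\<dots> \<le> C * (\<delta> * norm z ^ d)" using K \<delta> by (intro mult_right_mono) auto
  finally have c1: "cmod (peval d p z) \<le> C * \<delta> * norm z ^ d" by (simp add: mult_ac)
  have w: "1 / (4 * \<sigma>\<^sup>2) \<le> 1 + (norm u)\<^sup>2 / (norm z)\<^sup>2"
    using pb(4) \<sigma>_pos by (simp add: pos_divide_le_eq mult.commute)
  have ind: "indicator {z. z \<noteq> 0 \<and> cmod (peval d p z) \<le> C * \<delta> * norm z ^ d} z = (1::ennreal)"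
    using c1 pb(3) by simp
  have "ennreal (1 / (4 * \<sigma>\<^sup>2)) * 1 \<le> ennreal (1 + (norm u)\<^sup>2 / (norm z)\<^sup>2) * (1 + ennreal (1 / \<delta>) * indicator {u. cmod (dir_deriv d p z u) \<le>
          C * sqrt \<delta> * norm z ^ (d - 1) * max (norm u) (norm z)} u)"
    by (intro mult_mono ennreal_leI w) auto
  then show "ennreal (1 / (4 * \<sigma>\<^sup>2)) \<le> tube_density d p C \<delta> u z"
    unfolding tube_density_def ind by simp
  assume small': "cmod (poly (pderiv P) y) \<le> K * sqrt \<delta>"
  have ms: "m / \<sigma> \<le> 2 * max (norm u) (norm z)"
  proof (cases "\<sigma> = 1")
    case True
    then show ?thesis using pb(2) by simp
  next
    case False
    then have s: "\<sigma> = m / norm u" by (simp add: \<sigma>_def min_def split: if_splits)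
    have "norm u \<le> 2 * max (norm u) (norm z)" using norm_ge_zero[of u] by linarith
    then show ?thesis using m_pos u0 by (simp add: s)
  qed
  have "cmod (dir_deriv d p z u) = m ^ (d - 1) * (m / \<sigma>) * cmod (poly (pderiv P) y)"
    unfolding z_def dir_deriv_point using m_pos \<sigma>_pos by (simp add: norm_mult norm_power norm_divide)
  also have "\<dots> \<le> (2 ^ (d - 1) * norm z ^ (d - 1)) * (2 * max (norm u) (norm z)) * (K * sqrt \<delta>)"
    using small' md ms K m_pos \<sigma>_pos \<delta> by (intro mult_mono) (auto simp: le_max_iff_disj intro!: mult_nonneg_nonneg)
  also have "\<dots> = (2 * 2 ^ (d - 1)) * K * (sqrt \<delta> * norm z ^ (d - 1) * max (norm u) (norm z))" by (simp add: mult_ac)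
  also have "2 * 2 ^ (d - 1) = (2::real) ^ d" using d1 by (metis power_eq_if not_one_le_zero)
  also have "2 ^ d * K * (sqrt \<delta> * norm z ^ (d - 1) * max (norm u) (norm z)) \<le> C * (sqrt \<delta> * norm z ^ (d - 1) * max (norm u) (norm z))"
    using K \<delta> by (intro mult_right_mono) (auto simp: le_max_iff_disj intro!: mult_nonneg_nonneg)
  finally have "indicator {u. cmod (dir_deriv d p z u) \<le> C * sqrt \<delta> * norm z ^ (d - 1) * max (norm u) (norm z)} u = (1::ennreal)"
    by (simp add: mult_ac)
  then have "tube_density d p C \<delta> u z = ennreal (1 + (norm u)\<^sup>2 / (norm z)\<^sup>2) * (1 + ennreal (1 / \<delta>))"
    unfolding tube_density_def ind by simp
  moreover have "ennreal (1 / (4 * \<sigma>\<^sup>2)) * ennreal (1 / \<delta>) \<le> ennreal (1 + (norm u)\<^sup>2 / (norm z)\<^sup>2) * (1 + ennreal (1 / \<delta>))"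
    by (intro mult_mono ennreal_leI w) auto
  moreover have "ennreal (1 / (4 * \<sigma>\<^sup>2)) * ennreal (1 / \<delta>) = ennreal (1 / (4 * \<sigma>\<^sup>2 * \<delta>))"
    using \<delta> \<sigma>_pos by (simp add: ennreal_mult[symmetric])
  ultimately show "ennreal (1 / (4 * \<sigma>\<^sup>2 * \<delta>)) \<le> tube_density d p C \<delta> u z" by simp
qed

lemma disc_coordinate:
  assumes "cmod (x - x0) \<le> \<sigma> * r"
  shows "\<exists>y. x = x0 + of_real \<sigma> * y \<and> cmod y \<le> r"
  using assms \<sigma>_pos
  by (intro exI[of _ "(x - x0) / of_real \<sigma>"]) (auto simp: norm_divide field_simps)

text \<open>On the disc of radius \<open>sqrt \<delta>\<close> in \<open>y\<close> the polynomial is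
  O(\<open>\<delta>\<close>) and its derivative O(\<open>sqrt \<delta>\<close>), so both indicators
  hold. Area times density is \<open>pi / 4\<close> whatever \<open>\<delta>\<close> is: a single
  bad root makes the defect of order one.\<close>

lemma bad_root:
  assumes "(cmod (poly (pderiv P) 0))\<^sup>2 < A * \<delta>"
  shows "1 \<le> 2 * line_defect d p C \<delta> u v"
proof -
  define a where "a = poly (pderiv P) 0"
  have sd: "0 < sqrt \<delta>" "sqrt \<delta> \<le> 1 / 2" "(sqrt \<delta>)\<^sup>2 = \<delta>"
    using \<delta> real_sqrt_le_mono[OF \<delta>(2)] by (auto simp: real_sqrt_divide)
  have a: "cmod a \<le> sqrt A * sqrt \<delta>"
    using assms real_le_rsqrt[of "cmod a" "A * \<delta>"] by (simp add: a_def real_sqrt_mult)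
  have K: "0 \<le> sqrt A + M" "2 ^ d * (sqrt A + M) \<le> C"
    using M_ge_1 A_ge(3) by (auto simp: C_def intro: add_nonneg_nonneg)
  have "ennreal (1 / (4 * \<sigma>\<^sup>2 * \<delta>) * (pi * (\<sigma> * sqrt \<delta>)\<^sup>2)) \<le> line_defect d p C \<delta> u v"
  proof (rule line_defect_ge[where ?x0.0 = x0])
    fix x assume "cmod (x - x0) \<le> \<sigma> * sqrt \<delta>"
    then obtain y where y: "x = x0 + of_real \<sigma> * y" "cmod y \<le> sqrt \<delta>" using disc_coordinate by blast
    have y1: "cmod y \<le> 1 / 2" using y sd by linarith
    then have y2: "cmod y \<le> 1" by linarith
    have "cmod (poly P y) \<le> cmod (a * y) + M * (cmod y)\<^sup>2"
      using taylor(1)[OF y2] norm_triangle_ineq[of "a * y" "poly P y - a * y"] by (simp add: a_def)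
    also have "\<dots> \<le> sqrt A * sqrt \<delta> * sqrt \<delta> + M * (sqrt \<delta>)\<^sup>2"
      unfolding norm_mult using a y(2) M_ge_1 sd A_nonneg by (intro add_mono mult_mono power_mono) auto
    also have "\<dots> = (sqrt A + M) * \<delta>" using sd by (simp add: power2_eq_square algebra_simps)
    finally have s1: "cmod (poly P y) \<le> (sqrt A + M) * \<delta>" .
    have "cmod (poly (pderiv P) y) \<le> cmod a + M * cmod y"
      using taylor(2)[OF y2] norm_triangle_ineq[of a "poly (pderiv P) y - a"] by (simp add: a_def)
    also have "\<dots> \<le> sqrt A * sqrt \<delta> + M * sqrt \<delta>"
      using a y(2) M_ge_1 by (intro add_mono mult_left_mono) auto
    also have "\<dots> = (sqrt A + M) * sqrt \<delta>" by (simp add: algebra_simps)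
    finally have s2: "cmod (poly (pderiv P) y) \<le> (sqrt A + M) * sqrt \<delta>" .
    show "cmod x \<le> 2 \<and> ennreal (1 / (4 * \<sigma>\<^sup>2 * \<delta>)) \<le> tube_density d p C \<delta> u (x *s u + v)"
      using point_bounds(1)[OF y1] tube_point(2)[OF y1 K s1 s2] y(1) by simp
  qed (use \<sigma>_pos sd \<delta> in auto)
  also have "1 / (4 * \<sigma>\<^sup>2 * \<delta>) * (pi * (\<sigma> * sqrt \<delta>)\<^sup>2) = pi / 4"
    using \<sigma>_pos \<delta> sd by (simp add: power_mult_distrib)
  finally have LD: "ennreal (pi / 4) \<le> line_defect d p C \<delta> u v" .
  have "1 \<le> ennreal (2 * (pi / 4))"
    unfolding ennreal_1[symmetric] using pi_ge_two by (intro ennreal_leI) simp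
  also have "\<dots> = ennreal 2 * ennreal (pi / 4)" by (rule ennreal_mult) auto
  also have "\<dots> \<le> ennreal 2 * line_defect d p C \<delta> u v" using LD by (intro mult_left_mono) auto
  finally show ?thesis by simp
qed

context
  fixes a \<rho> :: real
  assumes good: "A * \<delta> \<le> (cmod (poly (pderiv P) 0))\<^sup>2"
  defines "a \<equiv> cmod (poly (pderiv P) 0)"
    and "\<rho> \<equiv> \<delta> / a"
begin

lemma a_ge: "16 * (real d + 1) * 2 ^ (d + 1) * sqrt \<delta> \<le> a" "0 < a"
proof -
  have "sqrt A * sqrt \<delta> \<le> a"
    unfolding real_sqrt_mult[symmetric] a_def using good by (intro real_le_lsqrt) auto
  then show 1: "16 * (real d + 1) * 2 ^ (d + 1) * sqrt \<delta> \<le> a"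
    using order_trans[OF mult_right_mono[OF sqrt_A_ge, of "sqrt \<delta>"]] \<delta> by simp
  have "0 < 16 * (real d + 1) * 2 ^ (d + 1) * sqrt \<delta>"
    using \<delta> by (intro mult_pos_pos) auto
  then show "0 < a" using 1 by linarith
qed

lemma rho_pos: "0 < \<rho>" using \<delta> a_ge(2) by (simp add: \<rho>_def)

lemma rho_le: "16 * (real d + 1) * 2 ^ (d + 1) * \<rho> \<le> sqrt \<delta>" "sqrt \<delta> \<le> 1 / 2"
proof -
  have "16 * (real d + 1) * 2 ^ (d + 1) * \<delta> = 16 * (real d + 1) * 2 ^ (d + 1) * sqrt \<delta> * sqrt \<delta>"
    using \<delta> by simp
  also have "\<dots> \<le> a * sqrt \<delta>" using a_ge(1) \<delta> by (intro mult_right_mono) auto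
  finally show "16 * (real d + 1) * 2 ^ (d + 1) * \<rho> \<le> sqrt \<delta>"
    using a_ge(2) unfolding \<rho>_def by (simp add: pos_divide_le_eq mult.commute)
  show "sqrt \<delta> \<le> 1 / 2" using real_sqrt_le_mono[OF \<delta>(2)] by (simp add: real_sqrt_divide)
qed

lemma rho_small: "16 * (real d + 1) * \<rho> \<le> 1 / 2" "\<rho> \<le> 1 / 2"
proof -
  have "16 * (real d + 1) * \<rho> * 1 \<le> 16 * (real d + 1) * \<rho> * 2 ^ (d + 1)"
    using rho_pos by (intro mult_left_mono one_le_power) auto
  then show 1: "16 * (real d + 1) * \<rho> \<le> 1 / 2" using order_trans[OF _ order_trans[OF rho_le]] by (simp only: mult_ac mult_1_right)
  have "1 * \<rho> \<le> 16 * (real d + 1) * \<rho>" using rho_pos by (intro mult_right_mono) auto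
  then show "\<rho> \<le> 1 / 2" using 1 by linarith
qed

text \<open>On the disc of radius \<open>\<rho>\<close> the linear term is at most
  \<open>a * \<rho> = \<delta>\<close>, and so is the quadratic one. The squared displacement is
  thus itself comparable to an area inside the tube; this is how the defect controls the transport
  cost.\<close>

lemma good_defect: "ennreal (\<rho>\<^sup>2) \<le> 2 * line_defect d p C \<delta> u v"
proof -
  have K: "2 ^ d * 2 \<le> C"
    using M_ge_1 A_ge(3) by (simp add: C_def)
  have "ennreal (1 / (4 * \<sigma>\<^sup>2) * (pi * (\<sigma> * \<rho>)\<^sup>2)) \<le> line_defect d p C \<delta> u v"
  proof (rule line_defect_ge[where ?x0.0 = x0])
    fix x assume "cmod (x - x0) \<le> \<sigma> * \<rho>"
    then obtain y where y: "x = x0 + of_real \<sigma> * y" "cmod y \<le> \<rho>" using disc_coordinate by blast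
    have y1: "cmod y \<le> 1 / 2" using y rho_small by linarith
    then have y2: "cmod y \<le> 1" by linarith
    have "cmod (poly P y) \<le> a * cmod y + M * (cmod y)\<^sup>2"
      using taylor(1)[OF y2] norm_triangle_ineq[of "poly (pderiv P) 0 * y" "poly P y - poly (pderiv P) 0 * y"]
      by (simp add: a_def norm_mult)
    also have "\<dots> \<le> a * \<rho> + M * \<rho>\<^sup>2"
      using y(2) M_ge_1 a_ge by (intro add_mono mult_left_mono power_mono) auto
    also have "a * \<rho> = \<delta>" using a_ge by (simp add: \<rho>_def)
    also have "M * \<rho>\<^sup>2 \<le> \<delta>"
    proof -
      have "M * \<delta> \<le> a\<^sup>2" using good order_trans[OF mult_right_mono[OF A_ge(3), of \<delta>]] \<delta> by (simp add: a_def)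
      then have "M * \<delta> * \<delta> \<le> a\<^sup>2 * \<delta>" using \<delta> by (intro mult_right_mono) auto
      then show ?thesis using a_ge(2) by (simp add: \<rho>_def power_divide field_simps power2_eq_square)
    qed
    finally have s1: "cmod (poly P y) \<le> 2 * \<delta>" by simp
    show "cmod x \<le> 2 \<and> ennreal (1 / (4 * \<sigma>\<^sup>2)) \<le> tube_density d p C \<delta> u (x *s u + v)"
      using point_bounds(1)[OF y1] tube_point(1)[OF y1 _ K s1] y(1) by simp
  qed (use \<sigma>_pos rho_pos in auto)
  also have "1 / (4 * \<sigma>\<^sup>2) * (pi * (\<sigma> * \<rho>)\<^sup>2) = pi / 4 * \<rho>\<^sup>2"
    using \<sigma>_pos by (simp add: power_mult_distrib)
  finally have LD: "ennreal (pi / 4 * \<rho>\<^sup>2) \<le> line_defect d p C \<delta> u v" .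
  have "ennreal (\<rho>\<^sup>2) \<le> ennreal (2 * (pi / 4 * \<rho>\<^sup>2))"
    using pi_ge_two mult_right_mono[of 2 pi "\<rho>\<^sup>2"] by (intro ennreal_leI) simp
  also have "\<dots> = ennreal 2 * ennreal (pi / 4 * \<rho>\<^sup>2)" by (rule ennreal_mult) auto
  also have "\<dots> \<le> ennreal 2 * line_defect d p C \<delta> u v" using LD by (intro mult_left_mono) auto
  finally show ?thesis by simp
qed

text \<open>At \<open>y = 0\<close> the perturbed polynomial has value at most
  \<open>\<delta>\<close> and derivative at least \<open>a / 2\<close>, so
  \<open>poly_root_near\<close> finds a root at distance of order \<open>\<rho>\<close>. It is
  recorded both in the parameter \<open>x\<close>, for injectivity of the matching, and as a
  projective distance, for the cost.\<close>

lemma good_match: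
  assumes q: "coeff_norm d (\<lambda>a. q a - p a) \<le> \<delta>"
  shows "\<exists>y. peval d q (y *s u + v) = 0 \<and> cmod (x0 - y) \<le> 2 * d * \<rho> * \<sigma> \<and>
     (dpt (x0 *s u + v) (y *s u + v))\<^sup>2 \<le> 16 * (real d)\<^sup>2 * \<rho>\<^sup>2"
proof -
  let ?t = "of_real (\<sigma> / m) *s u" and ?b = "of_real (1 / m) *s (x0 *s u + v)"
  define Q where "Q = restr_poly d q ?t ?b"
  have QP: "cmod (coeff (Q - P) k) \<le> 2 ^ d * \<delta>" for k
  proof -
    have "cmod (coeff (Q - P) k) \<le> 2 ^ d * coeff_norm d (\<lambda>a. q a - p a)"
      unfolding Q_def P_def restr_poly_diff[symmetric] using norm_dir norm_base
      by (intro cmod_coeff_restr_poly_le) auto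
    also have "\<dots> \<le> 2 ^ d * \<delta>" using q by (intro mult_left_mono) auto
    finally show ?thesis .
  qed
  have "poly Q 0 = peval d (\<lambda>a. q a - p a) ?b"
    using P_0 unfolding Q_def P_def poly_restr_poly peval_diff by simp
  then have Q0: "cmod (poly Q 0) \<le> \<delta>"
    using cmod_peval_le[of d "\<lambda>a. q a - p a" ?b] q by (simp only: norm_base power_one mult_1_right)
  have "poly (pderiv Q) 0 = poly (pderiv P) 0 + coeff (Q - P) 1"
    by (simp add: poly_0_coeff_0 coeff_pderiv)
  then have "a - 2 ^ d * \<delta> \<le> cmod (poly (pderiv Q) 0)"
    using norm_triangle_ineq2[of "poly (pderiv P) 0" "- coeff (Q - P) 1"] QP[of 1]
    by (simp only: a_def norm_minus_cancel diff_minus_eq_add)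
  moreover have "2 ^ d * \<delta> \<le> a / 2"
  proof -
    have "2 ^ (d + 1) * \<delta> = 2 ^ (d + 1) * sqrt \<delta> * sqrt \<delta>" using \<delta> by simp
    also have "\<dots> \<le> 2 ^ (d + 1) * sqrt \<delta> * 1" using \<delta> rho_le(2) by (intro mult_left_mono) auto
    also have "\<dots> \<le> 16 * (real d + 1) * (2 ^ (d + 1) * sqrt \<delta>)"
      using \<delta> mult_right_mono[of 1 "16 * (real d + 1)" "2 ^ (d + 1) * sqrt \<delta>"] by simp
    also have "\<dots> \<le> a" using a_ge(1) by (simp add: mult_ac)
    finally show ?thesis by simp
  qed
  ultimately have Q': "a / 2 \<le> cmod (poly (pderiv Q) 0)" by simp
  have "degree Q \<le> d" unfolding Q_def by (rule degree_restr_poly)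
  from poly_root_near[OF Q0 Q' _ this] a_ge(2)
  obtain y where y: "poly Q y = 0" "cmod y \<le> real d * \<delta> / (a / 2)" by auto
  then have y2: "cmod y \<le> 2 * d * \<rho>" by (simp add: \<rho>_def mult_ac)
  define x where "x = x0 + of_real \<sigma> * y"
  have "peval d q (x *s u + v) = 0"
    unfolding x_def peval_point using y(1) by (simp add: Q_def)
  moreover have "cmod (x0 - x) \<le> 2 * d * \<rho> * \<sigma>"
    using y2 \<sigma>_pos by (simp add: x_def norm_mult mult.commute)
  moreover have "(dpt (x0 *s u + v) (x *s u + v))\<^sup>2 \<le> 16 * (real d)\<^sup>2 * \<rho>\<^sup>2"
  proof -
    have zz: "x0 *s u + v - (x *s u + v) = (x0 - x) *s u" by (simp add: vec_eq_iff algebra_simps)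
    have "norm ((x0 - x) *s u) / m = cmod y * norm ?t"
      using m_pos \<sigma>_pos by (simp add: x_def norm_vector_scalar_mult norm_mult norm_divide)
    also have "\<dots> \<le> 2 * d * \<rho> * 1" using y2 norm_dir rho_pos by (intro mult_mono) auto
    finally have "norm ((x0 - x) *s u) / m \<le> 2 * d * \<rho>" by simp
    then have "dpt (x0 *s u + v) (x *s u + v) \<le> 4 * d * \<rho>"
      using dpt_le[OF z0, of "x *s u + v"] unfolding zz m_def[symmetric] by simp
    from power_mono[OF this dpt_bounds(1), of 2] show ?thesis by (simp add: power_mult_distrib)
  qed
  ultimately show ?thesis by blast
qed

text \<open>At a second root the Taylor bound gives
  \<open>a * cmod y \<le> M * (cmod y)\<^sup>2\<close>, so roots repel at distance
  \<open>a / M\<close>. The threshold makes \<open>\<rho>\<close> a small multiple of this, and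
  twice the displacement stays below the separation; the factor 16 absorbs the loss of 4 in
  \<open>chord_ge\<close>.\<close>

lemma good_separation:
  assumes x: "peval d p (x *s u + v) = 0" "x \<noteq> x0"
  shows "2 * (2 * d * \<rho> * \<sigma>) < chord x0 x"
proof -
  define y where "y = (x - x0) / of_real \<sigma>"
  have xy: "x = x0 + of_real \<sigma> * y" using \<sigma>_pos by (simp add: y_def)
  have y0: "y \<noteq> 0" using x(2) \<sigma>_pos by (simp add: y_def)
  have Py: "poly P y = 0"
    using x(1) m_pos unfolding xy peval_point by (simp add: P_def)
  define b where "b = min 1 (a / M)"
  have b: "0 < b" "b \<le> 1" using a_ge(2) M_ge_1 by (auto simp: b_def)
  have "b \<le> cmod y"
  proof (cases "cmod y \<le> 1")
    case True
    have "a * cmod y \<le> M * (cmod y)\<^sup>2"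
      using taylor(1)[OF True] Py by (simp add: a_def norm_mult)
    then have "a \<le> M * cmod y" using y0 by (simp add: power2_eq_square)
    then have "a / M \<le> cmod y" using M_ge_1 by (simp add: pos_divide_le_eq mult.commute)
    then show ?thesis by (simp add: b_def)
  qed (simp add: b_def)
  then have "\<sigma> * b \<le> cmod (x0 - x)" using \<sigma>_pos by (simp add: xy norm_mult)
  moreover have "\<sigma> * b \<le> 1 * 1" using \<sigma>_le_1 \<sigma>_pos b by (intro mult_mono) auto
  ultimately have ch: "\<sigma> * b / 4 \<le> chord x0 x"
    using x0 \<sigma>_pos b by (intro chord_ge) auto
  have "16 * d * \<rho> < b"
  proof -
    have "16 * d * \<rho> < 16 * (real d + 1) * \<rho>" using rho_pos by simp
    also have "\<dots> \<le> b"
    proof -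
      have "16 * (real d + 1) * (M * \<delta>) \<le> 256 * (real d + 1)\<^sup>2 * (M * \<delta>)"
        using M_ge_1 \<delta> by (intro mult_right_mono) (auto simp: power2_eq_square algebra_simps)
      also have "\<dots> \<le> A * \<delta>" using mult_right_mono[OF A_ge(2), of \<delta>] \<delta> by simp
      also have "\<dots> \<le> a * a" using good by (simp add: a_def power2_eq_square)
      finally have "16 * (real d + 1) * \<rho> \<le> a / M"
        using a_ge(2) M_ge_1 by (simp add: \<rho>_def pos_le_divide_eq pos_divide_le_eq mult_ac)
      then show ?thesis using rho_small(1) unfolding b_def by simp
    qed
    finally show ?thesis .
  qed
  then have "\<sigma> * (16 * d * \<rho>) < \<sigma> * b" using \<sigma>_pos by simp
  then show ?thesis using ch by (simp add: mult_ac)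
qed

end

end

text \<open>This and the next two are the constants \<open>M\<close>, \<open>A\<close> and
  \<open>C\<close> of the local picture as functions of \<open>d\<close> and \<open>R\<close> alone,
  independent of any line or root.\<close>

definition taylor_const :: "nat \<Rightarrow> real \<Rightarrow> real" where
  "taylor_const d R = (real d + 1)\<^sup>2 * (2 ^ d * R) + 1"

definition bad_const :: "nat \<Rightarrow> real \<Rightarrow> real" where
  "bad_const d R = 256 * (real d + 1)\<^sup>2 * 4 ^ (d + 1) * taylor_const d R"

definition width_const :: "nat \<Rightarrow> real \<Rightarrow> real" where
  "width_const d R = 2 ^ d * (sqrt (bad_const d R) + taylor_const d R) + 2 ^ (d + 1)"

text \<open>Either the root is bad and the defect is of order one, or it has a partner closer than
  half its separation from all other roots, at a cost that the defect pays. The radius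
  \<open>s\<close> in the second case is \<open>2 * d * \<rho> * \<sigma>\<close>.\<close>

lemma root_dichotomy:
  fixes p q :: "('n::finite \<Rightarrow> nat) \<Rightarrow> complex"
  assumes d1: "1 \<le> d" and R: "coeff_norm d p \<le> R" and \<delta>: "0 < \<delta>" "\<delta> \<le> 1 / 4"
    and q: "coeff_norm d (\<lambda>a. q a - p a) \<le> \<delta>"
    and u0: "u \<noteq> 0" and z0: "\<And>x. x *s u + v \<noteq> 0"
    and fp: "restr_poly d p u v = smult L (\<Prod>i<d. [:- X i, 1:])"
    and fq: "\<And>x. peval d q (x *s u + v) = 0 \<Longrightarrow> \<exists>j<d. x = Y j"
    and i: "i < d" "cmod (X i) \<le> 1"
  defines "LD \<equiv> line_defect d p (width_const d R) \<delta> u v"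
  shows "1 \<le> 2 * LD \<or> (\<exists>j<d. \<exists>s. chord (X i) (Y j) \<le> s \<and> (\<forall>k<d. k \<noteq> i \<longrightarrow> 2 * s < chord (X i) (X k)) \<and>
     ennreal ((dpt (X i *s u + v) (Y j *s u + v))\<^sup>2) \<le> ennreal (32 * (real d + 1)\<^sup>2) * LD)"
proof -
  have roots: "peval d p (X k *s u + v) = 0" if "k < d" for k
    unfolding poly_restr_poly[symmetric] fp using that by (auto simp: poly_prod)
  have root: "peval d p (X i *s u + v) = 0" using roots i by blast
  note ctx = d1 R \<delta> u0 z0[of "X i"] i(2) root
  define m where "m = norm (X i *s u + v)"
  define \<sigma> where "\<sigma> = min 1 (m / norm u)"
  define P where "P = restr_poly d p (of_real (\<sigma> / m) *s u) (of_real (1 / m) *s (X i *s u + v))"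
  define a where "a = cmod (poly (pderiv P) 0)"
  note folds = m_def[symmetric] \<sigma>_def[symmetric] P_def[symmetric] a_def[symmetric]
    taylor_const_def[symmetric] bad_const_def[symmetric] width_const_def[symmetric] LD_def[symmetric]
  show ?thesis
  proof (cases "a\<^sup>2 < bad_const d R * \<delta>")
    case True
    then show ?thesis using bad_root[OF ctx, unfolded folds] by blast
  next
    case False
    then have good: "bad_const d R * \<delta> \<le> a\<^sup>2" by simp
    define \<rho> where "\<rho> = \<delta> / a"
    note ctx2 = ctx good[unfolded a_def P_def \<sigma>_def m_def bad_const_def taylor_const_def]
    have a0: "0 < a" using a_ge(2)[OF ctx2, unfolded folds] .
    obtain y where y: "peval d q (y *s u + v) = 0" "cmod (X i - y) \<le> 2 * d * \<rho> * \<sigma>"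
      "(dpt (X i *s u + v) (y *s u + v))\<^sup>2 \<le> 16 * (real d)\<^sup>2 * \<rho>\<^sup>2"
      using good_match[OF ctx2 q, unfolded folds, folded \<rho>_def] by blast
    obtain j where j: "j < d" "y = Y j" using fq[OF y(1)] by blast
    \<comment> \<open>Equal roots under different labels form a double root, at which the derivative
      vanishes; a good root is therefore simple, and distinct labels name distinct points.\<close>
    have sep: "2 * (2 * d * \<rho> * \<sigma>) < chord (X i) (X k)" if k: "k < d" "k \<noteq> i" for k
    proof (cases "X k = X i")
      case True
      define H where "H = smult L (\<Prod>l\<in>{..<d} - {i} - {k}. [:- X l, 1:])"
      have "(\<Prod>l<d. [:- X l, 1:]) = [:- X i, 1:] * ([:- X k, 1:] * (\<Prod>l\<in>{..<d} - {i} - {k}. [:- X l, 1:]))"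
        using i k by (simp add: prod.remove[of "{..<d}" i] prod.remove[of "{..<d} - {i}" k] del: mult_pCons_left)
      then have "[:- X i, 1:] * ([:- X i, 1:] * H) = restr_poly d p u v"
        unfolding fp H_def True by (simp only: mult_smult_right)
      then have "dir_deriv d p (X i *s u + v) u = 0"
        using pderiv_zero_at_double_root by (metis poly_pderiv_restr_poly)
      then have "a = 0"
        using dir_deriv_point[OF ctx, of 0, unfolded folds] m_pos[OF ctx, unfolded folds] \<sigma>_pos[OF ctx, unfolded folds]
        by (simp add: a_def)
      then show ?thesis using a0 by simp
    next
      case False
      then show ?thesis
        using good_separation[OF ctx2 roots[OF k(1)], unfolded folds, folded \<rho>_def] by simp
    qed
    have "ennreal ((dpt (X i *s u + v) (Y j *s u + v))\<^sup>2) \<le> ennreal (16 * (real d)\<^sup>2 * \<rho>\<^sup>2)"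
      using y(3) j by (intro ennreal_leI) simp
    also have "\<dots> = ennreal (16 * (real d)\<^sup>2) * ennreal (\<rho>\<^sup>2)" by (rule ennreal_mult) auto
    also have "\<dots> \<le> ennreal (16 * (real d)\<^sup>2) * (ennreal 2 * LD)"
      using good_defect[OF ctx2, unfolded folds, folded \<rho>_def] by (intro mult_left_mono) auto
    also have "\<dots> = ennreal (32 * (real d)\<^sup>2) * LD"
      unfolding mult.assoc[symmetric] by (subst ennreal_mult[symmetric]) (auto simp: mult_ac)
    also have "\<dots> \<le> ennreal (32 * (real d + 1)\<^sup>2) * LD"
      by (intro mult_right_mono ennreal_leI mult_left_mono power_mono) auto
    finally have "ennreal ((dpt (X i *s u + v) (Y j *s u + v))\<^sup>2) \<le> ennreal (32 * (real d + 1)\<^sup>2) * LD" .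
    moreover have "chord (X i) (Y j) \<le> 2 * d * \<rho> * \<sigma>" using chord_le y(2) j order_trans by blast
    ultimately show ?thesis using sep j(1) by blast
  qed
qed

text \<open>Exchanging the two vectors reverses the polynomial, giving \<open>x ^ d\<close> times
  its value at \<open>1 / x\<close>, and so inverts the roots. That no root is 0 means that
  \<open>v\<close> is not a zero of the form.\<close>

lemma restr_poly_swap:
  assumes u: "peval d p u \<noteq> 0" and f: "restr_poly d p u v = smult (peval d p u) (\<Prod>i<d. [:- X i, 1:])"
    and X: "\<And>i. i < d \<Longrightarrow> X i \<noteq> 0"
  shows "restr_poly d p v u = smult (peval d p u * (\<Prod>i<d. - X i)) (\<Prod>i<d. [:- (1 / X i), 1:])"
proof (rule poly_ext)
  fix x
  have R: "poly (smult (peval d p u * (\<Prod>i<d. - X i)) (\<Prod>i<d. [:- (1 / X i), 1:])) x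
    = peval d p u * (\<Prod>i<d. 1 - x * X i)"
  proof -
    have "(\<Prod>i<d. - X i) * (\<Prod>i<d. x - 1 / X i) = (\<Prod>i<d. 1 - x * X i)"
      unfolding prod.distrib[symmetric] using X by (intro prod.cong) (auto simp: field_simps)
    then show ?thesis by (simp add: poly_prod mult.assoc)
  qed
  show "poly (restr_poly d p v u) x = poly (smult (peval d p u * (\<Prod>i<d. - X i)) (\<Prod>i<d. [:- (1 / X i), 1:])) x"
  proof (cases "x = 0")
    case True
    then show ?thesis unfolding R by (simp add: poly_restr_poly)
  next
    case False
    have "x *s v + u = x *s ((1 / x) *s u + v)" using False by (simp add: vec_eq_iff field_simps)
    then have "poly (restr_poly d p v u) x = x ^ d * poly (restr_poly d p u v) (1 / x)"
      unfolding poly_restr_poly by (simp only: peval_homogeneous)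
    also have "\<dots> = peval d p u * ((\<Prod>i<d. x) * (\<Prod>i<d. 1 / x - X i))"
      unfolding f by (simp add: poly_prod)
    also have "(\<Prod>i<d. x) * (\<Prod>i<d. 1 / x - X i) = (\<Prod>i<d. 1 - x * X i)"
      unfolding prod.distrib[symmetric] using False by (intro prod.cong) (auto simp: field_simps)
    finally show ?thesis unfolding R .
  qed
qed

text \<open>Distinct good roots have distinct partners: a common partner would put them at chordal
  distance at most \<open>s i + s k\<close>, while \<open>2 * s i\<close> and \<open>2 * s k\<close>
  are both smaller than that distance. As soon as one root is bad, the defect pays for any pairing
  of it.\<close>

lemma matching_exists:
  fixes p q :: "('n::finite \<Rightarrow> nat) \<Rightarrow> complex"
  assumes d1: "1 \<le> d" and R: "coeff_norm d p \<le> R" and \<delta>: "0 < \<delta>" "\<delta> \<le> 1 / 4"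
    and q: "coeff_norm d (\<lambda>a. q a - p a) \<le> \<delta>"
    and gen: "peval d p u \<noteq> 0" "peval d p v \<noteq> 0" "peval d q u \<noteq> 0" "peval d q v \<noteq> 0" "\<And>x. x *s u + v \<noteq> 0"
    and fp: "restr_poly d p u v = smult (peval d p u) (\<Prod>i<d. [:- X i, 1:])"
    and fq: "restr_poly d q u v = smult (peval d q u) (\<Prod>i<d. [:- Y i, 1:])"
  defines "LD \<equiv> line_defect d p (width_const d R) \<delta> u v + line_defect d p (width_const d R) \<delta> v u"
  shows "\<exists>\<sigma>. bij_betw \<sigma> {..<d} {..<d} \<and>
    (\<Sum>i<d. ennreal ((dpt (X i *s u + v) (Y (\<sigma> i) *s u + v))\<^sup>2)) \<le> ennreal (32 * (real d + 1) ^ 3) * LD"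
proof -
  let ?K = "ennreal (32 * (real d + 1)\<^sup>2)"
  let ?c = "\<lambda>i j. ennreal ((dpt (X i *s u + v) (Y j *s u + v))\<^sup>2)"
  have X0: "X i \<noteq> 0" if "i < d" for i
    using gen(2) that arg_cong[OF fp, of "\<lambda>P. poly P 0"] by (auto simp: poly_restr_poly poly_prod)
  have Y0: "Y i \<noteq> 0" if "i < d" for i
    using gen(4) that arg_cong[OF fq, of "\<lambda>P. poly P 0"] by (auto simp: poly_restr_poly poly_prod)
  have u0: "u \<noteq> 0" using gen(1) d1 cmod_peval_le[of d p u] by (auto simp: power_0_left)
  have v0: "v \<noteq> 0" using gen(5)[of 0] by auto
  have z0: "x *s v + u \<noteq> 0" for x
  proof
    assume xv: "x *s v + u = 0"
    then have "x \<noteq> 0" using u0 by auto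
    then have "(1 / x) *s u + v = (1 / x) *s (x *s v + u)" by (simp add: vec_eq_iff field_simps)
    then show False using xv gen(5)[of "1 / x"] by simp
  qed
  define rel where "rel i j s \<longleftrightarrow> j < d \<and> chord (X i) (Y j) \<le> s \<and>
     (\<forall>k<d. k \<noteq> i \<longrightarrow> 2 * s < chord (X i) (X k)) \<and> ?c i j \<le> ?K * LD" for i j s
  have dich: "1 \<le> 2 * LD \<or> (\<exists>j s. rel i j s)" if i: "i < d" for i
  proof (cases "cmod (X i) \<le> 1")
    case True
    let ?L = "line_defect d p (width_const d R) \<delta> u v"
    have fq': "\<exists>j<d. x = Y j" if "peval d q (x *s u + v) = 0" for x
      using that gen(3) unfolding poly_restr_poly[symmetric] fq by (auto simp: poly_prod)
    have le: "?L \<le> LD" by (simp add: LD_def)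
    have "1 \<le> 2 * ?L \<or> (\<exists>j<d. \<exists>s. chord (X i) (Y j) \<le> s \<and> (\<forall>k<d. k \<noteq> i \<longrightarrow> 2 * s < chord (X i) (X k)) \<and> ?c i j \<le> ?K * ?L)"
      using root_dichotomy[OF d1 R \<delta> q u0 gen(5) fp fq' i True] by blast
    moreover have "2 * ?L \<le> 2 * LD" "?K * ?L \<le> ?K * LD" using le by (auto intro: mult_left_mono)
    ultimately show ?thesis unfolding rel_def by (meson order_trans)
  next
    case False
    \<comment> \<open>A root outside the closed unit disc is examined in the exchanged chart, where
      its parameter is \<open>1 / X i\<close>; \<open>chord_inverse\<close> and
      \<open>dpt_scale\<close> carry the result back.\<close>
    let ?L = "line_defect d p (width_const d R) \<delta> v u"
    have fp': "restr_poly d p v u = smult (peval d p u * (\<Prod>i<d. - X i)) (\<Prod>i<d. [:- (1 / X i), 1:])"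
      by (rule restr_poly_swap[OF gen(1) fp X0])
    have fq': "\<exists>j<d. x = 1 / Y j" if "peval d q (x *s v + u) = 0" for x
    proof -
      have "restr_poly d q v u = smult (peval d q u * (\<Prod>i<d. - Y i)) (\<Prod>i<d. [:- (1 / Y i), 1:])"
        by (rule restr_poly_swap[OF gen(3) fq Y0])
      moreover have "peval d q u * (\<Prod>i<d. - Y i) \<noteq> 0" using gen(3) Y0 by auto
      ultimately show ?thesis using that unfolding poly_restr_poly[symmetric] by (auto simp: poly_prod)
    qed
    have i1: "cmod (1 / X i) \<le> 1" using False by (simp add: norm_divide divide_le_eq_1)
    have le: "?L \<le> LD" by (simp add: LD_def)
    have dp: "dpt ((1 / X i) *s v + u) ((1 / Y j) *s v + u) = dpt (X i *s u + v) (Y j *s u + v)" if "j < d" for j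
    proof -
      have e: "(1 / X i) *s v + u = (1 / X i) *s (X i *s u + v)" "(1 / Y j) *s v + u = (1 / Y j) *s (Y j *s u + v)"
        using X0[OF i] Y0[OF that] by (auto simp: vec_eq_iff field_simps)
      show ?thesis unfolding e using X0[OF i] Y0[OF that] by (intro dpt_scale) auto
    qed
    have "1 \<le> 2 * ?L \<or> (\<exists>j<d. \<exists>s. chord (1 / X i) (1 / Y j) \<le> s \<and> (\<forall>k<d. k \<noteq> i \<longrightarrow> 2 * s < chord (1 / X i) (1 / X k)) \<and>
      ennreal ((dpt ((1 / X i) *s v + u) ((1 / Y j) *s v + u))\<^sup>2) \<le> ?K * ?L)"
      using root_dichotomy[OF d1 R \<delta> q v0 z0 fp' fq' i i1] by blast
    then have "1 \<le> 2 * ?L \<or> (\<exists>j<d. \<exists>s. chord (X i) (Y j) \<le> s \<and> (\<forall>k<d. k \<noteq> i \<longrightarrow> 2 * s < chord (X i) (X k)) \<and> ?c i j \<le> ?K * ?L)"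
      using X0 Y0 i dp by (simp add: chord_inverse cong: conj_cong)
    moreover have "2 * ?L \<le> 2 * LD" "?K * ?L \<le> ?K * LD" using le by (auto intro: mult_left_mono)
    ultimately show ?thesis unfolding rel_def by (meson order_trans)
  qed
  define G where "G = {i. i < d \<and> (\<exists>j s. rel i j s)}"
  have "\<forall>i\<in>G. \<exists>j. \<exists>s. rel i j s" by (auto simp: G_def)
  then obtain f where "\<forall>i\<in>G. \<exists>s. rel i (f i) s" by metis
  then obtain s where f: "\<And>i. i \<in> G \<Longrightarrow> rel i (f i) (s i)" by metis
  have "inj_on f G"
  proof (rule inj_onI, rule ccontr)
    fix i k assume ik: "i \<in> G" "k \<in> G" "f i = f k" "i \<noteq> k"
    have "chord (X i) (X k) \<le> chord (X i) (Y (f i)) + chord (Y (f i)) (X k)" by (rule chord_triangle)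
    also have "\<dots> \<le> s i + s k"
      using f[OF ik(1)] f[OF ik(2)] ik(3) by (auto simp: rel_def chord_commute[of "Y _"] intro: add_mono)
    finally have "chord (X i) (X k) \<le> s i + s k" .
    moreover have "2 * s i < chord (X i) (X k)" using f[OF ik(1)] ik by (auto simp: rel_def G_def)
    moreover have "2 * s k < chord (X k) (X i)" using f[OF ik(2)] ik by (auto simp: rel_def G_def)
    ultimately show False using chord_commute[of "X i" "X k"] by simp
  qed
  moreover have "f ` G \<subseteq> {..<d}" using f by (auto simp: rel_def)
  moreover have "G \<subseteq> {..<d}" by (auto simp: G_def)
  ultimately obtain \<sigma> where \<sigma>: "bij_betw \<sigma> {..<d} {..<d}" "\<forall>i\<in>G. \<sigma> i = f i"
    using extend_inj_to_bij[of "{..<d}" G f] by auto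
  have cost: "?c i (\<sigma> i) \<le> ?K * LD" if i: "i < d" for i
  proof (cases "i \<in> G")
    case True
    then show ?thesis using f[OF True] \<sigma>(2) by (simp add: rel_def)
  next
    case False
    then have LD: "1 \<le> 2 * LD" using dich[OF i] i by (auto simp: G_def)
    \<comment> \<open>Projective distances are at most \<open>pi / 2\<close>, hence below 2, so an
      arbitrary partner costs at most 4, that is at most \<open>8 * LD\<close>.\<close>
    have "(dpt (X i *s u + v) (Y (\<sigma> i) *s u + v))\<^sup>2 \<le> 2\<^sup>2"
      using dpt_bounds[of "X i *s u + v" "Y (\<sigma> i) *s u + v"] pi_less_4 by (intro power_mono) auto
    then have "?c i (\<sigma> i) \<le> ennreal (2\<^sup>2)" by (rule ennreal_leI)
    then have "?c i (\<sigma> i) \<le> ennreal 4 * 1" by simp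
    also have "\<dots> \<le> ennreal 4 * (ennreal 2 * LD)" using LD by (intro mult_left_mono) auto
    also have "\<dots> = ennreal 8 * LD" unfolding mult.assoc[symmetric] by (subst ennreal_mult[symmetric]) auto
    also have "\<dots> \<le> ?K * LD"
    proof (intro mult_right_mono ennreal_leI)
      have "1 \<le> (real d + 1)\<^sup>2" by simp
      then show "8 \<le> 32 * (real d + 1)\<^sup>2" by linarith
    qed simp
    finally show ?thesis .
  qed
  have "(\<Sum>i<d. ?c i (\<sigma> i)) \<le> (\<Sum>i<d. ?K * LD)" using cost by (intro sum_mono) auto
  also have "\<dots> = ennreal (real d) * (?K * LD)" by (simp add: ennreal_of_nat_eq_real_of_nat)
  also have "\<dots> \<le> ennreal (real d + 1) * (?K * LD)" by (intro mult_right_mono ennreal_leI) auto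
  also have "\<dots> = ennreal (32 * (real d + 1) ^ 3) * LD"
  proof -
    have e: "32 * (real d + 1) ^ 3 = (real d + 1) * (32 * (real d + 1)\<^sup>2)"
      by (simp add: power2_eq_square power3_eq_cube)
    have "ennreal (32 * (real d + 1) ^ 3) = ennreal (real d + 1) * ?K"
      unfolding e by (rule ennreal_mult) auto
    then show ?thesis by (simp only: mult.assoc)
  qed
  finally show ?thesis using \<sigma>(1) by blast
qed

section \<open>Lipschitz estimate for the intersection measures\<close>

lemma width_const_pos: "0 \<le> R \<Longrightarrow> 0 < width_const d R"
  unfolding width_const_def bad_const_def taylor_const_def
  by (intro add_nonneg_pos mult_nonneg_nonneg add_nonneg_nonneg) auto

lemma W2_mu_le_sqrt:
  fixes p q :: "('n::finite \<Rightarrow> nat) \<Rightarrow> complex"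
  assumes d: "1 \<le> d" and card: "CARD('n) \<ge> 2" and "0 < \<kappa>" "nondeg d \<kappa> p" "nondeg d \<kappa> q" and b: "0 \<le> b"
    and cost: "\<And>u v X Y. peval d p u \<noteq> 0 \<Longrightarrow> peval d p v \<noteq> 0 \<Longrightarrow> peval d q u \<noteq> 0 \<Longrightarrow> peval d q v \<noteq> 0 \<Longrightarrow>
       (\<And>x. x *s u + v \<noteq> 0) \<Longrightarrow>
       restr_poly d p u v = smult (peval d p u) (\<Prod>i<d. [:- X i, 1:]) \<Longrightarrow>
       restr_poly d q u v = smult (peval d q u) (\<Prod>i<d. [:- Y i, 1:]) \<Longrightarrow>
       \<exists>\<sigma>. bij_betw \<sigma> {..<d} {..<d} \<and> (\<Sum>i<d. ennreal ((dpt (X i *s u + v) (Y (\<sigma> i) *s u + v))\<^sup>2)) \<le> B (u, v)"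
    and B: "(\<integral>\<^sup>+w. B w \<partial>gauss) \<le> ennreal b"
  shows "W2 (mu d p) (mu d q) \<le> sqrt b"
proof -
  obtain X where X [measurable]: "\<And>i. X i \<in> borel_measurable borel"
    and rX: "\<And>u v. peval d p u \<noteq> 0 \<Longrightarrow> restr_poly d p u v = smult (peval d p u) (\<Prod>i<d. [:- X i (u, v), 1:])"
    using root_labelling[of d p] by blast
  obtain Y where Y [measurable]: "\<And>i. Y i \<in> borel_measurable borel"
    and rY: "\<And>u v. peval d q u \<noteq> 0 \<Longrightarrow> restr_poly d q u v = smult (peval d q u) (\<Prod>i<d. [:- Y i (u, v), 1:])"
    using root_labelling[of d q] by blast
  note aep = AE_gauss_generic[OF assms(4,3) d card] and aeq = AE_gauss_generic[OF assms(5,3) d card]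
  have "mu d p = distr (labelled_gauss d) borel (\<lambda>x. X (fst x) (snd x) *s fst (snd x) + snd (snd x))"
    using aep by (intro mu_eq_distr X d rX) (auto elim: eventually_mono)
  moreover have "mu d q = distr (labelled_gauss d) borel (\<lambda>x. Y (fst x) (snd x) *s fst (snd x) + snd (snd x))"
    using aeq by (intro mu_eq_distr Y d rY) (auto elim: eventually_mono)
  moreover have "AE w in gauss. \<exists>\<sigma>. bij_betw \<sigma> {..<d} {..<d} \<and>
     (\<Sum>i<d. ennreal ((dpt (X i w *s fst w + snd w) (Y (\<sigma> i) w *s fst w + snd w))\<^sup>2)) \<le> B w"
    using aep aeq
  proof eventually_elim
    case (elim w)
    then show ?case
      using cost[of "fst w" "snd w" "\<lambda>i. X i w" "\<lambda>i. Y i w"] rX[of "fst w" "snd w"] rY[of "fst w" "snd w"] by simp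
  qed
  moreover have "(\<lambda>w. X i w *s fst w + snd w) \<in> borel_measurable borel" "(\<lambda>w. Y i w *s fst w + snd w) \<in> borel_measurable borel" for i
    by measurable
  ultimately show ?thesis
    using W2_le_matching_cost[of "\<lambda>i w. X i w *s fst w + snd w" "\<lambda>i w. Y i w *s fst w + snd w", OF _ _ d b _ B] by simp
qed

text \<open>For \<open>\<delta>\<close> up to \<open>\<delta>0\<close> the expected defect is
  O(\<open>\<delta>\<^sup>2\<close>), and its square root gives the linear bound. For larger
  \<open>\<delta>\<close> the trivial bound on \<open>W2\<close> is already linear, at the price of
  the factor \<open>1 / \<delta>0\<close>.\<close>

proposition W2_mu_lipschitz:
  assumes d: "1 \<le> d" and card: "CARD('n::finite) \<ge> 2" and \<kappa>: "0 < \<kappa>" and R: "0 \<le> R"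
  shows "\<exists>K\<ge>0. \<forall>p q :: ('n \<Rightarrow> nat) \<Rightarrow> complex. nondeg d \<kappa> p \<longrightarrow> nondeg d \<kappa> q \<longrightarrow> coeff_norm d p \<le> R \<longrightarrow>
    W2 (mu d p) (mu d q) \<le> K * coeff_norm d (\<lambda>a. q a - p a)"
proof -
  define C where "C = width_const d R"
  have C: "0 < C" using width_const_pos[OF R] by (simp add: C_def)
  obtain B where B: "0 \<le> B" and BB: "\<And>(c :: ('n \<Rightarrow> nat) \<Rightarrow> complex) \<delta>. nondeg d \<kappa> c \<Longrightarrow> 0 < \<delta> \<Longrightarrow> C * \<delta> \<le> \<kappa> / 2 \<Longrightarrow>
    (\<integral>\<^sup>+w. line_defect d c C \<delta> (fst w) (snd w) + line_defect d c C \<delta> (snd w) (fst w) \<partial>gauss) \<le> ennreal (B * \<delta>\<^sup>2)"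
    using expected_line_defect_le[OF \<kappa> less_imp_le[OF C] d card] by blast
  \<comment> \<open>The value 1/4 is required by the local picture, the other one by the tube
    estimate, which asks for a width of at most \<open>\<kappa> / 2\<close>.\<close>
  define \<delta>0 where "\<delta>0 = min (1 / 4) (\<kappa> / (2 * C))"
  have \<delta>0: "0 < \<delta>0" using \<kappa> C by (simp add: \<delta>0_def)
  define E where "E = 32 * (real d + 1) ^ 3"
  have E: "0 \<le> E" by (simp add: E_def)
  define K where "K = sqrt (E * B) + sqrt (4 * d) / \<delta>0"
  have K: "sqrt (E * B) \<le> K" "sqrt (4 * d) / \<delta>0 \<le> K" "0 \<le> K"
    using B E \<delta>0 by (auto simp: K_def)
  have main: "W2 (mu d p) (mu d q) \<le> K * \<delta>"
    if p: "nondeg d \<kappa> p" "coeff_norm d p \<le> R" and q: "nondeg d \<kappa> q" "coeff_norm d (\<lambda>a. q a - p a) \<le> \<delta>" and \<delta>: "0 < \<delta>"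
    for p q :: "('n \<Rightarrow> nat) \<Rightarrow> complex" and \<delta>
  proof (cases "\<delta> \<le> \<delta>0")
    case True
    then have d4: "\<delta> \<le> 1 / 4" and "\<delta> \<le> \<kappa> / (2 * C)" by (auto simp: \<delta>0_def)
    then have Cd: "C * \<delta> \<le> \<kappa> / 2" using C by (simp add: field_simps)
    let ?B = "\<lambda>w. ennreal E * (line_defect d p C \<delta> (fst w) (snd w) + line_defect d p C \<delta> (snd w) (fst w))"
    have "(\<integral>\<^sup>+w. ?B w \<partial>gauss) = ennreal E * (\<integral>\<^sup>+w. line_defect d p C \<delta> (fst w) (snd w) + line_defect d p C \<delta> (snd w) (fst w) \<partial>gauss)"
      by (rule nn_integral_cmult) measurable
    also have "\<dots> \<le> ennreal E * ennreal (B * \<delta>\<^sup>2)" by (intro mult_left_mono BB p \<delta> Cd) auto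
    also have "\<dots> = ennreal (E * B * \<delta>\<^sup>2)" using E B by (simp add: ennreal_mult[symmetric] mult.assoc)
    finally have "(\<integral>\<^sup>+w. ?B w \<partial>gauss) \<le> ennreal (E * B * \<delta>\<^sup>2)" .
    then have "W2 (mu d p) (mu d q) \<le> sqrt (E * B * \<delta>\<^sup>2)"
      using E B matching_exists[OF d p(2) \<delta> d4 q(2)]
      by (intro W2_mu_le_sqrt[OF d card \<kappa> p(1) q(1), where B = ?B]) (auto simp: E_def C_def)
    also have "\<dots> = sqrt (E * B) * \<delta>" using \<delta> by (simp add: real_sqrt_mult)
    also have "\<dots> \<le> K * \<delta>" using K(1) \<delta> by (intro mult_right_mono) auto
    finally show ?thesis .
  next
    case False
    have "W2 (mu d p) (mu d q) \<le> sqrt (4 * d)"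
    proof (rule W2_mu_le_sqrt[OF d card \<kappa> p(1) q(1), where B = "\<lambda>_. ennreal (4 * d)"])
      show "(\<integral>\<^sup>+(w :: (complex^'n) \<times> (complex^'n)). ennreal (4 * d) \<partial>gauss) \<le> ennreal (4 * d)"
        by (simp add: emeasure_gauss_UNIV)
      fix u v :: "complex^'n" and X Y :: "nat \<Rightarrow> complex"
      have "ennreal ((dpt (X i *s u + v) (Y i *s u + v))\<^sup>2) \<le> ennreal 4" for i
      proof (rule ennreal_leI)
        have "(dpt (X i *s u + v) (Y i *s u + v))\<^sup>2 \<le> 2\<^sup>2"
          using dpt_bounds[of "X i *s u + v" "Y i *s u + v"] pi_less_4 by (intro power_mono) auto
        then show "(dpt (X i *s u + v) (Y i *s u + v))\<^sup>2 \<le> 4" by simp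
      qed
      then have "(\<Sum>i<d. ennreal ((dpt (X i *s u + v) (Y i *s u + v))\<^sup>2)) \<le> (\<Sum>i<d. ennreal 4)" by (rule sum_mono)
      also have "\<dots> = ennreal (\<Sum>i<d. 4)" by (rule sum_ennreal) simp
      finally have "(\<Sum>i<d. ennreal ((dpt (X i *s u + v) (Y i *s u + v))\<^sup>2)) \<le> ennreal (4 * d)" by (simp add: mult.commute)
      then show "\<exists>\<sigma>. bij_betw \<sigma> {..<d} {..<d} \<and> (\<Sum>i<d. ennreal ((dpt (X i *s u + v) (Y (\<sigma> i) *s u + v))\<^sup>2)) \<le> ennreal (4 * d)"
        by (intro exI[of _ id]) auto
    qed simp
    also have "\<dots> \<le> sqrt (4 * d) / \<delta>0 * \<delta>"
      using False \<delta>0 mult_left_mono[of \<delta>0 \<delta> "sqrt (4 * d)"] by (simp add: field_simps)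
    also have "\<dots> \<le> K * \<delta>" using K(2) \<delta> by (intro mult_right_mono) auto
    finally show ?thesis .
  qed
  show ?thesis
  proof (intro exI[of _ K] conjI allI impI K(3))
    fix p q :: "('n \<Rightarrow> nat) \<Rightarrow> complex"
    assume pq: "nondeg d \<kappa> p" "nondeg d \<kappa> q" "coeff_norm d p \<le> R"
    let ?n = "coeff_norm d (\<lambda>a. q a - p a)"
    show "W2 (mu d p) (mu d q) \<le> K * ?n"
    \<comment> \<open>The estimate \<open>main\<close> needs a positive \<open>\<delta>\<close>,
      whereas the coefficient distance may vanish; hence the slack
      \<open>e / (K + 1)\<close>.\<close>
    proof (rule field_le_epsilon)
      fix e :: real assume e: "0 < e"
      have "W2 (mu d p) (mu d q) \<le> K * (?n + e / (K + 1))"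
        using e K(3) by (intro main pq) (auto intro: add_nonneg_pos)
      also have "\<dots> \<le> K * ?n + e"
        using e K(3) by (simp add: distrib_left field_simps)
      finally show "W2 (mu d p) (mu d q) \<le> K * ?n + e" .
    qed
  qed
qed

section \<open>From Lipschitz curves to the inner distance\<close>

lemma W2in_le_of_lipschitz:
  assumes ends: "\<gamma> 0 = p" "\<gamma> 1 = q" and poly: "\<And>t. 0 \<le> t \<Longrightarrow> t \<le> 1 \<Longrightarrow> \<gamma> t \<in> polys d" and M: "0 \<le> M"
    and lip: "\<And>s t. 0 \<le> s \<Longrightarrow> s \<le> 1 \<Longrightarrow> 0 \<le> t \<Longrightarrow> t \<le> 1 \<Longrightarrow> W2 (mu d (\<gamma> s)) (mu d (\<gamma> t)) \<le> M * \<bar>s - t\<bar>"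
  shows "W2in d p q \<le> ennreal M"
proof -
  have "AC2 (\<lambda>t. mu d (\<gamma> t))"
    \<comment> \<open>The constant \<open>M\<close> serves as the density on the unit interval; it
      also bounds the metric speed, so the energy is at most \<open>M\<^sup>2\<close>.\<close>
    unfolding AC2_def
  proof (intro exI[of _ "\<lambda>_. M"] conjI allI impI M)
    fix s t :: real assume st: "0 \<le> s" "s \<le> t" "t \<le> 1"
    then show "W2 (mu d (\<gamma> s)) (mu d (\<gamma> t)) \<le> integral {s..t} (\<lambda>_. M)"
      using lip[of s t] by (simp add: mult.commute)
  qed (auto intro: integrable_const_ivl)
  then have adm: "admissible d p q \<gamma>" using ends poly by (simp add: admissible_def)
  have speed: "speed (\<lambda>s. mu d (\<gamma> s)) t \<le> ereal M" if t: "0 \<le> t" "t \<le> 1" for t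
    unfolding speed_def
  proof (rule Limsup_bounded)
    show "\<forall>\<^sub>F s in at t within {0..1}. ereal (W2 (mu d (\<gamma> s)) (mu d (\<gamma> t)) / \<bar>s - t\<bar>) \<le> ereal M"
      unfolding eventually_at_filter using t lip by (intro always_eventually) (auto simp: pos_divide_le_eq)
  qed
  have "energy d \<gamma> \<le> (\<integral>\<^sup>+t. ennreal (M\<^sup>2) * indicator {0..1::real} t \<partial>lebesgue)"
    unfolding energy_def
  proof (rule nn_integral_mono)
    fix t :: real
    show "indicator {0..1} t * (e2ennreal (speed (\<lambda>s. mu d (\<gamma> s)) t))\<^sup>2 \<le> ennreal (M\<^sup>2) * indicator {0..1} t"
    proof (cases "t \<in> {0..1}")
      case True
      then have "e2ennreal (speed (\<lambda>s. mu d (\<gamma> s)) t) \<le> e2ennreal (ereal M)"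
        by (intro e2ennreal_mono speed) auto
      then have "(e2ennreal (speed (\<lambda>s. mu d (\<gamma> s)) t))\<^sup>2 \<le> (ennreal M)\<^sup>2"
        by (intro power_mono) (auto simp: e2ennreal_ereal)
      then show ?thesis using True M by (simp add: ennreal_power)
    qed simp
  qed
  also have "\<dots> = ennreal (M\<^sup>2)" by (subst nn_integral_cmult_indicator) auto
  finally have en: "energy d \<gamma> \<le> ennreal (M\<^sup>2)" .
  define E where "E = (INF \<gamma>\<in>{\<gamma>. admissible d p q \<gamma>}. energy d \<gamma>)"
  have "E \<le> energy d \<gamma>" unfolding E_def using adm by (intro INF_lower) auto
  then have E: "E \<le> ennreal (M\<^sup>2)" using en by simp
  then have "E \<noteq> \<infinity>" by (auto simp: top_unique)
  moreover have "sqrt (enn2real E) \<le> M"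
    using enn2real_mono[OF E] M by (intro real_le_lsqrt) auto
  ultimately show ?thesis unfolding W2in_def E_def[symmetric] Let_def by (simp add: ennreal_leI)
qed

lemma restr_poly_scale: "restr_poly d (\<lambda>a. k * c a) u v = smult k (restr_poly d c u v)"
  by (rule poly_ext) (simp add: poly_restr_poly peval_scale)

lemma mu_scale:
  assumes "k \<noteq> 0"
  shows "mu d (\<lambda>a. k * c a) = mu d c"
proof -
  have "line_count d (\<lambda>a. k * c a) = line_count d c"
    using assms by (intro ext) (simp add: line_count_def Let_def restr_poly_scale order_smult)
  then show ?thesis by (simp add: mu_def)
qed

section \<open>Paths of nonsingular polynomials\<close>

lemma coeff_norm_minus_commute: "coeff_norm d (\<lambda>a. x a - y a) = coeff_norm d (\<lambda>a. y a - x a)"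
  by (simp add: coeff_norm_def norm_minus_commute)

text \<open>The factor collects one value, which loses at most \<open>\<eta>\<close>, and
  \<open>CARD('n)\<close> partial derivatives, each of which loses at most
  \<open>d * \<eta>\<close>.\<close>

lemma nondeg_perturb:
  fixes p q :: "('n::finite \<Rightarrow> nat) \<Rightarrow> complex"
  assumes "nondeg d \<kappa> p" "coeff_norm d (\<lambda>a. q a - p a) \<le> \<eta>"
  shows "nondeg d (\<kappa> - (1 + real (CARD('n)) * d) * \<eta>) q"
  unfolding nondeg_def
proof (intro allI impI)
  fix z :: "complex^'n" assume z: "norm z = 1"
  let ?n = "coeff_norm d (\<lambda>a. q a - p a)"
  have 1: "cmod (peval d p z) \<le> cmod (peval d q z) + ?n"
    using cmod_peval_le[of d "\<lambda>a. q a - p a" z] norm_triangle_sub[of "peval d p z" "peval d q z"]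
    by (simp add: z peval_diff norm_minus_commute)
  have 2: "cmod (dpeval d i p z) \<le> cmod (dpeval d i q z) + d * ?n" for i
    using cmod_dpeval_le[of d i "\<lambda>a. q a - p a" z] norm_triangle_sub[of "dpeval d i p z" "dpeval d i q z"]
    by (simp add: z dpeval_diff norm_minus_commute)
  have "(\<Sum>i\<in>UNIV. cmod (dpeval d i p z)) \<le> (\<Sum>i\<in>UNIV. cmod (dpeval d i q z)) + CARD('n) * (d * ?n)"
    using sum_mono[of UNIV, OF 2] by (simp add: sum.distrib)
  moreover have "\<kappa> \<le> cmod (peval d p z) + (\<Sum>i\<in>UNIV. cmod (dpeval d i p z))"
    using assms(1) z by (simp add: nondeg_def)
  moreover have "(1 + real (CARD('n)) * d) * ?n \<le> (1 + real (CARD('n)) * d) * \<eta>"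
    using assms(2) by (intro mult_left_mono) auto
  ultimately show "\<kappa> - (1 + real (CARD('n)) * d) * \<eta> \<le> cmod (peval d q z) + (\<Sum>i\<in>UNIV. cmod (dpeval d i q z))"
    using 1 by (simp add: algebra_simps)
qed

lemma nondeg_mono: "nondeg d \<kappa> p \<Longrightarrow> \<kappa>' \<le> \<kappa> \<Longrightarrow> nondeg d \<kappa>' p"
  unfolding nondeg_def by (meson order_trans)

lemma nondeg_nonzero:
  fixes p :: "('n::finite \<Rightarrow> nat) \<Rightarrow> complex"
  assumes "nondeg d \<kappa> p" "0 < \<kappa>"
  shows "p \<noteq> (\<lambda>_. 0)"
proof
  assume p: "p = (\<lambda>_. 0)"
  have "norm (axis undefined 1 :: complex^'n) = 1" by simp
  with assms(1) have "\<kappa> \<le> cmod (peval d p (axis undefined 1)) + (\<Sum>i\<in>UNIV. cmod (dpeval d i p (axis undefined 1)))"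
    unfolding nondeg_def by blast
  then show False using assms(2) by (simp add: p peval_def dpeval_def)
qed

text \<open>The margin is the minimum over the product with the unit sphere; a zero minimum would be
  a singular zero. The index space is arbitrary so that it can be a time interval as well as a set
  of polynomials indexed by itself.\<close>

lemma nondeg_of_compact_family:
  fixes g :: "'t::topological_space \<Rightarrow> ('n::finite \<Rightarrow> nat) \<Rightarrow> complex"
  assumes T: "compact T" and g: "\<And>\<alpha>. continuous_on T (\<lambda>t. g t \<alpha>)" and ns: "\<And>t. t \<in> T \<Longrightarrow> \<not> singular d (g t)"
  shows "\<exists>\<kappa>>0. \<forall>t\<in>T. nondeg d \<kappa> (g t)"
proof (cases "T = {}")
  case False
  let ?S = "sphere (0::complex^'n) 1"
  let ?f = "\<lambda>x::'t \<times> (complex^'n). cmod (peval d (g (fst x)) (snd x)) + (\<Sum>i\<in>UNIV. cmod (dpeval d i (g (fst x)) (snd x)))"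
  have "axis undefined 1 \<in> ?S" by simp
  then have ne: "T \<times> ?S \<noteq> {}" using False by blast
  have comp: "compact (T \<times> ?S)" using T by (intro compact_Times) auto
  have gc: "continuous_on (T \<times> ?S) (\<lambda>x. g (fst x) \<alpha>)" for \<alpha>
    by (rule continuous_on_compose2[OF g]) (auto intro: continuous_intros)
  have "continuous_on (T \<times> ?S) ?f"
    unfolding peval_def dpeval_def by (intro continuous_intros gc)
  from continuous_attains_inf[OF comp ne this]
  obtain x where x: "x \<in> T \<times> ?S" "\<And>y. y \<in> T \<times> ?S \<Longrightarrow> ?f x \<le> ?f y" by blast
  have "0 < ?f x"
  proof (rule ccontr)
    assume "\<not> 0 < ?f x"
    moreover have nn: "0 \<le> (\<Sum>i\<in>UNIV. cmod (dpeval d i (g (fst x)) (snd x)))" by (simp add: sum_nonneg)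
    ultimately have "cmod (peval d (g (fst x)) (snd x)) = 0" "(\<Sum>i\<in>UNIV. cmod (dpeval d i (g (fst x)) (snd x))) = 0"
      using norm_ge_zero[of "peval d (g (fst x)) (snd x)"] by linarith+
    then have "peval d (g (fst x)) (snd x) = 0" "\<forall>i. dpeval d i (g (fst x)) (snd x) = 0"
      by (auto simp: sum_nonneg_eq_0_iff)
    moreover have "snd x \<noteq> 0" using x(1) by auto
    ultimately have "singular d (g (fst x))" unfolding singular_def by blast
    then show False using ns[of "fst x"] x(1) by auto
  qed
  moreover have "nondeg d (?f x) (g t)" if "t \<in> T" for t
    unfolding nondeg_def using x(2)[of "(t, _)"] that by auto
  ultimately show ?thesis by blast
qed (auto intro: exI[of _ 1])

text \<open>Paths with explicit bounds instead of mere connectedness: the constants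
  \<open>\<kappa>\<close>, \<open>R\<close> and \<open>\<Lambda>\<close> can be relaxed, so they
  become uniform over finitely many links, and they determine the bound on
  \<open>W2in\<close>.\<close>

definition linked :: "nat \<Rightarrow> real \<Rightarrow> real \<Rightarrow> real \<Rightarrow> (('n::finite \<Rightarrow> nat) \<Rightarrow> complex) \<Rightarrow> (('n \<Rightarrow> nat) \<Rightarrow> complex) \<Rightarrow> bool" where
  "linked d \<kappa> R \<Lambda> p q \<longleftrightarrow> (\<exists>\<gamma>. \<gamma> 0 = p \<and> \<gamma> 1 = q \<and>
     (\<forall>t::real. 0 \<le> t \<longrightarrow> t \<le> 1 \<longrightarrow> \<gamma> t \<in> polys d \<and> nondeg d \<kappa> (\<gamma> t) \<and> coeff_norm d (\<gamma> t) \<le> R) \<and>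
     (\<forall>s t. 0 \<le> s \<longrightarrow> s \<le> t \<longrightarrow> t \<le> 1 \<longrightarrow> coeff_norm d (\<lambda>a. \<gamma> t a - \<gamma> s a) \<le> \<Lambda> * (t - s)))"

lemma linked_mono:
  assumes "linked d \<kappa> R \<Lambda> p q" "\<kappa>' \<le> \<kappa>" "R \<le> R'" "\<Lambda> \<le> \<Lambda>'"
  shows "linked d \<kappa>' R' \<Lambda>' p q"
proof -
  obtain \<gamma> where \<gamma>: "\<gamma> 0 = p" "\<gamma> 1 = q"
     "\<And>t::real. 0 \<le> t \<Longrightarrow> t \<le> 1 \<Longrightarrow> \<gamma> t \<in> polys d \<and> nondeg d \<kappa> (\<gamma> t) \<and> coeff_norm d (\<gamma> t) \<le> R"
     "\<And>s t. 0 \<le> s \<Longrightarrow> s \<le> t \<Longrightarrow> t \<le> 1 \<Longrightarrow> coeff_norm d (\<lambda>a. \<gamma> t a - \<gamma> s a) \<le> \<Lambda> * (t - s)"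
    using assms(1) unfolding linked_def by metis
  have "coeff_norm d (\<lambda>a. \<gamma> t a - \<gamma> s a) \<le> \<Lambda>' * (t - s)" if "0 \<le> s" "s \<le> t" "t \<le> 1" for s t
    using \<gamma>(4)[OF that] mult_right_mono[OF assms(4), of "t - s"] that by linarith
  moreover have "\<gamma> t \<in> polys d \<and> nondeg d \<kappa>' (\<gamma> t) \<and> coeff_norm d (\<gamma> t) \<le> R'" if "0 \<le> t" "t \<le> 1" for t
    using \<gamma>(3)[OF that] nondeg_mono[OF _ assms(2)] assms(3) by auto
  ultimately show ?thesis unfolding linked_def using \<gamma>(1,2) by blast
qed

lemma linked_sym:
  assumes "linked d \<kappa> R \<Lambda> p q"
  shows "linked d \<kappa> R \<Lambda> q p"
proof -
  obtain \<gamma> where \<gamma>: "\<gamma> 0 = p" "\<gamma> 1 = q"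
     "\<And>t::real. 0 \<le> t \<Longrightarrow> t \<le> 1 \<Longrightarrow> \<gamma> t \<in> polys d \<and> nondeg d \<kappa> (\<gamma> t) \<and> coeff_norm d (\<gamma> t) \<le> R"
     "\<And>s t. 0 \<le> s \<Longrightarrow> s \<le> t \<Longrightarrow> t \<le> 1 \<Longrightarrow> coeff_norm d (\<lambda>a. \<gamma> t a - \<gamma> s a) \<le> \<Lambda> * (t - s)"
    using assms(1) unfolding linked_def by metis
  have "coeff_norm d (\<lambda>a. \<gamma> (1 - t) a - \<gamma> (1 - s) a) \<le> \<Lambda> * (t - s)" if "0 \<le> s" "s \<le> t" "t \<le> 1" for s t
    using \<gamma>(4)[of "1 - t" "1 - s"] that coeff_norm_minus_commute[of d "\<gamma> (1 - t)" "\<gamma> (1 - s)"] by simp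
  then show ?thesis unfolding linked_def
    using \<gamma>(1,2,3) by (intro exI[of _ "\<lambda>t. \<gamma> (1 - t)"]) auto
qed

text \<open>Each half is run at double speed, whence \<open>2 * \<Lambda>\<close>; across the joint
  the two increments add up.\<close>

lemma linked_trans:
  assumes "linked d \<kappa> R \<Lambda> p q" "linked d \<kappa> R \<Lambda> q r" "0 \<le> \<Lambda>"
  shows "linked d \<kappa> R (2 * \<Lambda>) p r"
proof -
  obtain f where f: "f 0 = p" "f 1 = q"
     "\<And>t::real. 0 \<le> t \<Longrightarrow> t \<le> 1 \<Longrightarrow> f t \<in> polys d \<and> nondeg d \<kappa> (f t) \<and> coeff_norm d (f t) \<le> R"
     "\<And>s t. 0 \<le> s \<Longrightarrow> s \<le> t \<Longrightarrow> t \<le> 1 \<Longrightarrow> coeff_norm d (\<lambda>a. f t a - f s a) \<le> \<Lambda> * (t - s)"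
    using assms(1) unfolding linked_def by metis
  obtain g where g: "g 0 = q" "g 1 = r"
     "\<And>t::real. 0 \<le> t \<Longrightarrow> t \<le> 1 \<Longrightarrow> g t \<in> polys d \<and> nondeg d \<kappa> (g t) \<and> coeff_norm d (g t) \<le> R"
     "\<And>s t. 0 \<le> s \<Longrightarrow> s \<le> t \<Longrightarrow> t \<le> 1 \<Longrightarrow> coeff_norm d (\<lambda>a. g t a - g s a) \<le> \<Lambda> * (t - s)"
    using assms(2) unfolding linked_def by metis
  define h where "h t = (if t \<le> 1 / 2 then f (2 * t) else g (2 * t - 1))" for t :: real
  have "coeff_norm d (\<lambda>a. h t a - h s a) \<le> 2 * \<Lambda> * (t - s)" if st: "0 \<le> s" "s \<le> t" "t \<le> 1" for s t
  proof -
    consider "t \<le> 1 / 2" | "s \<le> 1 / 2" "1 / 2 < t" | "1 / 2 < s" using st by linarith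
    then show ?thesis
    proof cases
      case 1
      then show ?thesis using f(4)[of "2 * s" "2 * t"] st by (simp add: h_def algebra_simps)
    next
      case 2
      have "coeff_norm d (\<lambda>a. h t a - h s a) \<le> coeff_norm d (\<lambda>a. g (2 * t - 1) a - g 0 a) + coeff_norm d (\<lambda>a. f 1 a - f (2 * s) a)"
        using coeff_norm_diff_triangle[of d "h t" "h s" q] 2 f(2) g(1) by (simp add: h_def)
      also have "\<dots> \<le> \<Lambda> * (2 * t - 1 - 0) + \<Lambda> * (1 - 2 * s)"
        using 2 st by (intro add_mono f(4) g(4)) auto
      also have "\<dots> = 2 * \<Lambda> * (t - s)" by (simp add: algebra_simps)
      finally show ?thesis .
    next
      case 3
      then show ?thesis using g(4)[of "2 * s - 1" "2 * t - 1"] st by (simp add: h_def algebra_simps)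
    qed
  qed
  moreover have "h t \<in> polys d \<and> nondeg d \<kappa> (h t) \<and> coeff_norm d (h t) \<le> R" if "0 \<le> t" "t \<le> 1" for t
    using f(3)[of "2 * t"] g(3)[of "2 * t - 1"] that by (auto simp: h_def)
  moreover have "h 0 = p" "h 1 = r" using f g by (auto simp: h_def)
  ultimately show ?thesis unfolding linked_def by blast
qed

lemma segment_diff: "((1 - t) * x + t * y) - ((1 - s) * x + s * y) = (t - s) * (y - x)" for x y s t :: complex
  by (simp add: algebra_simps)

lemma linked_segment:
  fixes p q :: "('n::finite \<Rightarrow> nat) \<Rightarrow> complex"
  assumes "p \<in> polys d" "q \<in> polys d" "0 < \<kappa>"
    and nd: "\<And>t. 0 \<le> t \<Longrightarrow> t \<le> 1 \<Longrightarrow> nondeg d \<kappa> (\<lambda>a. (1 - of_real t) * p a + of_real t * q a)"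
    and R: "coeff_norm d p \<le> R" "coeff_norm d q \<le> R"
  shows "linked d \<kappa> R (coeff_norm d (\<lambda>a. q a - p a)) p q"
proof -
  define \<gamma> where "\<gamma> t = (\<lambda>a. (1 - of_real t) * p a + of_real t * q a)" for t :: real
  have "coeff_norm d (\<gamma> t) \<le> R" if t: "0 \<le> t" "t \<le> 1" for t
  proof -
    have "coeff_norm d (\<gamma> t) \<le> cmod (1 - of_real t) * coeff_norm d p + cmod (of_real t) * coeff_norm d q"
      unfolding \<gamma>_def coeff_norm_scale[symmetric] by (rule coeff_norm_triangle)
    also have "cmod (1 - of_real t) = 1 - t"
    proof -
      have "1 - of_real t = (of_real (1 - t) :: complex)" by simp
      then show ?thesis using t by (simp only: norm_of_real abs_of_nonneg diff_ge_0_iff_ge)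
    qed
    also have "(1 - t) * coeff_norm d p + cmod (of_real t) * coeff_norm d q \<le> (1 - t) * R + t * R"
      using t R by (intro add_mono mult_mono) auto
    finally show ?thesis by (simp add: algebra_simps)
  qed
  moreover have "\<gamma> t \<in> polys d" if "0 \<le> t" "t \<le> 1" for t
    using nondeg_nonzero[OF nd[OF that] assms(3)] assms(1,2) by (auto simp: polys_def \<gamma>_def)
  moreover have "coeff_norm d (\<lambda>a. \<gamma> t a - \<gamma> s a) \<le> coeff_norm d (\<lambda>a. q a - p a) * (t - s)" if "0 \<le> s" "s \<le> t" "t \<le> 1" for s t
  proof -
    have "(\<lambda>a. \<gamma> t a - \<gamma> s a) = (\<lambda>a. of_real (t - s) * (q a - p a))"
      unfolding \<gamma>_def segment_diff by simp
    moreover have "cmod (of_real (t - s)) = t - s" using that by (simp only: norm_of_real abs_of_nonneg diff_ge_0_iff_ge)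
    ultimately show ?thesis by (simp only: coeff_norm_scale mult.commute)
  qed
  ultimately show ?thesis unfolding linked_def using nd
    by (intro exI[of _ \<gamma>]) (auto simp: \<gamma>_def)
qed

lemma polys_scale: "k \<noteq> 0 \<Longrightarrow> p \<in> polys d \<Longrightarrow> (\<lambda>a. k * p a) \<in> polys d"
  by (auto simp: polys_def fun_eq_iff)

text \<open>The intermediate points of an admissible curve are only seen through \<open>mu\<close>, which ignores
  scalar factors, so the end points may be rescaled independently.\<close>

lemma W2in_le_linked:
  assumes d: "1 \<le> d" and card: "CARD('n::finite) \<ge> 2" and \<kappa>: "0 < \<kappa>" and R: "0 \<le> R"
  shows "\<exists>K\<ge>0. \<forall>(p :: ('n \<Rightarrow> nat) \<Rightarrow> complex) q \<Lambda> k l. linked d \<kappa> R \<Lambda> p q \<longrightarrow> 0 \<le> \<Lambda> \<longrightarrow> k \<noteq> 0 \<longrightarrow> l \<noteq> 0 \<longrightarrow>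
    W2in d (\<lambda>a. k * p a) (\<lambda>a. l * q a) \<le> ennreal (K * \<Lambda>)"
proof -
  obtain K where K: "0 \<le> K" and KK: "\<And>p q :: ('n \<Rightarrow> nat) \<Rightarrow> complex. nondeg d \<kappa> p \<Longrightarrow> nondeg d \<kappa> q \<Longrightarrow> coeff_norm d p \<le> R \<Longrightarrow>
    W2 (mu d p) (mu d q) \<le> K * coeff_norm d (\<lambda>a. q a - p a)"
    using W2_mu_lipschitz[OF d card \<kappa> R] by blast
  show ?thesis
  proof (intro exI[of _ K] conjI allI impI K)
    fix p q :: "('n \<Rightarrow> nat) \<Rightarrow> complex" and \<Lambda> :: real and k l :: complex
    assume lk: "linked d \<kappa> R \<Lambda> p q" and \<Lambda>: "0 \<le> \<Lambda>" and kl: "k \<noteq> 0" "l \<noteq> 0"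
    obtain \<gamma> where \<gamma>: "\<gamma> 0 = p" "\<gamma> 1 = q"
       "\<And>t::real. 0 \<le> t \<Longrightarrow> t \<le> 1 \<Longrightarrow> \<gamma> t \<in> polys d \<and> nondeg d \<kappa> (\<gamma> t) \<and> coeff_norm d (\<gamma> t) \<le> R"
       "\<And>s t. 0 \<le> s \<Longrightarrow> s \<le> t \<Longrightarrow> t \<le> 1 \<Longrightarrow> coeff_norm d (\<lambda>a. \<gamma> t a - \<gamma> s a) \<le> \<Lambda> * (t - s)"
      using lk unfolding linked_def by metis
    define f where "f t = (if t = 0 then k else if t = 1 then l else 1)" for t :: real
    define g where "g t = (\<lambda>a. f t * \<gamma> t a)" for t
    have f0: "f t \<noteq> 0" for t using kl by (simp add: f_def)
    have mug: "mu d (g t) = mu d (\<gamma> t)" for t unfolding g_def by (rule mu_scale[OF f0])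
    show "W2in d (\<lambda>a. k * p a) (\<lambda>a. l * q a) \<le> ennreal (K * \<Lambda>)"
    proof (rule W2in_le_of_lipschitz[of g])
      show "g 0 = (\<lambda>a. k * p a)" "g 1 = (\<lambda>a. l * q a)" using \<gamma> by (auto simp: g_def f_def)
      show "g t \<in> polys d" if "0 \<le> t" "t \<le> 1" for t
        unfolding g_def using \<gamma>(3)[OF that] by (intro polys_scale f0) auto
      show "0 \<le> K * \<Lambda>" using K \<Lambda> by simp
      fix s t :: real assume st: "0 \<le> s" "s \<le> 1" "0 \<le> t" "t \<le> 1"
      have "coeff_norm d (\<lambda>a. \<gamma> t a - \<gamma> s a) \<le> \<Lambda> * \<bar>s - t\<bar>"
        using \<gamma>(4)[of s t] \<gamma>(4)[of t s] st coeff_norm_minus_commute[of d "\<gamma> t" "\<gamma> s"] by (cases "s \<le> t") auto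
      then have "K * coeff_norm d (\<lambda>a. \<gamma> t a - \<gamma> s a) \<le> K * (\<Lambda> * \<bar>s - t\<bar>)" using K by (rule mult_left_mono)
      then show "W2 (mu d (g s)) (mu d (g t)) \<le> K * \<Lambda> * \<bar>s - t\<bar>"
        unfolding mug using KK[of "\<gamma> s" "\<gamma> t"] \<gamma>(3)[of s] \<gamma>(3)[of t] st by (auto simp: mult.assoc intro: order_trans)
    qed
  qed
qed

section \<open>A finite-dimensional family in which a generic member avoids the discriminant\<close>

definition pmono :: "('n \<Rightarrow> nat) \<Rightarrow> ('n \<Rightarrow> nat) \<Rightarrow> complex" where
  "pmono \<alpha> = (\<lambda>\<beta>. if \<beta> = \<alpha> then 1 else 0)"

definition edge_exp :: "nat \<Rightarrow> 'n \<Rightarrow> 'n \<Rightarrow> 'n \<Rightarrow> nat" where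
  "edge_exp d i j = (\<lambda>l. (if l = i then d - 1 else 0) + (if l = j then 1 else 0))"

text \<open>A linear combination of the forms \<open>x_i ^ (d - 1) * x_j\<close>. At a point whose
  i-th coordinate is 1, such a form has the j-th coordinate as value, and its partial derivatives in
  the directions other than \<open>i\<close> are those of \<open>x_j\<close>. Row \<open>i\<close>
  therefore prescribes the value and these derivatives independently.\<close>

definition pencil :: "nat \<Rightarrow> complex^'n::finite^'n \<Rightarrow> ('n \<Rightarrow> nat) \<Rightarrow> complex" where
  "pencil d b = (\<lambda>\<alpha>. \<Sum>i\<in>UNIV. \<Sum>j\<in>UNIV. b $ i $ j * pmono (edge_exp d i j) \<alpha>)"

lemma edge_exp_mons: "1 \<le> d \<Longrightarrow> edge_exp d i j \<in> mons d"
  by (simp add: mons_def edge_exp_def sum.distrib)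

lemma peval_pmono: "\<alpha> \<in> mons d \<Longrightarrow> peval d (pmono \<alpha>) z = (\<Prod>i\<in>UNIV. (z$i) ^ \<alpha> i)"
  by (simp add: peval_def pmono_def if_distrib[of "\<lambda>x. x * _"] cong: if_cong)

lemma dpeval_pmono: "\<alpha> \<in> mons d \<Longrightarrow> dpeval d l (pmono \<alpha>) z =
    of_nat (\<alpha> l) * (\<Prod>j\<in>UNIV. (z$j) ^ (\<alpha> j - (if j = l then 1 else 0)))"
  by (simp add: dpeval_def pmono_def mult.assoc if_distrib[of "\<lambda>x. x * _"] cong: if_cong)

lemma peval_edge:
  assumes "1 \<le> d" "z $ i = 1"
  shows "peval d (pmono (edge_exp d i j)) z = z $ j"
proof -
  have "(\<Prod>k\<in>UNIV. (z$k) ^ edge_exp d i j k) = (\<Prod>k\<in>UNIV. (if k = j then z $ k else 1))"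
    using assms(2) by (intro prod.cong) (auto simp: edge_exp_def)
  then show ?thesis using assms by (simp add: peval_pmono edge_exp_mons)
qed

lemma dpeval_edge:
  assumes "1 \<le> d" "z $ i = 1" "l \<noteq> i"
  shows "dpeval d l (pmono (edge_exp d i j)) z = (if j = l then 1 else 0)"
proof -
  have "edge_exp d i j l = (if j = l then 1 else 0)" using assms(3) by (auto simp: edge_exp_def)
  moreover have "(\<Prod>k\<in>UNIV. (z$k) ^ (edge_exp d i l k - (if k = l then 1 else 0))) = 1"
    by (rule prod.neutral) (use assms(2,3) in \<open>auto simp: edge_exp_def\<close>)
  ultimately show ?thesis unfolding dpeval_pmono[OF edge_exp_mons[OF assms(1)]] by (cases "j = l") simp_all
qed

lemma peval_pencil: "peval d (pencil d b) z = (\<Sum>i\<in>UNIV. \<Sum>j\<in>UNIV. b $ i $ j * peval d (pmono (edge_exp d i j)) z)"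
proof -
  have "peval d (pencil d b) z = (\<Sum>\<alpha>\<in>mons d. \<Sum>i\<in>UNIV. \<Sum>j\<in>UNIV.
      b $ i $ j * (pmono (edge_exp d i j) \<alpha> * (\<Prod>k\<in>UNIV. (z$k) ^ \<alpha> k)))"
    by (simp add: peval_def pencil_def sum_distrib_right mult.assoc)
  also have "\<dots> = (\<Sum>i\<in>UNIV. \<Sum>j\<in>UNIV. \<Sum>\<alpha>\<in>mons d.
      b $ i $ j * (pmono (edge_exp d i j) \<alpha> * (\<Prod>k\<in>UNIV. (z$k) ^ \<alpha> k)))"
    by (subst sum.swap, rule sum.cong[OF refl], rule sum.swap)
  finally show ?thesis by (simp add: peval_def sum_distrib_left)
qed

lemma dpeval_pencil: "dpeval d l (pencil d b) z = (\<Sum>i\<in>UNIV. \<Sum>j\<in>UNIV. b $ i $ j * dpeval d l (pmono (edge_exp d i j)) z)"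
proof -
  have "dpeval d l (pencil d b) z = (\<Sum>\<alpha>\<in>mons d. \<Sum>i\<in>UNIV. \<Sum>j\<in>UNIV.
      b $ i $ j * (pmono (edge_exp d i j) \<alpha> * of_nat (\<alpha> l) * (\<Prod>k\<in>UNIV. (z$k) ^ (\<alpha> k - (if k = l then 1 else 0)))))"
    by (simp add: dpeval_def pencil_def sum_distrib_right mult.assoc)
  also have "\<dots> = (\<Sum>i\<in>UNIV. \<Sum>j\<in>UNIV. \<Sum>\<alpha>\<in>mons d.
      b $ i $ j * (pmono (edge_exp d i j) \<alpha> * of_nat (\<alpha> l) * (\<Prod>k\<in>UNIV. (z$k) ^ (\<alpha> k - (if k = l then 1 else 0)))))"
    by (subst sum.swap, rule sum.cong[OF refl], rule sum.swap)
  finally show ?thesis by (simp add: dpeval_def sum_distrib_left)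
qed

lemma differentiable_prod:
  fixes f :: "'i \<Rightarrow> 'a::real_normed_vector \<Rightarrow> complex"
  assumes "\<And>i. i \<in> I \<Longrightarrow> f i differentiable (at x within S)"
  shows "(\<lambda>x. \<Prod>i\<in>I. f i x) differentiable (at x within S)"
  using assms
proof (induction I rule: infinite_finite_induct)
  case (insert j I)
  then have "(\<lambda>x. f j x * (\<Prod>i\<in>I. f i x)) differentiable (at x within S)"
    by (intro differentiable_mult) auto
  then show ?case using insert by simp
qed auto

lemma differentiable_vec_lambda:
  fixes G :: "'i::finite \<Rightarrow> 'a::real_normed_vector \<Rightarrow> 'b::euclidean_space"
  assumes "\<And>k. G k differentiable (at x within S)"
  shows "(\<lambda>a. \<chi> k. G k a) differentiable (at x within S)"
  unfolding differentiable_componentwise_within[of "\<lambda>a. \<chi> k. G k a"]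
proof
  fix e :: "'b^'i" assume "e \<in> Basis"
  then obtain k u where e: "e = axis k u" "u \<in> Basis" by (auto simp: Basis_vec_def)
  have "(\<lambda>a. G k a \<bullet> u) differentiable (at x within S)"
    using assms[of k] e(2) unfolding differentiable_componentwise_within[of "G k"] by blast
  then show "(\<lambda>a. (\<chi> k. G k a) \<bullet> e) differentiable (at x within S)"
    unfolding e by (simp add: inner_axis)
qed

lemma differentiable_peval:
  assumes "\<And>j. (\<lambda>a. g a $ j) differentiable (at x within S)"
  shows "(\<lambda>a. peval d c (g a)) differentiable (at x within S)"
  unfolding peval_def
  by (intro differentiable_sum ballI finite_mons differentiable_mult differentiable_const differentiable_prod
      differentiable_power assms)

lemma differentiable_dpeval:
  assumes "\<And>j. (\<lambda>a. g a $ j) differentiable (at x within S)"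
  shows "(\<lambda>a. dpeval d l c (g a)) differentiable (at x within S)"
  unfolding dpeval_def
  by (intro differentiable_sum ballI finite_mons differentiable_mult differentiable_const differentiable_prod
      differentiable_power assms)

text \<open>A pencil \<open>b\<close> for which \<open>(1 - t) p + t b\<close> has a singular point \<open>z\<close> with \<open>z $ i = 1\<close> is
  determined by its rows other than \<open>i\<close>, by \<open>t\<close> and by \<open>z\<close>: row \<open>i\<close> is recovered
  from the equations of the singular point. The matrix \<open>a\<close> below stores \<open>z\<close> and \<open>t\<close> in place of row \<open>i\<close>;
  since \<open>t\<close> is real, such matrices form a null set.\<close>

definition chart_point :: "'n::finite \<Rightarrow> complex^'n^'n \<Rightarrow> complex^'n" where
  "chart_point i a = (\<chi> j. if j = i then 1 else a $ i $ j)"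

definition bad_partial :: "nat \<Rightarrow> (('n::finite \<Rightarrow> nat) \<Rightarrow> complex) \<Rightarrow> 'n \<Rightarrow> complex^'n^'n \<Rightarrow> 'n \<Rightarrow> complex" where
  "bad_partial d p i a l = - ((1 - a $ i $ i) / a $ i $ i * dpeval d l p (chart_point i a) +
     (\<Sum>k\<in>UNIV - {i}. \<Sum>m\<in>UNIV. a $ k $ m * dpeval d l (pmono (edge_exp d k m)) (chart_point i a)))"

text \<open>The value equation at the singular point determines the diagonal entry. The other
  entries of row \<open>i\<close> also contribute to the value; having been found from the
  derivatives first, they are subtracted.\<close>

definition bad_value :: "nat \<Rightarrow> (('n::finite \<Rightarrow> nat) \<Rightarrow> complex) \<Rightarrow> 'n \<Rightarrow> complex^'n^'n \<Rightarrow> complex" where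
  "bad_value d p i a = - ((1 - a $ i $ i) / a $ i $ i * peval d p (chart_point i a) +
     (\<Sum>k\<in>UNIV - {i}. \<Sum>m\<in>UNIV. a $ k $ m * peval d (pmono (edge_exp d k m)) (chart_point i a))) -
     (\<Sum>m\<in>UNIV - {i}. bad_partial d p i a m * chart_point i a $ m)"

definition bad_pencil :: "nat \<Rightarrow> (('n::finite \<Rightarrow> nat) \<Rightarrow> complex) \<Rightarrow> 'n \<Rightarrow> complex^'n^'n \<Rightarrow> complex^'n^'n" where
  "bad_pencil d p i a = (\<chi> k l. if k \<noteq> i then a $ k $ l else if l \<noteq> i then bad_partial d p i a l else bad_value d p i a)"

lemma differentiable_bad_pencil:
  assumes "a $ i $ i \<noteq> 0"
  shows "bad_pencil d p i differentiable (at a within S)"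
proof -
  have nth: "(\<lambda>a::complex^'a^'a. a $ k $ l) differentiable (at a within S)" for k l
  proof -
    have "bounded_linear (\<lambda>a::complex^'a^'a. a $ k $ l)"
      using bounded_linear_compose[OF bounded_linear_vec_nth bounded_linear_vec_nth] .
    then show ?thesis by (rule bounded_linear_imp_differentiable)
  qed
  have cp: "(\<lambda>a. chart_point i a $ j) differentiable (at a within S)" for j
    using nth[of i j] by (cases "j = i") (auto simp: chart_point_def)
  have q: "(\<lambda>a::complex^'a^'a. (1 - a $ i $ i) / a $ i $ i) differentiable (at a within S)"
    using assms nth[of i i] by (intro differentiable_divide differentiable_diff) auto
  have bp: "(\<lambda>a. bad_partial d p i a l) differentiable (at a within S)" for l
    unfolding bad_partial_def
    by (intro differentiable_minus differentiable_add differentiable_mult differentiable_sum ballI q nth differentiable_dpeval cp) auto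
  have bv: "bad_value d p i differentiable (at a within S)"
    unfolding bad_value_def[abs_def]
    by (intro differentiable_diff differentiable_minus differentiable_add differentiable_mult differentiable_sum ballI q nth
        differentiable_peval cp bp) auto
  show ?thesis unfolding bad_pencil_def[abs_def]
  proof (intro differentiable_vec_lambda)
    fix k l
    show "(\<lambda>a. if k \<noteq> i then a $ k $ l else if l \<noteq> i then bad_partial d p i a l else bad_value d p i a) differentiable (at a within S)"
      using nth bp bv by (cases "k = i"; cases "l = i") auto
  qed
qed

text \<open>There is one parametrisation for each coordinate that may be nonzero at the singular
  point, and a differentiable map between spaces of equal dimension carries null sets to null sets.
  The time \<open>t = 0\<close> is left out because there the pencil does not enter the segment and
  its row cannot be solved for.\<close>

lemma negligible_bad_pencils:
  fixes p :: "('n::finite \<Rightarrow> nat) \<Rightarrow> complex"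
  assumes d: "1 \<le> d"
  shows "negligible {b. \<exists>t. 0 < t \<and> t \<le> 1 \<and> singular d (\<lambda>\<alpha>. (1 - of_real t) * p \<alpha> + of_real t * pencil d b \<alpha>)}" (is "negligible ?B")
proof -
  define S where "S i = {a::complex^'n^'n. Im (a $ i $ i) = 0 \<and> a $ i $ i \<noteq> 0}" for i
  have "negligible (bad_pencil d p i ` S i)" for i
  proof (rule negligible_differentiable_image_negligible)
    have "axis i (axis i \<i>) \<noteq> (0 :: complex^'n^'n)" by (simp add: axis_eq_0_iff)
    then have "negligible {a::complex^'n^'n. axis i (axis i \<i>) \<bullet> a = 0}" by (intro negligible_hyperplane) auto
    moreover have "axis i (axis i \<i>) \<bullet> a = Im (a $ i $ i)" for a :: "complex^'n^'n"
      by (simp add: inner_axis' inner_complex_def)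
    ultimately show "negligible (S i)" by (elim negligible_subset) (auto simp: S_def)
    show "bad_pencil d p i differentiable_on S i"
      unfolding differentiable_on_def by (auto simp: S_def intro: differentiable_bad_pencil)
  qed simp
  then have "negligible (\<Union>i. bad_pencil d p i ` S i)"
    by (intro negligible_Union) auto
  moreover have "?B \<subseteq> (\<Union>i. bad_pencil d p i ` S i)"
  proof clarify
    fix b t assume t: "0 < t" "t \<le> 1" and sing: "singular d (\<lambda>\<alpha>. (1 - of_real t) * p \<alpha> + of_real t * pencil d b \<alpha>)"
    define s where "s = complex_of_real t"
    have s: "s \<noteq> 0" "Im s = 0" using t by (auto simp: s_def)
    obtain z' :: "complex^'n" where z': "z' \<noteq> 0" "peval d (\<lambda>\<alpha>. (1 - s) * p \<alpha> + s * pencil d b \<alpha>) z' = 0"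
      "\<And>l. dpeval d l (\<lambda>\<alpha>. (1 - s) * p \<alpha> + s * pencil d b \<alpha>) z' = 0"
      using sing unfolding singular_def s_def by blast
    obtain i where i: "z' $ i \<noteq> 0" using z'(1) by (auto simp: vec_eq_iff)
    define z where "z = inverse (z' $ i) *s z'"
    have zi: "z $ i = 1" using i by (simp add: z_def)
    have val: "(1 - s) * peval d p z + s * peval d (pencil d b) z = 0"
    proof -
      have "(1 - s) * peval d p z' + s * peval d (pencil d b) z' = 0"
        using z'(2) by (simp only: peval_add peval_scale)
      then have "inverse (z' $ i) ^ d * ((1 - s) * peval d p z' + s * peval d (pencil d b) z') = 0" by simp
      then show ?thesis unfolding z_def peval_homogeneous by (simp add: algebra_simps)
    qed
    have der: "(1 - s) * dpeval d l p z + s * dpeval d l (pencil d b) z = 0" for l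
    proof -
      have "(1 - s) * dpeval d l p z' + s * dpeval d l (pencil d b) z' = 0"
        using z'(3)[of l] by (simp only: dpeval_add dpeval_scale)
      then have "inverse (z' $ i) ^ (d - 1) * ((1 - s) * dpeval d l p z' + s * dpeval d l (pencil d b) z') = 0" by simp
      then show ?thesis unfolding z_def dpeval_homogeneous by (simp add: algebra_simps)
    qed
    have solve: "y = - ((1 - s) / s * x)" if "(1 - s) * x + s * y = 0" for x y
      using that s(1) by (simp add: field_simps)
    define a where "a = (\<chi> k l. if k \<noteq> i then b $ k $ l else if l \<noteq> i then z $ l else s)"
    have aii: "a $ i $ i = s" and ak: "\<And>k l. k \<noteq> i \<Longrightarrow> a $ k $ l = b $ k $ l" by (auto simp: a_def)
    have cp: "chart_point i a = z" using zi by (auto simp: chart_point_def a_def vec_eq_iff)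
    have bp: "bad_partial d p i a l = b $ i $ l" if l: "l \<noteq> i" for l
    proof -
      have "dpeval d l (pencil d b) z = (\<Sum>m\<in>UNIV. b $ i $ m * dpeval d l (pmono (edge_exp d i m)) z) +
         (\<Sum>k\<in>UNIV - {i}. \<Sum>m\<in>UNIV. b $ k $ m * dpeval d l (pmono (edge_exp d k m)) z)"
        unfolding dpeval_pencil by (rule sum.remove) auto
      also have "(\<Sum>m\<in>UNIV. b $ i $ m * dpeval d l (pmono (edge_exp d i m)) z) = b $ i $ l"
        unfolding dpeval_edge[where d=d and z=z and i=i and l=l, OF d zi l] by (simp add: if_distrib cong: if_cong)
      finally show ?thesis using solve[OF der[of l]] by (simp add: bad_partial_def cp aii ak)
    qed
    have bv: "bad_value d p i a = b $ i $ i"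
    proof -
      have "peval d (pencil d b) z = (\<Sum>m\<in>UNIV. b $ i $ m * peval d (pmono (edge_exp d i m)) z) +
         (\<Sum>k\<in>UNIV - {i}. \<Sum>m\<in>UNIV. b $ k $ m * peval d (pmono (edge_exp d k m)) z)"
        unfolding peval_pencil by (rule sum.remove) auto
      also have "(\<Sum>m\<in>UNIV. b $ i $ m * peval d (pmono (edge_exp d i m)) z) = b $ i $ i + (\<Sum>m\<in>UNIV - {i}. b $ i $ m * z $ m)"
        unfolding peval_edge[where d=d and z=z and i=i, OF d zi] using zi by (subst sum.remove[of _ i]) auto
      finally show ?thesis using solve[OF val] bp by (simp add: bad_value_def cp aii ak)
    qed
    have "b = bad_pencil d p i a"
      using bp bv by (auto simp: bad_pencil_def vec_eq_iff ak)
    moreover have "a \<in> S i" using s aii by (simp add: S_def)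
    ultimately show "b \<in> (\<Union>i. bad_pencil d p i ` S i)" by blast
  qed
  ultimately show ?thesis by (rule negligible_subset)
qed

lemma nonsingular_nondeg_segment:
  fixes p q :: "('n::finite \<Rightarrow> nat) \<Rightarrow> complex"
  assumes "\<And>t. 0 \<le> t \<Longrightarrow> t \<le> 1 \<Longrightarrow> \<not> singular d (\<lambda>a. (1 - of_real t) * p a + of_real t * q a)"
  shows "\<exists>\<kappa>>0. \<forall>t. 0 \<le> t \<longrightarrow> t \<le> 1 \<longrightarrow> nondeg d \<kappa> (\<lambda>a. (1 - of_real t) * p a + of_real t * q a)"
proof -
  have "continuous_on {0..1} (\<lambda>t. (1 - of_real t) * p \<alpha> + of_real t * q \<alpha>)" for \<alpha>
    by (intro continuous_intros)
  then show ?thesis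
    using nondeg_of_compact_family[of "{0..1::real}" "\<lambda>t a. (1 - of_real t) * p a + of_real t * q a" d] assms by auto
qed

text \<open>Two null sets do not fill the space, so one pencil can be reached from both ends by
  segments of nonsingular polynomials. Compactness of the time interval then gives each segment a
  positive \<open>\<kappa>\<close>.\<close>

lemma nonsingular_linked:
  fixes p q :: "('n::finite \<Rightarrow> nat) \<Rightarrow> complex"
  assumes d: "1 \<le> d" and p: "p \<in> polys d" "\<not> singular d p" and q: "q \<in> polys d" "\<not> singular d q"
  shows "\<exists>\<kappa>>0. \<exists>R\<ge>0. \<exists>\<Lambda>\<ge>0. linked d \<kappa> R \<Lambda> p q"
proof -
  define B where "B p = {b. \<exists>t. 0 < t \<and> t \<le> 1 \<and> singular d (\<lambda>\<alpha>. (1 - of_real t) * p \<alpha> + of_real t * pencil d b \<alpha>)}"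
    for p :: "('n \<Rightarrow> nat) \<Rightarrow> complex"
  have "negligible (B p \<union> B q)"
    unfolding B_def by (intro negligible_Un negligible_bad_pencils d)
  then have "B p \<union> B q \<noteq> UNIV" by (metis non_negligible_UNIV)
  then obtain b where b: "b \<notin> B p" "b \<notin> B q" by auto
  define r where "r = pencil d b"
  \<comment> \<open>At \<open>t = 0\<close> the segment is at the given polynomial;
    \<open>t = 1\<close> is covered by \<open>B\<close>, so that \<open>r\<close> is nonsingular
    too.\<close>
  have seg: "\<not> singular d (\<lambda>a. (1 - of_real t) * x a + of_real t * r a)"
    if "b \<notin> B x" "\<not> singular d x" "0 \<le> t" "t \<le> 1" for x t
    using that by (cases "t = 0") (auto simp: B_def r_def)
  obtain \<kappa>1 where k1: "0 < \<kappa>1" "\<And>t. 0 \<le> t \<Longrightarrow> t \<le> 1 \<Longrightarrow> nondeg d \<kappa>1 (\<lambda>a. (1 - of_real t) * p a + of_real t * r a)"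
    using nonsingular_nondeg_segment[of d p r] seg[OF b(1) p(2)] by blast
  obtain \<kappa>2 where k2: "0 < \<kappa>2" "\<And>t. 0 \<le> t \<Longrightarrow> t \<le> 1 \<Longrightarrow> nondeg d \<kappa>2 (\<lambda>a. (1 - of_real t) * q a + of_real t * r a)"
    using nonsingular_nondeg_segment[of d q r] seg[OF b(2) q(2)] by blast
  have r: "r \<in> polys d"
  proof -
    have "r \<noteq> (\<lambda>_. 0)" using nondeg_nonzero[OF k1(2)[of 1] k1(1)] by simp
    moreover have "r \<alpha> = 0" if "\<alpha> \<notin> mons d" for \<alpha>
      using that edge_exp_mons[OF d] unfolding r_def pencil_def pmono_def by (intro sum.neutral ballI) auto
    ultimately show ?thesis by (simp add: polys_def)
  qed
  define \<kappa> where "\<kappa> = min \<kappa>1 \<kappa>2"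
  define R where "R = coeff_norm d p + coeff_norm d q + coeff_norm d r"
  define \<Lambda> where "\<Lambda> = coeff_norm d (\<lambda>a. r a - p a) + coeff_norm d (\<lambda>a. r a - q a)"
  have \<kappa>: "0 < \<kappa>" "\<kappa> \<le> \<kappa>1" "\<kappa> \<le> \<kappa>2" using k1 k2 by (auto simp: \<kappa>_def)
  have R: "coeff_norm d p \<le> R" "coeff_norm d q \<le> R" "coeff_norm d r \<le> R" "0 \<le> R" by (auto simp: R_def)
  have \<Lambda>: "0 \<le> \<Lambda>" by (simp add: \<Lambda>_def)
  have "linked d \<kappa> R \<Lambda> p r"
    by (rule linked_mono[OF linked_segment[OF p(1) r k1(1) k1(2) R(1,3)]]) (use \<kappa> in \<open>auto simp: \<Lambda>_def\<close>)
  moreover have "linked d \<kappa> R \<Lambda> q r"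
    by (rule linked_mono[OF linked_segment[OF q(1) r k2(1) k2(2) R(2,3)]]) (use \<kappa> in \<open>auto simp: \<Lambda>_def\<close>)
  ultimately have "linked d \<kappa> R (2 * \<Lambda>) p q"
    using linked_trans[OF _ linked_sym \<Lambda>] by blast
  then show ?thesis using \<kappa>(1) R(4) \<Lambda> by (metis mult_nonneg_nonneg zero_le_numeral)
qed

section \<open>The Bombieri-Weyl norm and compactness\<close>

definition bw_weight :: "nat \<Rightarrow> ('n::finite \<Rightarrow> nat) \<Rightarrow> real" where
  "bw_weight d \<alpha> = (\<Prod>i\<in>UNIV. fact (\<alpha> i)) / fact d"

lemma bw_weight_pos: "0 < bw_weight d \<alpha>"
  unfolding bw_weight_def by (intro divide_pos_pos prod_pos) auto

lemma bw_inner_eq: "bw_inner d c c' = (\<Sum>\<alpha>\<in>mons d. c \<alpha> * cnj (c' \<alpha>) * complex_of_real (bw_weight d \<alpha>))"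
  unfolding bw_inner_def bw_weight_def by simp

lemma bw_inner_self: "bw_inner d c c = of_real (\<Sum>\<alpha>\<in>mons d. (cmod (c \<alpha>))\<^sup>2 * bw_weight d \<alpha>)"
  unfolding bw_inner_eq complex_norm_square[symmetric] of_real_sum by simp

lemma bw_norm_sq: "(bw_norm d c)\<^sup>2 = (\<Sum>\<alpha>\<in>mons d. (cmod (c \<alpha>))\<^sup>2 * bw_weight d \<alpha>)"
proof -
  have "0 \<le> (\<Sum>\<alpha>\<in>mons d. (cmod (c \<alpha>))\<^sup>2 * bw_weight d \<alpha>)"
    by (intro sum_nonneg mult_nonneg_nonneg less_imp_le[OF bw_weight_pos]) auto
  then show ?thesis unfolding bw_norm_def bw_inner_self by simp
qed

lemma bw_norm_nonneg: "0 \<le> bw_norm d c"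
  unfolding bw_norm_def bw_inner_self
  by (auto intro!: sum_nonneg mult_nonneg_nonneg less_imp_le[OF bw_weight_pos])

lemma bw_norm_pos:
  assumes "c \<in> polys d"
  shows "0 < bw_norm d c"
proof -
  obtain \<alpha> where \<alpha>: "\<alpha> \<in> mons d" "c \<alpha> \<noteq> 0" using assms by (auto simp: polys_def fun_eq_iff)
  have "0 < (\<Sum>\<alpha>\<in>mons d. (cmod (c \<alpha>))\<^sup>2 * bw_weight d \<alpha>)"
    by (rule sum_pos2[OF finite_mons \<alpha>(1)])
       (use \<alpha>(2) bw_weight_pos less_imp_le[OF bw_weight_pos] in \<open>auto intro!: mult_pos_pos mult_nonneg_nonneg\<close>)
  then have "bw_norm d c \<noteq> 0" using bw_norm_sq[of d c] by auto
  then show ?thesis using bw_norm_nonneg[of d c] by simp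
qed

lemma bw_inner_scale: "bw_inner d (\<lambda>a. k * c a) (\<lambda>a. l * c' a) = k * cnj l * bw_inner d c c'"
  unfolding bw_inner_eq sum_distrib_left by (intro sum.cong) auto

lemma bw_norm_scale: "bw_norm d (\<lambda>a. k * c a) = cmod k * bw_norm d c"
proof -
  have "(bw_norm d (\<lambda>a. k * c a))\<^sup>2 = (cmod k * bw_norm d c)\<^sup>2"
    unfolding power_mult_distrib bw_norm_sq sum_distrib_left
    by (intro sum.cong) (auto simp: norm_mult power_mult_distrib)
  then show ?thesis by (rule power2_eq_imp_eq) (auto simp: bw_norm_nonneg)
qed

lemma dFS_scale:
  assumes "k \<noteq> 0" "l \<noteq> 0"
  shows "dFS d (\<lambda>a. k * c a) (\<lambda>a. l * c' a) = dFS d c c'"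
  using assms by (simp add: dFS_def bw_inner_scale bw_norm_scale norm_mult)

lemma dFS_self:
  assumes "c \<in> polys d"
  shows "dFS d c c = 0"
proof -
  have "cmod (bw_inner d c c) = (bw_norm d c)\<^sup>2"
    unfolding bw_inner_self bw_norm_sq[symmetric] norm_of_real by simp
  then show ?thesis using bw_norm_pos[OF assms] by (simp add: dFS_def power2_eq_square)
qed

lemma dFS_nonneg: "0 \<le> dFS d c c'"
proof -
  let ?x = "cmod (bw_inner d c c') / (bw_norm d c * bw_norm d c')"
  have "0 \<le> ?x" by (simp add: bw_norm_nonneg)
  then have "-1 \<le> min 1 ?x" by simp
  then show ?thesis unfolding dFS_def by (intro arccos_lbound) auto
qed

definition bw_const :: "nat \<Rightarrow> 'n::finite itself \<Rightarrow> real" where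
  "bw_const d T = (\<Sum>\<alpha>\<in>(mons d :: ('n \<Rightarrow> nat) set). 1 / sqrt (bw_weight d \<alpha>))"

lemma bw_const_nonneg: "0 \<le> bw_const d T"
  unfolding bw_const_def by (intro sum_nonneg) (auto simp: less_imp_le[OF bw_weight_pos])

lemma cmod_coeff_le_bw_norm:
  assumes "\<alpha> \<in> mons d"
  shows "cmod (c \<alpha>) \<le> 1 / sqrt (bw_weight d \<alpha>) * bw_norm d c"
proof -
  have "(cmod (c \<alpha>))\<^sup>2 * bw_weight d \<alpha> \<le> (bw_norm d c)\<^sup>2"
    unfolding bw_norm_sq
    using assms by (intro member_le_sum) (auto intro!: mult_nonneg_nonneg less_imp_le[OF bw_weight_pos])
  then have "sqrt ((cmod (c \<alpha>))\<^sup>2 * bw_weight d \<alpha>) \<le> bw_norm d c"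
    by (intro real_le_lsqrt bw_norm_nonneg) auto
  then show ?thesis using bw_weight_pos[of d \<alpha>] by (simp add: real_sqrt_mult field_simps)
qed

lemma coeff_norm_le_bw_norm:
  fixes c :: "('n::finite \<Rightarrow> nat) \<Rightarrow> complex"
  shows "coeff_norm d c \<le> bw_const d TYPE('n) * bw_norm d c"
  unfolding coeff_norm_def bw_const_def sum_distrib_right
  by (intro sum_mono cmod_coeff_le_bw_norm)

text \<open>For unit vectors and the best phase the squared distance is
  \<open>2 - 2 * cos \<theta>\<close> or less, which equals
  \<open>(2 * sin (\<theta> / 2))\<^sup>2\<close>: the chord is no longer than the arc.\<close>

lemma phase_alignment:
  assumes "bw_norm d p = 1" "bw_norm d q = 1"
  shows "\<exists>k. cmod k = 1 \<and> bw_norm d (\<lambda>a. k * q a - p a) \<le> dFS d p q"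
proof -
  define h where "h = bw_inner d p q"
  \<comment> \<open>The phase of the inner product, which makes \<open>cnj k * h\<close> real and
    nonnegative; for \<open>h = 0\<close> every phase is as good.\<close>
  define k where "k = (if h = 0 then 1 else h / of_real (cmod h))"
  have k: "cmod k = 1" "k * of_real (cmod h) = h" by (auto simp: k_def norm_divide)
  have kh: "Re (cnj k * h) = cmod h"
  proof -
    have "cnj k * h = (cnj k * k) * of_real (cmod h)" using k(2) by (simp add: mult.assoc)
    also have "cnj k * k = 1" using k(1) complex_norm_square[of k] by (simp add: mult.commute)
    finally show ?thesis by simp
  qed
  have sq: "(cmod (a - b))\<^sup>2 = (cmod a)\<^sup>2 + (cmod b)\<^sup>2 - 2 * Re (b * cnj a)" for a b
    unfolding cmod_power2 by (simp add: power2_eq_square algebra_simps)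
  have "(bw_norm d (\<lambda>a. k * q a - p a))\<^sup>2 =
    (\<Sum>\<alpha>\<in>mons d. (cmod (q \<alpha>))\<^sup>2 * bw_weight d \<alpha>) + (\<Sum>\<alpha>\<in>mons d. (cmod (p \<alpha>))\<^sup>2 * bw_weight d \<alpha>)
     - 2 * (\<Sum>\<alpha>\<in>mons d. Re (p \<alpha> * cnj (k * q \<alpha>)) * bw_weight d \<alpha>)"
    unfolding bw_norm_sq sq sum_distrib_left sum.distrib[symmetric] sum_subtractf[symmetric]
    using k(1) by (intro sum.cong) (auto simp: norm_mult algebra_simps)
  also have "(\<Sum>\<alpha>\<in>mons d. Re (p \<alpha> * cnj (k * q \<alpha>)) * bw_weight d \<alpha>) = Re (cnj k * h)"
    unfolding h_def bw_inner_eq sum_distrib_left Re_sum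
    by (intro sum.cong) (auto simp: algebra_simps)
  finally have n: "(bw_norm d (\<lambda>a. k * q a - p a))\<^sup>2 = 2 - 2 * cmod h"
    using assms unfolding bw_norm_sq[symmetric] kh by simp
  define \<theta> where "\<theta> = dFS d p q"
  have "\<theta> = arccos (min 1 (cmod h))" using assms by (simp add: \<theta>_def dFS_def h_def)
  moreover have "-1 \<le> min 1 (cmod h)" using norm_ge_zero[of h] by linarith
  ultimately have "cos \<theta> = min 1 (cmod h)" by simp
  then have "2 - 2 * cmod h \<le> 2 - 2 * cos \<theta>" by simp
  also have "\<dots> = (2 * sin (\<theta> / 2))\<^sup>2"
    using cos_double_sin[of "\<theta> / 2"] by (simp add: power_mult_distrib)
  also have "\<dots> \<le> \<theta>\<^sup>2"
  proof -
    have "\<bar>sin (\<theta> / 2)\<bar> \<le> \<bar>\<theta> / 2\<bar>" by (rule abs_sin_x_le_abs_x)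
    then have "\<bar>2 * sin (\<theta> / 2)\<bar> \<le> \<bar>\<theta>\<bar>" by simp
    then show ?thesis by (simp add: abs_le_square_iff)
  qed
  finally have "bw_norm d (\<lambda>a. k * q a - p a) \<le> \<theta>"
    unfolding n[symmetric] by (rule power2_le_imp_le) (simp add: \<theta>_def dFS_nonneg)
  then show ?thesis using k(1) by (auto simp: \<theta>_def)
qed

section \<open>The set \<open>Peps\<close> and its unit representatives\<close>

lemma Peps_polys: "p \<in> Peps d \<epsilon> \<Longrightarrow> p \<in> polys d"
  by (simp add: Peps_def)

lemma Peps_iff: "p \<in> Peps d \<epsilon> \<longleftrightarrow> p \<in> polys d \<and> (\<forall>q\<in>discr d. \<epsilon> \<le> dFS d p q)"
  by (simp add: Peps_def dist_discr_def le_INF_iff)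

lemma Peps_nonsingular:
  assumes "p \<in> Peps d \<epsilon>" "0 < \<epsilon>"
  shows "\<not> singular d p"
  using assms dFS_self[of p d] by (auto simp: Peps_iff discr_def)

lemma Peps_scale:
  assumes "p \<in> Peps d \<epsilon>" "k \<noteq> 0"
  shows "(\<lambda>a. k * p a) \<in> Peps d \<epsilon>"
  using assms polys_scale[OF assms(2)] dFS_scale[OF assms(2), of 1 d p] by (auto simp: Peps_iff)

definition unit_Peps :: "nat \<Rightarrow> real \<Rightarrow> (('n::finite \<Rightarrow> nat) \<Rightarrow> complex) set" where
  "unit_Peps d \<epsilon> = {p \<in> Peps d \<epsilon>. bw_norm d p = 1}"

lemma unit_Peps_normalize:
  assumes "p \<in> Peps d \<epsilon>"
  shows "(\<lambda>a. of_real (1 / bw_norm d p) * p a) \<in> unit_Peps d \<epsilon>"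
proof -
  have n: "0 < bw_norm d p" by (rule bw_norm_pos[OF Peps_polys[OF assms]])
  have "bw_norm d (\<lambda>a. of_real (1 / bw_norm d p) * p a) = 1"
    unfolding bw_norm_scale norm_of_real using n by simp
  moreover have "(\<lambda>a. of_real (1 / bw_norm d p) * p a) \<in> Peps d \<epsilon>"
    using n by (intro Peps_scale[OF assms]) simp
  ultimately show ?thesis unfolding unit_Peps_def by blast
qed

lemma continuous_on_bw_inner: "continuous_on S (\<lambda>p. bw_inner d p q)"
  unfolding bw_inner_def
  by (intro continuous_intros continuous_on_subset[OF continuous_on_product_coordinates]) auto

lemma continuous_on_bw_norm: "continuous_on S (bw_norm d)"
  unfolding bw_norm_def bw_inner_def
  by (intro continuous_intros continuous_on_subset[OF continuous_on_product_coordinates]) auto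

text \<open>The truncation at -1 changes nothing, but it keeps the argument of \<open>arccos\<close>
  in its domain for every \<open>p\<close>, so that the right-hand side is continuous on the whole
  function space.\<close>

lemma dFS_unit:
  assumes "bw_norm d p = 1"
  shows "dFS d p q = arccos (max (-1) (min 1 (cmod (bw_inner d p q) / bw_norm d q)))"
proof -
  have "0 \<le> cmod (bw_inner d p q) / bw_norm d q" by (simp add: bw_norm_nonneg)
  then have "-1 \<le> min 1 (cmod (bw_inner d p q) / bw_norm d q)" by simp
  then show ?thesis using assms by (simp add: dFS_def max_absorb2)
qed

lemma continuous_on_dFS_formula:
  "continuous_on S (\<lambda>p. arccos (max (-1) (min 1 (cmod (bw_inner d p q) / bw_norm d q))))"
proof (cases "bw_norm d q = 0")
  case False
  then show ?thesis by (intro continuous_intros continuous_on_bw_inner) auto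
qed simp

text \<open>Tychonoff in the space of all coefficient functions: coordinates in
  \<open>mons d\<close> are bounded through the unit norm, all others are pinned to 0. Unit norm and
  distance at least \<open>\<epsilon>\<close> from each element of \<open>discr d\<close> are closed
  conditions.\<close>

lemma compact_unit_Peps: "compact (unit_Peps d \<epsilon> :: (('n::finite \<Rightarrow> nat) \<Rightarrow> complex) set)"
proof -
  define B where "B \<alpha> = (if \<alpha> \<in> mons d then cball 0 (1 / sqrt (bw_weight d \<alpha>)) else {0::complex})" for \<alpha> :: "'n \<Rightarrow> nat"
  have "compactin (product_topology (\<lambda>_. euclidean) UNIV) (PiE UNIV B)"
    unfolding compactin_PiE by (auto simp: B_def)
  then have comp: "compact (PiE UNIV B)" by (simp add: euclidean_product_topology)
  define F where "F q = {p :: ('n \<Rightarrow> nat) \<Rightarrow> complex. \<epsilon> \<le> arccos (max (-1) (min 1 (cmod (bw_inner d p q) / bw_norm d q)))}" for q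
  have "closed (F q)" for q
    unfolding F_def by (intro closed_Collect_le continuous_on_const continuous_on_dFS_formula)
  then have "closed ({p. bw_norm d p = 1} \<inter> (\<Inter>q\<in>discr d. F q))"
    by (intro closed_Int closed_INT ballI closed_Collect_eq continuous_on_bw_norm continuous_on_const)
  with comp have "compact (PiE UNIV B \<inter> ({p. bw_norm d p = 1} \<inter> (\<Inter>q\<in>discr d. F q)))"
    by (rule compact_Int_closed)
  moreover have "PiE UNIV B \<inter> ({p. bw_norm d p = 1} \<inter> (\<Inter>q\<in>discr d. F q)) = unit_Peps d \<epsilon>"
  proof (intro set_eqI iffI)
    fix p assume p: "p \<in> PiE UNIV B \<inter> ({p. bw_norm d p = 1} \<inter> (\<Inter>q\<in>discr d. F q))"
    then have n: "bw_norm d p = 1" by simp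
    have "p \<alpha> = 0" if "\<alpha> \<notin> mons d" for \<alpha>
    proof -
      have "p \<alpha> \<in> B \<alpha>" using p by (auto simp: PiE_def Pi_def)
      then show ?thesis using that by (simp add: B_def)
    qed
    moreover have "p \<noteq> (\<lambda>_. 0)" using n by (auto simp: bw_norm_def bw_inner_def)
    ultimately have "p \<in> polys d" by (simp add: polys_def)
    then show "p \<in> unit_Peps d \<epsilon>" using p n dFS_unit[OF n] by (auto simp: unit_Peps_def Peps_iff F_def)
  next
    fix p :: "('n \<Rightarrow> nat) \<Rightarrow> complex" assume p: "p \<in> unit_Peps d \<epsilon>"
    then have n: "bw_norm d p = 1" and pp: "p \<in> polys d" and "\<forall>q\<in>discr d. \<epsilon> \<le> dFS d p q"
      by (auto simp: unit_Peps_def Peps_iff)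
    moreover have "p \<alpha> \<in> B \<alpha>" for \<alpha>
      using cmod_coeff_le_bw_norm[of \<alpha> d p] n pp by (auto simp: B_def polys_def)
    ultimately show "p \<in> PiE UNIV B \<inter> ({p. bw_norm d p = 1} \<inter> (\<Inter>q\<in>discr d. F q))"
      using dFS_unit[OF n] by (auto simp: F_def)
  qed
  ultimately show ?thesis by simp
qed

section \<open>Uniform constants and the final estimate\<close>

lemma linked_finite_uniform:
  assumes "finite F" "\<And>c. c \<in> F \<Longrightarrow> \<exists>\<kappa>>0. \<exists>R\<ge>0. \<exists>\<Lambda>\<ge>0. linked d \<kappa> R \<Lambda> c0 c"
  shows "\<exists>\<kappa>>0. \<exists>R\<ge>0. \<exists>\<Lambda>\<ge>0. \<forall>c\<in>F. linked d \<kappa> R \<Lambda> c0 c"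
  using assms
proof (induction F rule: finite_induct)
  case empty
  then show ?case by (auto intro: exI[of _ 1])
next
  case (insert x F)
  obtain \<kappa>1 R1 \<Lambda>1 where 1: "0 < \<kappa>1" "0 \<le> R1" "0 \<le> \<Lambda>1" "\<forall>c\<in>F. linked d \<kappa>1 R1 \<Lambda>1 c0 c"
    using insert by (metis insertCI)
  obtain \<kappa>2 R2 \<Lambda>2 where 2: "0 < \<kappa>2" "0 \<le> R2" "0 \<le> \<Lambda>2" "linked d \<kappa>2 R2 \<Lambda>2 c0 x"
    using insert.prems[of x] by blast
  have "\<forall>c\<in>insert x F. linked d (min \<kappa>1 \<kappa>2) (max R1 R2) (max \<Lambda>1 \<Lambda>2) c0 c"
    using 1(4) 2(4) by (auto intro: linked_mono)
  moreover have "0 < min \<kappa>1 \<kappa>2" "0 \<le> max R1 R2" "0 \<le> max \<Lambda>1 \<Lambda>2" using 1 2 by auto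
  ultimately show ?case by blast
qed

text \<open>Close pairs are joined by a segment, whose length is O(\<open>dFS\<close>) once the
  phases are aligned. Distant pairs are joined through a base point by a path of bounded length; as
  their distance is bounded below, this is again a linear bound.\<close>

lemma W2in_lipschitz_Peps:
  fixes \<epsilon> :: real and d :: nat
  assumes \<epsilon>: "\<epsilon> > 0" and d: "d \<ge> 1" and card: "CARD('n::finite) \<ge> 2"
  shows "\<exists>L::real. \<forall>p\<in>(Peps d \<epsilon> :: (('n \<Rightarrow> nat) \<Rightarrow> complex) set). \<forall>q\<in>Peps d \<epsilon>.
            W2in d p q \<le> ennreal (L * dFS d p q)"
proof (cases "(Peps d \<epsilon> :: (('n \<Rightarrow> nat) \<Rightarrow> complex) set) = {}")
  case False
  let ?S = "unit_Peps d \<epsilon> :: (('n \<Rightarrow> nat) \<Rightarrow> complex) set"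
  define Cw where "Cw = bw_const d TYPE('n)"
  have Cw: "0 \<le> Cw" by (simp add: Cw_def bw_const_nonneg)
  have S: "p \<in> polys d" "\<not> singular d p" "coeff_norm d p \<le> Cw" "bw_norm d p = 1" if "p \<in> ?S" for p
    using that Peps_nonsingular[OF _ \<epsilon>, of p d] coeff_norm_le_bw_norm[of d p]
    by (auto simp: unit_Peps_def Peps_polys Cw_def)
  obtain \<kappa>0 where \<kappa>0: "0 < \<kappa>0" "\<And>p. p \<in> ?S \<Longrightarrow> nondeg d \<kappa>0 p"
  proof -
    have "continuous_on ?S (\<lambda>p. p \<alpha>)" for \<alpha>
      by (rule continuous_on_subset[OF continuous_on_product_coordinates]) auto
    from nondeg_of_compact_family[where g="\<lambda>p. p", OF compact_unit_Peps this S(2)]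
    show ?thesis using that by blast
  qed
  define D where "D = 1 + real (CARD('n)) * d"
  have D: "0 < D" by (simp add: D_def add_pos_nonneg)
  \<comment> \<open>A perturbation of this size costs at most half of the nondegeneracy
    \<open>\<kappa>0\<close>.\<close>
  define \<eta> where "\<eta> = \<kappa>0 / (2 * D)"
  have \<eta>: "0 < \<eta>" using \<kappa>0 D by (simp add: \<eta>_def)
  have near: "linked d (\<kappa>0 / 2) Cw (coeff_norm d (\<lambda>a. q a - p a)) p q"
    if p: "p \<in> ?S" and q: "q \<in> ?S" and pq: "coeff_norm d (\<lambda>a. q a - p a) \<le> \<eta>" for p q
  proof (rule linked_segment)
    fix t :: real assume t: "0 \<le> t" "t \<le> 1"
    have "(\<lambda>a. ((1 - of_real t) * p a + of_real t * q a) - p a) = (\<lambda>a. of_real t * (q a - p a))"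
      by (simp add: algebra_simps)
    then have "coeff_norm d (\<lambda>a. ((1 - of_real t) * p a + of_real t * q a) - p a) = t * coeff_norm d (\<lambda>a. q a - p a)"
      using t by (simp add: coeff_norm_scale)
    also have "\<dots> \<le> 1 * \<eta>" using t pq by (intro mult_mono) auto
    finally have "nondeg d (\<kappa>0 - D * \<eta>) (\<lambda>a. (1 - of_real t) * p a + of_real t * q a)"
      unfolding D_def using \<kappa>0(2)[OF p] by (intro nondeg_perturb) auto
    moreover have "\<kappa>0 - D * \<eta> = \<kappa>0 / 2" using D by (simp add: \<eta>_def)
    ultimately show "nondeg d (\<kappa>0 / 2) (\<lambda>a. (1 - of_real t) * p a + of_real t * q a)" by simp
  qed (use S p q \<kappa>0 in auto)
  obtain c0 where c0: "c0 \<in> ?S" using False unit_Peps_normalize by blast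
  define U where "U c = {q :: ('n \<Rightarrow> nat) \<Rightarrow> complex. coeff_norm d (\<lambda>a. q a - c a) < \<eta>}" for c
  have "open (U c)" for c
    unfolding U_def coeff_norm_def
    by (intro open_Collect_less continuous_intros continuous_on_subset[OF continuous_on_product_coordinates]) auto
  moreover have "?S \<subseteq> (\<Union>c\<in>?S. U c)"
  proof
    fix p assume "p \<in> ?S"
    moreover have "p \<in> U p" using \<eta> by (simp add: U_def coeff_norm_def)
    ultimately show "p \<in> (\<Union>c\<in>?S. U c)" by blast
  qed
  \<comment> \<open>With finitely many centres the nonuniform constants of
    \<open>nonsingular_linked\<close> have a common value, and every other point is one short
    segment away from a centre.\<close>
  ultimately obtain F where F: "F \<subseteq> ?S" "finite F" "?S \<subseteq> (\<Union>c\<in>F. U c)"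
    using compactE_image[OF compact_unit_Peps, of ?S U] by metis
  have "\<exists>\<kappa>>0. \<exists>R\<ge>0. \<exists>\<Lambda>\<ge>0. linked d \<kappa> R \<Lambda> c0 c" if "c \<in> F" for c
    using that F(1) S c0 by (intro nonsingular_linked d) auto
  from linked_finite_uniform[OF F(2) this]
  obtain \<kappa>1 R1 \<Lambda>1 where lk: "0 < \<kappa>1" "0 \<le> R1" "0 \<le> \<Lambda>1" "\<And>c. c \<in> F \<Longrightarrow> linked d \<kappa>1 R1 \<Lambda>1 c0 c" by blast
  define \<kappa> where "\<kappa> = min (\<kappa>0 / 2) \<kappa>1"
  define R where "R = max Cw R1"
  define \<Lambda> where "\<Lambda> = max \<eta> \<Lambda>1"
  have pos: "0 < \<kappa>" "0 \<le> R" "0 \<le> \<Lambda>" using \<kappa>0 lk Cw \<eta> by (auto simp: \<kappa>_def R_def \<Lambda>_def)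
  have base: "linked d \<kappa> R (2 * \<Lambda>) c0 p" if p: "p \<in> ?S" for p
  proof -
    obtain c where c: "c \<in> F" "p \<in> U c" using F(3) p by blast
    have "linked d \<kappa> R \<Lambda> c0 c"
      by (rule linked_mono[OF lk(4)[OF c(1)]]) (auto simp: \<kappa>_def R_def \<Lambda>_def)
    moreover have "linked d \<kappa> R \<Lambda> c p"
      by (rule linked_mono[OF near]) (use c F(1) p in \<open>auto simp: \<kappa>_def R_def \<Lambda>_def U_def\<close>)
    ultimately show ?thesis using pos by (intro linked_trans) auto
  qed
  have far: "linked d \<kappa> R (4 * \<Lambda>) p q" if "p \<in> ?S" "q \<in> ?S" for p q
    using linked_trans[OF linked_sym[OF base[OF that(1)]] base[OF that(2)]] pos by simp
  obtain K where K: "0 \<le> K" and KK: "\<And>(p :: ('n \<Rightarrow> nat) \<Rightarrow> complex) q \<Lambda> k l. linked d \<kappa> R \<Lambda> p q \<Longrightarrow> 0 \<le> \<Lambda> \<Longrightarrow> k \<noteq> 0 \<Longrightarrow> l \<noteq> 0 \<Longrightarrow>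
    W2in d (\<lambda>a. k * p a) (\<lambda>a. l * q a) \<le> ennreal (K * \<Lambda>)"
    using W2in_le_linked[OF d card pos(1,2)] by blast
  \<comment> \<open>The summand 1 serves close pairs and \<open>4 * \<Lambda> / \<eta>\<close>
    distant ones, for which \<open>1 \<le> Cw * \<theta> / \<eta>\<close>.\<close>
  define L where "L = K * Cw * (1 + 4 * \<Lambda> / \<eta>)"
  show ?thesis
  proof (intro exI[of _ L] ballI)
    fix p q :: "('n \<Rightarrow> nat) \<Rightarrow> complex" assume p: "p \<in> Peps d \<epsilon>" and q: "q \<in> Peps d \<epsilon>"
    define np where "np = bw_norm d p"
    define nq where "nq = bw_norm d q"
    have n: "0 < np" "0 < nq" using p q by (auto simp: np_def nq_def intro: bw_norm_pos Peps_polys)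
    define p1 where "p1 = (\<lambda>a. of_real (1 / np) * p a)"
    define q1 where "q1 = (\<lambda>a. of_real (1 / nq) * q a)"
    have pS: "p1 \<in> ?S" and qS: "q1 \<in> ?S"
      unfolding p1_def q1_def np_def nq_def using p q by (auto intro!: unit_Peps_normalize simp del: of_real_divide)
    define \<theta> where "\<theta> = dFS d p q"
    have \<theta>: "0 \<le> \<theta>" by (simp add: \<theta>_def dFS_nonneg)
    have \<theta>1: "dFS d p1 q1 = \<theta>" unfolding p1_def q1_def \<theta>_def using n by (intro dFS_scale) auto
    obtain k where k: "cmod k = 1" "bw_norm d (\<lambda>a. k * q1 a - p1 a) \<le> \<theta>"
      using phase_alignment[of d p1 q1] S(4)[OF pS] S(4)[OF qS] \<theta>1 by auto
    have k0: "k \<noteq> 0" using k by auto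
    \<comment> \<open>Rotating the phase changes neither the projective class nor membership in the
      unit representatives, and brings the representative within \<open>\<theta>\<close> of
      \<open>p1\<close>.\<close>
    define q2 where "q2 = (\<lambda>a. k * q1 a)"
    have q2S: "q2 \<in> ?S"
      using qS k k0 Peps_scale[of q1 d \<epsilon> k] by (simp add: q2_def unit_Peps_def bw_norm_scale)
    have dist: "coeff_norm d (\<lambda>a. q2 a - p1 a) \<le> Cw * \<theta>"
      using order_trans[OF coeff_norm_le_bw_norm mult_left_mono[OF k(2) bw_const_nonneg]] by (simp add: q2_def Cw_def)
    have pe: "p = (\<lambda>a. of_real np * p1 a)" using n by (simp add: p1_def)
    have qe: "q = (\<lambda>a. (of_real nq / k) * q2 a)" using n k0 by (simp add: q1_def q2_def)
    have W: "W2in d p q \<le> ennreal (K * \<Lambda>')" if "linked d \<kappa> R \<Lambda>' p1 q2" "0 \<le> \<Lambda>'" for \<Lambda>'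
      using KK[OF that, of "of_real np" "of_real nq / k"] n k0 unfolding pe[symmetric] qe[symmetric] by simp
    show "W2in d p q \<le> ennreal (L * dFS d p q)"
    proof (cases "coeff_norm d (\<lambda>a. q2 a - p1 a) \<le> \<eta>")
      case True
      have "linked d \<kappa> R (Cw * \<theta>) p1 q2"
        by (rule linked_mono[OF near[OF pS q2S True]]) (use dist in \<open>auto simp: \<kappa>_def R_def\<close>)
      then have "W2in d p q \<le> ennreal (K * (Cw * \<theta>))" using Cw \<theta> by (intro W) auto
      also have "\<dots> \<le> ennreal (L * \<theta>)"
      proof (rule ennreal_leI)
        have "K * Cw * \<theta> * 1 \<le> K * Cw * \<theta> * (1 + 4 * \<Lambda> / \<eta>)"
          using K Cw \<theta> pos \<eta> by (intro mult_left_mono) auto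
        then show "K * (Cw * \<theta>) \<le> L * \<theta>" by (simp add: L_def mult_ac)
      qed
      finally show ?thesis by (simp add: \<theta>_def)
    next
      case False
      then have big: "\<eta> \<le> Cw * \<theta>" using dist by simp
      have "W2in d p q \<le> ennreal (K * (4 * \<Lambda>))" using far[OF pS q2S] pos by (intro W) auto
      also have "\<dots> \<le> ennreal (L * \<theta>)"
      proof (rule ennreal_leI)
        have "K * (4 * \<Lambda>) * 1 \<le> K * (4 * \<Lambda>) * (Cw * \<theta> / \<eta>)"
          using K pos big \<eta> by (intro mult_left_mono) auto
        also have "\<dots> = K * Cw * (4 * \<Lambda> / \<eta>) * \<theta>" by simp
        also have "\<dots> \<le> K * Cw * (1 + 4 * \<Lambda> / \<eta>) * \<theta>"
          using K Cw \<theta> by (intro mult_right_mono mult_left_mono) auto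
        finally show "K * (4 * \<Lambda>) \<le> L * \<theta>" by (simp add: L_def)
      qed
      finally show ?thesis by (simp add: \<theta>_def)
    qed
  qed
qed simp

text \<open>Compactness is inherited from the unit representatives: a subsequence of them converges
  coefficientwise, hence in \<open>dFS\<close>, and the Lipschitz bound transfers the convergence to
  \<open>W2in\<close>.\<close>

theorem mainTheorem15:
  fixes \<epsilon> :: real and d :: nat
  assumes "\<epsilon> > 0" and "d \<ge> 1" and "CARD('n::finite) \<ge> 2"
  shows "(\<exists>L::real. \<forall>p\<in>(Peps d \<epsilon> :: (('n \<Rightarrow> nat) \<Rightarrow> complex) set). \<forall>q\<in>Peps d \<epsilon>.
            W2in d p q \<le> ennreal (L * dFS d p q))
       \<and> (\<forall>s::nat \<Rightarrow> (('n \<Rightarrow> nat) \<Rightarrow> complex). (\<forall>k. s k \<in> Peps d \<epsilon>) \<longrightarrow>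
            (\<exists>r p. strict_mono r \<and> p \<in> Peps d \<epsilon> \<and> (\<lambda>k. W2in d (s (r k)) p) \<longlonglongrightarrow> 0))"
proof (intro conjI allI impI)
  show lip: "\<exists>L::real. \<forall>p\<in>(Peps d \<epsilon> :: (('n \<Rightarrow> nat) \<Rightarrow> complex) set). \<forall>q\<in>Peps d \<epsilon>.
            W2in d p q \<le> ennreal (L * dFS d p q)"
    by (rule W2in_lipschitz_Peps[OF assms])
  fix s :: "nat \<Rightarrow> ('n \<Rightarrow> nat) \<Rightarrow> complex" assume s: "\<forall>k. s k \<in> Peps d \<epsilon>"
  obtain L where L: "\<And>p q :: ('n \<Rightarrow> nat) \<Rightarrow> complex. p \<in> Peps d \<epsilon> \<Longrightarrow> q \<in> Peps d \<epsilon> \<Longrightarrow> W2in d p q \<le> ennreal (L * dFS d p q)"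
    using lip by blast
  define \<sigma> where "\<sigma> k = (\<lambda>a. of_real (1 / bw_norm d (s k)) * s k a)" for k
  have \<sigma>: "\<sigma> k \<in> unit_Peps d \<epsilon>" for k unfolding \<sigma>_def using s by (intro unit_Peps_normalize) auto
  have "seq_compact (unit_Peps d \<epsilon> :: (('n \<Rightarrow> nat) \<Rightarrow> complex) set)"
    by (rule compact_imp_seq_compact[OF compact_unit_Peps])
  then obtain p r where p: "p \<in> unit_Peps d \<epsilon>" and r: "strict_mono r" and lim: "(\<sigma> \<circ> r) \<longlonglongrightarrow> p"
    using seq_compactE[of "unit_Peps d \<epsilon>" \<sigma>] \<sigma> by metis
  have pP: "p \<in> Peps d \<epsilon>" "bw_norm d p = 1" using p by (auto simp: unit_Peps_def)
  have "continuous_on UNIV (\<lambda>x. arccos (max (-1) (min 1 (cmod (bw_inner d x p) / bw_norm d p))))"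
    by (rule continuous_on_dFS_formula)
  then have "isCont (\<lambda>x. arccos (max (-1) (min 1 (cmod (bw_inner d x p) / bw_norm d p)))) p"
    by (simp add: continuous_on_eq_continuous_at)
  from isCont_tendsto_compose[OF this lim]
  have "(\<lambda>k. dFS d (\<sigma> (r k)) p) \<longlonglongrightarrow> dFS d p p"
    using \<sigma> p by (simp add: dFS_unit unit_Peps_def)
  moreover have "dFS d (\<sigma> k) p = dFS d (s k) p" for k
  proof -
    have "of_real (1 / bw_norm d (s k)) \<noteq> (0::complex)"
      using bw_norm_pos[OF Peps_polys, of "s k" d \<epsilon>] s by auto
    then show ?thesis using dFS_scale[of "of_real (1 / bw_norm d (s k))" 1 d "s k" p] by (simp add: \<sigma>_def)
  qed
  ultimately have "(\<lambda>k. dFS d (s (r k)) p) \<longlonglongrightarrow> 0"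
    using dFS_self[OF Peps_polys[OF pP(1)]] by simp
  then have "(\<lambda>k. L * dFS d (s (r k)) p) \<longlonglongrightarrow> L * 0" by (rule tendsto_mult_left)
  then have lim0: "(\<lambda>k. ennreal (L * dFS d (s (r k)) p)) \<longlonglongrightarrow> 0" using tendsto_ennrealI by fastforce
  have "(\<lambda>k. W2in d (s (r k)) p) \<longlonglongrightarrow> 0"
    by (rule tendsto_sandwich[OF _ _ tendsto_const lim0]) (use L s pP in auto)
  then show "\<exists>r p. strict_mono r \<and> p \<in> Peps d \<epsilon> \<and> (\<lambda>k. W2in d (s (r k)) p) \<longlonglongrightarrow> 0"
    using r pP by blast
qed

end
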